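(* Let $p$ be an odd prime, $m$ a positive integer, and $G$ a group of order $2p^m$. Suppose that $(G,\{\sigma_1,\sigma_2\})$ is the automorphism group (with its distinguished generators) of a chiral polyhedron $\mathcal{P}$ of type $\{k_1,k_2\}$. Let $P$ be a Sylow $p$-subgroup of $G$. Then: (1) $G = P \rtimes \langle \sigma_1\sigma_2\rangle$ (that is, $P$ is normal in $G$, $P\cap\langle\sigma_1\sigma_2\rangle=\{1\}$ and $G=P\langle\sigma_1\sigma_2\rangle$). (2) Up to duality, $\{k_1,k_2\}=\{p^{l_1},2p^{l_2}\}$ for some positive integers $l_1,l_2$; that is, there are positive integers $l_1,l_2$ such that $(k_1,k_2)=(p^{l_1},2p^{l_2})$ or $(k_1,k_2)=(2p^{l_2},p^{l_1})$. (3) If, up to duality, $(k_1,k_2)=(p^{l_1},2p^{l_2})$ as in (2), then $P=\langle \sigma_1,\sigma_2^2\rangle$. Moreover $d(P)=2$ and $P$ is not abelian (so $m\ge 3$). (4) $\mathcal{P}$ is tight, that is $k_1k_2=2p^m$, if and only if $P$ is a metacyclic group.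
   Context: Abstract polyhedra. An abstract polyhedron (abstract polytope of rank $3$) is a partially ordered set $\mathcal{P}$ with a strictly monotone rank function with range $\{-1,0,1,2,3\}$ such that: (P1) there is a least face $F_{-1}$ and a greatest face $F_3$; (P2) every flag (maximal chain) contains exactly $5$ elements; (P3) any two flags $\Phi,\Psi$ can be joined by a sequence of flags $\Phi=\Phi_0,\dots,\Phi_k=\Psi$, each containing $\Phi\cap\Psi$, with consecutive flags differing in exactly one element; (P4) if $F<G$ have ranks $i-1$ and $i+1$ with $0\le i\le 2$, there are exactly two elements $H$ of rank $i$ with $F<H<G$. For a flag $\Phi$ and $i\in\{0,1,2\}$, $\Phi^i$ denotes the unique flag differing from $\Phi$ exactly in its element of rank $i$ (the $i$-adjacent flag). $\mathrm{Aut}(\mathcal{P})$ is the group of order-preserving permutations of $\mathcal{P}$ (acting on the right). $\mathcal{P}$ is chiral if $\mathrm{Aut}(\mathcal{P})$ has exactly two orbits on flags and adjacent flags always lie in different orbits. Then $\mathcal{P}$ is equivelar: it has type $\{k_1,k_2\}$ (an ordered pair), where $k_1$ is the number of edges of each $2$-face and $k_2$ is the valency of each vertex. Fix a base flag $\Phi$. The distinguished generators of $G=\mathrm{Aut}(\mathcal{P})$ are the automorphisms $\sigma_1,\sigma_2$ with $\sigma_j$ taking $\Phi$ to $(\Phi^{j})^{j-1}$; $\sigma_1,\sigma_2$ have orders $k_1,k_2$. "$(G,\{\sigma_1,\sigma_2\})$ is the automorphism group of $\mathcal{P}$" means $G=\mathrm{Aut}(\mathcal{P})$ with these generators. Standard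 group-theoretic characterization (Schulte–Weiss): a finite group $G$ with elements $\sigma_1,\sigma_2$ is of the form $(\mathrm{Aut}(\mathcal{P}),\{\sigma_1,\sigma_2\})$ for a chiral polyhedron $\mathcal{P}$ of type $\{k_1,k_2\}$ if and only if $G=\langle\sigma_1,\sigma_2\rangle$, $\sigma_1,\sigma_2,\sigma_1\sigma_2$ have orders $k_1,k_2,2$, $\langle\sigma_1\rangle\cap\langle\sigma_2\rangle=\{1\}$, and there is no automorphism $\alpha$ of $G$ with $\sigma_1^\alpha=\sigma_1^{-1}$ and $\sigma_2^\alpha=\sigma_2^{-1}$. Duality reverses the partial order of $\mathcal{P}$ and interchanges $k_1$ and $k_2$ (in terms of generators, the roles of $\sigma_1$ and $\sigma_2$ are interchanged up to inversion). The polyhedron $\mathcal{P}$ of type $\{k_1,k_2\}$ is tight if $|\mathrm{Aut}(\mathcal{P})|=k_1k_2$. $d(P)$ is the size of a smallest generating set of $P$. A finite group is metacyclic if it has a cyclic normal subgroup with cyclic quotient. *)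

theory Defs
  imports "HOL-Algebra.Algebra"
begin

text \<open>
  A poset is given by its reflexive order relation \<open>r\<close>; its elements are those of \<^term>\<open>Field r\<close>.
  The strict order is \<open>r - Id\<close>.
\<close>

section \<open>Flags\<close>

definition flag :: "'a rel \<Rightarrow> 'a set \<Rightarrow> bool" where
  "flag r \<Phi> \<longleftrightarrow> pred_on.maxchain (Field r) (\<lambda>x y. (x, y) \<in> r) \<Phi>"

definition adjacent :: "'a set \<Rightarrow> 'a set \<Rightarrow> bool" where
  "adjacent \<Phi> \<Psi> \<longleftrightarrow> card (\<Phi> - \<Psi>) = 1 \<and> card (\<Psi> - \<Phi>) = 1"

definition adj_flag :: "'a rel \<Rightarrow> ('a \<Rightarrow> int) \<Rightarrow> int \<Rightarrow> 'a set \<Rightarrow> 'a set" where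
  "adj_flag r rk i \<Phi> =
     (THE \<Psi>. flag r \<Psi> \<and> \<Psi> \<noteq> \<Phi> \<and> {x \<in> \<Psi>. rk x \<noteq> i} = {x \<in> \<Phi>. rk x \<noteq> i})"


section \<open>Abstract polyhedra\<close>

text \<open>
  The rank function is a parameter; by P2 and strict monotonicity the order determines it
  uniquely.
\<close>

locale abstract_polyhedron =
  fixes r :: "'a rel" and rk :: "'a \<Rightarrow> int"
  assumes poset: "Partial_order r"
    and rank_range: "rk ` Field r = {-1, 0, 1, 2, 3}"
    and rank_strict_mono: "\<And>x y. (x, y) \<in> r - Id \<Longrightarrow> rk x < rk y"
    and P1_least: "\<exists>x\<in>Field r. \<forall>y\<in>Field r. (x, y) \<in> r"
    and P1_greatest: "\<exists>x\<in>Field r. \<forall>y\<in>Field r. (y, x) \<in> r"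
    and P2: "\<And>\<Phi>. flag r \<Phi> \<Longrightarrow> card \<Phi> = 5"
    and P3: "\<And>\<Phi> \<Psi>. flag r \<Phi> \<Longrightarrow> flag r \<Psi> \<Longrightarrow>
        \<exists>(k::nat) \<Theta>. \<Theta> 0 = \<Phi> \<and> \<Theta> k = \<Psi> \<and>
          (\<forall>j\<le>k. flag r (\<Theta> j) \<and> \<Phi> \<inter> \<Psi> \<subseteq> \<Theta> j) \<and>
          (\<forall>j<k. adjacent (\<Theta> j) (\<Theta> (Suc j)))"
    and P4: "\<And>F G i. i \<in> {0, 1, 2} \<Longrightarrow> (F, G) \<in> r - Id \<Longrightarrow> rk F = i - 1 \<Longrightarrow> rk G = i + 1 \<Longrightarrow>
        card {H \<in> Field r. rk H = i \<and> (F, H) \<in> r - Id \<and> (H, G) \<in> r - Id} = 2"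

text \<open>
  Automorphisms act on the right, so \<open>f \<otimes> g\<close> applies \<open>f\<close> first; this is the opposite of the
  composition in \<^const>\<open>BijGroup\<close>. As there, automorphisms are extensional functions, so that
  each is determined by its values on the poset.
\<close>

definition Aut :: "'a rel \<Rightarrow> ('a \<Rightarrow> 'a) monoid" where
  "Aut r =
    \<lparr>carrier = {f \<in> Bij (Field r). \<forall>x\<in>Field r. \<forall>y\<in>Field r. (x, y) \<in> r \<longleftrightarrow> (f x, f y) \<in> r},
     monoid.mult = \<lambda>f g. compose (Field r) g f,
     one = \<lambda>x\<in>Field r. x\<rparr>"

lemma group_Aut: "group (Aut r)"
proof (rule groupI)
  fix f assume "f \<in> carrier (Aut r)"
  then have f: "f \<in> Bij (Field r)"
    and iff: "\<And>x y. x \<in> Field r \<Longrightarrow> y \<in> Field r \<Longrightarrow> (x, y) \<in> r \<longleftrightarrow> (f x, f y) \<in> r"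
    by (auto simp: Aut_def)
  let ?g = "\<lambda>x\<in>Field r. inv_into (Field r) f x"
  have im: "f ` Field r = Field r" and inj: "inj_on f (Field r)"
    using f by (auto simp: Bij_def bij_betw_def)
  have "?g \<in> carrier (Aut r)"
    using restrict_inv_into_Bij[OF f] iff Bij_inv_into_mem[OF f] im
    by (auto simp: Aut_def f_inv_into_f)
  moreover have "?g \<otimes>\<^bsub>Aut r\<^esub> f = \<one>\<^bsub>Aut r\<^esub>"
    using im by (auto simp: Aut_def compose_def f_inv_into_f restrict_def fun_eq_iff)
  ultimately show "\<exists>g\<in>carrier (Aut r). g \<otimes>\<^bsub>Aut r\<^esub> f = \<one>\<^bsub>Aut r\<^esub>" by blast
next
  fix f g assume "f \<in> carrier (Aut r)" "g \<in> carrier (Aut r)"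
  then show "f \<otimes>\<^bsub>Aut r\<^esub> g \<in> carrier (Aut r)"
    using Bij_imp_funcset[of f "Field r"]
    by (auto simp: Aut_def compose_Bij compose_eq Pi_iff)
qed (auto simp: Aut_def id_Bij Bij_imp_funcset Bij_imp_extensional compose_assoc
      compose_Id[OF Bij_imp_funcset Bij_imp_extensional])

text \<open>
  As \<open>Aut r\<close> acts on flags from the right, \<open>\<lambda>f \<Phi>. f ` \<Phi>\<close> is an anti-homomorphism and not an
  instance of \<^locale>\<open>group_action\<close>; \<^const>\<open>orbit\<close> and \<^const>\<open>orbits\<close> do not depend on this.
\<close>

locale chiral_polyhedron = abstract_polyhedron +
  assumes two_flag_orbits: "card (orbits (Aut r) {\<Phi>. flag r \<Phi>} (\<lambda>f \<Phi>. f ` \<Phi>)) = 2"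
    and adjacent_orbits_differ: "\<And>\<Phi> \<Psi>. flag r \<Phi> \<Longrightarrow> flag r \<Psi> \<Longrightarrow> adjacent \<Phi> \<Psi> \<Longrightarrow>
        orbit (Aut r) (\<lambda>f \<Phi>. f ` \<Phi>) \<Phi> \<noteq> orbit (Aut r) (\<lambda>f \<Phi>. f ` \<Phi>) \<Psi>"

text \<open>As \<^const>\<open>card\<close> of an infinite set is \<open>0\<close>, an entry \<open>0\<close> of the type stands for \<open>\<infinity>\<close>.\<close>

definition has_type :: "'a rel \<Rightarrow> ('a \<Rightarrow> int) \<Rightarrow> nat \<Rightarrow> nat \<Rightarrow> bool" where
  "has_type r rk k\<^sub>1 k\<^sub>2 \<longleftrightarrow>
     (\<forall>F\<in>Field r. rk F = 2 \<longrightarrow> card {E \<in> Field r. rk E = 1 \<and> (E, F) \<in> r} = k\<^sub>1) \<and>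
     (\<forall>v\<in>Field r. rk v = 0 \<longrightarrow> card {E \<in> Field r. rk E = 1 \<and> (v, E) \<in> r} = k\<^sub>2)"

definition tight :: "'a rel \<Rightarrow> ('a \<Rightarrow> int) \<Rightarrow> bool" where
  "tight r rk \<longleftrightarrow> finite (carrier (Aut r)) \<and>
     (\<exists>k\<^sub>1 k\<^sub>2. has_type r rk k\<^sub>1 k\<^sub>2 \<and> order (Aut r) = k\<^sub>1 * k\<^sub>2)"

definition distinguished_generators ::
    "'a rel \<Rightarrow> ('a \<Rightarrow> int) \<Rightarrow> 'a set \<Rightarrow> ('a \<Rightarrow> 'a) \<Rightarrow> ('a \<Rightarrow> 'a) \<Rightarrow> bool" where
  "distinguished_generators r rk \<Phi> \<sigma>\<^sub>1 \<sigma>\<^sub>2 \<longleftrightarrow>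
     \<sigma>\<^sub>1 \<in> carrier (Aut r) \<and> \<sigma>\<^sub>1 ` \<Phi> = adj_flag r rk 0 (adj_flag r rk 1 \<Phi>) \<and>
     \<sigma>\<^sub>2 \<in> carrier (Aut r) \<and> \<sigma>\<^sub>2 ` \<Phi> = adj_flag r rk 1 (adj_flag r rk 2 \<Phi>)"


section \<open>Group theory\<close>

definition sylow_subgroup :: "nat \<Rightarrow> 'a set \<Rightarrow> ('a, 'b) monoid_scheme \<Rightarrow> bool" where
  "sylow_subgroup p P G \<longleftrightarrow> subgroup P G \<and> card P = p ^ multiplicity p (order G)"

definition min_gen_size :: "('a, 'b) monoid_scheme \<Rightarrow> nat" where
  "min_gen_size G =
     (LEAST n. \<exists>S\<subseteq>carrier G. finite S \<and> card S = n \<and> generate G S = carrier G)"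

definition metacyclic_group :: "('a, 'b) monoid_scheme \<Rightarrow> bool" where
  "metacyclic_group G \<longleftrightarrow>
     (\<exists>N. N \<lhd> G \<and> cyclic_group (G\<lparr>carrier := N\<rparr>) \<and> cyclic_group (G Mod N))"

end

theory Submission
  imports Defs "HOL-Number_Theory.Residues"
begin

text \<open>
  Since a chiral polyhedron has two flag orbits, each flag is \<open>\<Phi>g\<close> or \<open>\<Phi>\<^sup>1g\<close> for a unique automorphism
  \<open>g\<close>, and passing to an adjacent flag multiplies \<open>g\<close> on the left by some \<open>\<sigma>\<^sub>i\<close> or its inverse. Connectivity
  then yields that \<open>\<sigma>\<^sub>1, \<sigma>\<^sub>2\<close> generate the group, with orders \<open>k\<^sub>1, k\<^sub>2\<close>, \<open>\<sigma>\<^sub>1\<sigma>\<^sub>2\<close> of order 2 and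
  \<open>\<langle>\<sigma>\<^sub>1\<rangle> \<inter> \<langle>\<sigma>\<^sub>2\<rangle> = 1\<close>, and that no automorphism inverts both generators.

  The involution \<open>\<sigma>\<^sub>1\<sigma>\<^sub>2\<close> lies outside the subgroup \<open>P\<close> of index 2, so exactly one generator, say \<open>\<sigma>\<^sub>1\<close>, is
  in \<open>P\<close>, and \<open>P = \<langle>\<sigma>\<^sub>1, \<sigma>\<^sub>2\<^sup>2\<rangle>\<close>. Tightness means \<open>P = \<langle>\<sigma>\<^sub>1\<rangle>\<langle>\<sigma>\<^sub>2\<^sup>2\<rangle>\<close>. For odd \<open>p\<close> a \<open>p\<close>-group that is a
  product of two cyclic subgroups is metacyclic (Huppert). Conversely, let \<open>\<langle>n\<rangle>\<close> be normal with cyclic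
  quotient and \<open>x, y\<close> generators; after exchanging \<open>x\<close> and \<open>y\<close> and changing \<open>n\<close>, \<open>y\<close> generates the
  quotient and \<open>x = nv\<close> with \<open>v \<in> \<langle>y\<rangle>\<close>. Then \<open>x\<^sup>k = n\<^sup>e v\<^sup>k\<close> with \<open>e = 1 + q + \<dots> + q\<^sup>k\<^sup>-\<^sup>1\<close> and
  \<open>q \<equiv> 1 (mod p)\<close>, and \<open>e\<close> runs through all residues modulo any power of \<open>p\<close>, so \<open>P = \<langle>x\<rangle>\<langle>y\<rangle>\<close>.
\<close>

section \<open>Geometric sums modulo prime powers\<close>

text \<open>The obstacle in Huppert's theorem is lifting: a metacyclic factorization of a quotient
  by \<langle>z\<rangle>, with \<open>z\<close> central of order \<open>p\<close>, only makes
  \<langle>n, z\<rangle> normal, and \<open>z\<close> may stay outside \<langle>n\<rangle>. The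
  choice of \<open>z\<close> removes this. Let T be the smallest normal subgroup modulo which all
  commutators are central with trivial \<open>p\<close>-th power. If T is nontrivial,
  \<open>z\<close> is taken inside T, which forces \<open>z\<close> into \<langle>n\<rangle>; if T
  is trivial, the class is at most two and a factorization can be written down. Oddness of
  \<open>p\<close> enters both directions through the same fact, that \<open>p\<close> divides
  \<open>p (p - 1) / 2\<close>: the commutator factor in a \<open>p^k\<close>-th power of a product
  disappears, and a geometric sum with \<open>q\<close> congruent to 1 contains no more factors
  \<open>p\<close> than its length. The absence of an inverting automorphism is used three times: it
  excludes a trivial \<open>s\<close>, a trivial \<open>t^2\<close>, and an abelian
  \<open>P\<close>.\<close>

lemma geometric_sum_prime_not_square_dvd:
  fixes p q :: nat
  assumes "Factorial_Ring.prime p" "odd p" "[q = 1] (mod p)"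
  shows "\<not> p\<^sup>2 dvd (\<Sum>i<p. q ^ i)"
proof -
  obtain c where c: "int q = 1 + int p * c"
  proof -
    have "[int q = 1] (mod int p)"
      using assms(3) by (metis cong_int_iff of_nat_1)
    then show ?thesis
      using that by (metis add.commute cong_iff_lin cong_sym)
  qed
  \<comment> \<open>Modulo \<open>p^2\<close> only the linear term of the binomial expansion of
    \<open>(1 + p c)^i\<close> survives. Summing over \<open>i < p\<close> multiplies it by
    \<open>p (p - 1) / 2\<close>, a multiple of \<open>p\<close> because \<open>p\<close> is odd;
    for \<open>p = 2\<close>, \<open>q = 3\<close> the sum is 4.\<close>
  have pow: "[int q ^ i = 1 + int i * (int p * c)] (mod (int p)\<^sup>2)" for i
  proof (induction i)
    case (Suc i)
    have "[int q ^ Suc i = (1 + int p * c) * (1 + int i * (int p * c))] (mod (int p)\<^sup>2)"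
      using Suc c by (simp add: cong_scalar_left)
    also have "(1 + int p * c) * (1 + int i * (int p * c)) =
        1 + int (Suc i) * (int p * c) + (int p)\<^sup>2 * (int i * c\<^sup>2)"
      by (simp add: algebra_simps power2_eq_square)
    also have "[\<dots> = 1 + int (Suc i) * (int p * c)] (mod (int p)\<^sup>2)"
      by (simp add: cong_def)
    finally show ?case .
  qed auto
  obtain h where h: "p = 2 * h + 1"
    using assms(2) by (elim oddE)
  have gauss: "(\<Sum>i<p. int i) = int p * int h"
  proof -
    have "(\<Sum>i<2 * h + 1. int i) = int (2 * h + 1) * int h" for h
      by (induction h) (auto simp: algebra_simps)
    then show ?thesis using h by simp
  qed
  have "[(\<Sum>i<p. int q ^ i) = (\<Sum>i<p. 1 + int i * (int p * c))] (mod (int p)\<^sup>2)"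
    by (rule cong_sum) (rule pow)
  also have "(\<Sum>i<p. 1 + int i * (int p * c)) = int p + (\<Sum>i<p. int i) * (int p * c)"
    by (simp add: sum.distrib sum_distrib_right)
  also have "\<dots> = int p + (int p)\<^sup>2 * (int h * c)"
    unfolding gauss by (simp add: power2_eq_square)
  also have "[\<dots> = int p] (mod (int p)\<^sup>2)"
    by (simp add: cong_def)
  finally have cong: "[int (\<Sum>i<p. q ^ i) = int p] (mod int (p\<^sup>2))"
    by simp
  show ?thesis
  proof
    assume "p\<^sup>2 dvd (\<Sum>i<p. q ^ i)"
    then have "p\<^sup>2 dvd p"
      using cong by (metis cong_dvd_iff cong_int_iff)
    then have "p\<^sup>2 \<le> p"
      using assms(1) by (simp add: dvd_imp_le prime_gt_0_nat)
    then show False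
      using assms(1) by (metis leD power_one_right prime_gt_1_nat power_strict_increasing one_less_numeral_iff semiring_norm(76))
  qed
qed

text \<open>The factorization of \<open>(x^(m k) - 1) / (x - 1)\<close> through
  \<open>x^m - 1\<close>, obtained by cutting the sum into \<open>k\<close> blocks of length
  \<open>m\<close>, so that \<open>q = 1\<close> is covered as well.\<close>

lemma geometric_sum_mult:
  fixes q :: nat
  shows "(\<Sum>i<m * k. q ^ i) = (\<Sum>i<m. q ^ i) * (\<Sum>i<k. (q ^ m) ^ i)"
proof (induction k)
  case (Suc k)
  have add: "(\<Sum>i<a + b. q ^ i) = (\<Sum>i<a. q ^ i) + q ^ a * (\<Sum>i<b. q ^ i)" for a b
    by (induction b) (auto simp: algebra_simps power_add)
  have "(\<Sum>i<m * Suc k. q ^ i) = (\<Sum>i<m * k. q ^ i) + q ^ (m * k) * (\<Sum>i<m. q ^ i)"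
    using add[of "m * k" m] by (simp add: add.commute)
  then show ?case
    using Suc by (simp add: algebra_simps flip: power_mult)
qed auto

text \<open>A form of lifting the exponent. Modulo \<open>p\<close> the sum is \<open>k\<close>, so
  \<open>k = p k'\<close>; the block of length \<open>p\<close> carries exactly one factor
  \<open>p\<close>, and the remaining factor is a sum of length \<open>k'\<close> with
  \<open>q^p\<close> in place of \<open>q\<close>. Hence \<open>q\<close> is general in the
  induction.\<close>

lemma prime_power_dvd_geometric_sum:
  fixes p q :: nat
  assumes p: "Factorial_Ring.prime p" "odd p"
  shows "\<lbrakk>[q = 1] (mod p); p ^ s dvd (\<Sum>i<k. q ^ i)\<rbrakk> \<Longrightarrow> p ^ s dvd k"
proof (induction s arbitrary: q k)
  case (Suc s)
  have "[(\<Sum>i<k. q ^ i) = (\<Sum>i<k. 1)] (mod p)"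
    using Suc.prems(1) by (intro cong_sum) (metis cong_pow power_one)
  moreover have "p dvd (\<Sum>i<k. q ^ i)"
    using Suc.prems(2) by (metis dvd_mult_left power_Suc)
  ultimately have "p dvd k"
    by (metis card_lessThan cong_dvd_iff sum_constant mult.right_neutral of_nat_id)
  then obtain k' where k': "k = p * k'" ..
  let ?E = "\<Sum>i<p. q ^ i" and ?F = "\<Sum>i<k'. (q ^ p) ^ i"
  have "p ^ Suc s dvd ?E * ?F"
    using Suc.prems(2) unfolding k' geometric_sum_mult .
  moreover have "[?E = (\<Sum>i<p. 1)] (mod p)"
    using Suc.prems(1) by (intro cong_sum) (metis cong_pow power_one)
  then have "p dvd ?E"
    by (metis card_lessThan cong_dvd_iff sum_constant mult.right_neutral of_nat_id dvd_refl)
  then obtain e where e: "?E = p * e" ..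
  have "\<not> p dvd e"
    using geometric_sum_prime_not_square_dvd[OF p Suc.prems(1)] e
    by (metis mult_dvd_mono dvd_refl power2_eq_square)
  then have "coprime (p ^ s) e"
    using p(1) by (simp add: prime_imp_coprime)
  moreover have "p ^ s dvd e * ?F"
    using \<open>p ^ Suc s dvd ?E * ?F\<close> e p(1) by (simp add: mult.assoc prime_gt_0_nat)
  ultimately have "p ^ s dvd ?F"
    by (simp add: coprime_dvd_mult_right_iff)
  moreover have "[q ^ p = 1] (mod p)"
    using Suc.prems(1) by (metis cong_pow power_one)
  ultimately have "p ^ s dvd k'"
    using Suc.IH by blast
  then show ?case
    using k' by simp
qed auto

text \<open>Fermat's congruence for \<open>q^p\<close>, iterated, with multiples of \<open>p\<close>
  included. It serves to recover \<open>q\<close> modulo \<open>p\<close> from the action of an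
  element whose \<open>p^M\<close>-th power is trivial.\<close>

lemma cong_power_prime_power:
  fixes p q :: nat
  assumes "Factorial_Ring.prime p"
  shows "[q ^ p ^ M = q] (mod p)"
proof (induction M)
  case (Suc M)
  have fermat: "[q ^ p = q] (mod p)"
  proof (cases "p dvd q")
    case True
    then show ?thesis
      using assms by (metis cong_0_iff cong_sym cong_trans dvd_power_le dvd_power prime_gt_0_nat dvd_trans)
  next
    case False
    then have "[q ^ (p - 1) * q = 1 * q] (mod p)"
      using fermat_theorem[OF assms] by (intro cong_mult) auto
    then show ?thesis
      using assms by (metis mult_1 power_minus_mult prime_gt_0_nat)
  qed
  have "[(q ^ p ^ M) ^ p = q ^ p] (mod p)"
    using Suc by (rule cong_pow)
  then show ?case
    using fermat by (metis cong_trans power_Suc2 power_mult)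
qed simp

lemma geometric_sum_add:
  fixes q :: nat
  shows "(\<Sum>i<a + b. q ^ i) = (\<Sum>i<a. q ^ i) + q ^ a * (\<Sum>i<b. q ^ i)"
  by (induction b) (auto simp: algebra_simps power_add)

text \<open>Pigeonhole. Sums of lengths \<open>l \<le> k\<close> differ by \<open>q^l\<close> times
  a sum of length \<open>k - l\<close>, and \<open>q\<close> is a unit modulo \<open>p\<close>, so
  equal residues force \<open>p^s\<close> to divide \<open>k - l\<close>. The lengths below
  \<open>p^s\<close> therefore give all residues.\<close>

lemma geometric_sum_surj:
  fixes p q t :: nat
  assumes p: "Factorial_Ring.prime p" "odd p" and q: "[q = 1] (mod p)"
  obtains k where "[(\<Sum>i<k. q ^ i) = t] (mod p ^ s)"
proof -
  have pos: "0 < p ^ s"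
    using p(1) by (simp add: prime_gt_0_nat)
  have "coprime q p"
    using q by (metis cong_imp_coprime cong_sym coprime_1_left)
  then have cop: "coprime (p ^ s) (q ^ l)" for l
    by (simp add: coprime_commute)
  define e where "e k = (\<Sum>i<k. q ^ i) mod p ^ s" for k
  have inj: "k = l" if "k < p ^ s" "l \<le> k" "e k = e l" for k l
  proof -
    have "[(\<Sum>i<l. q ^ i) + q ^ l * (\<Sum>i<k - l. q ^ i) = (\<Sum>i<l. q ^ i) + 0] (mod p ^ s)"
      using that geometric_sum_add[of q l "k - l"] unfolding e_def cong_def by simp
    then have "[q ^ l * (\<Sum>i<k - l. q ^ i) = 0] (mod p ^ s)"
      by (simp only: cong_add_lcancel_nat)
    then have "p ^ s dvd q ^ l * (\<Sum>i<k - l. q ^ i)"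
      by (simp add: cong_0_iff)
    then have "p ^ s dvd (\<Sum>i<k - l. q ^ i)"
      using cop by (simp add: coprime_dvd_mult_right_iff)
    then have "p ^ s dvd k - l"
      by (rule prime_power_dvd_geometric_sum[OF p q])
    then show ?thesis
      using that by (metis diff_is_0_eq le_antisym less_imp_diff_less nat_dvd_not_less not_gr_zero)
  qed
  have "inj_on e {..<p ^ s}"
  proof (rule inj_onI)
    fix k l assume "k \<in> {..<p ^ s}" "l \<in> {..<p ^ s}" "e k = e l"
    then show "k = l"
      using inj[of k l] inj[of l k] by (cases "l \<le> k") auto
  qed
  moreover have "e ` {..<p ^ s} \<subseteq> {..<p ^ s}"
    using pos by (auto simp: e_def)
  ultimately have "e ` {..<p ^ s} = {..<p ^ s}"
    by (simp add: endo_inj_surj)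
  moreover have "t mod p ^ s \<in> {..<p ^ s}"
    using pos by simp
  ultimately obtain k where "e k = t mod p ^ s"
    by (metis imageE)
  then show thesis
    using that unfolding e_def cong_def by blast
qed

text \<open>The sum \<open>0 + ... + (n - 1)\<close> is the number of commutators collected when
  \<open>(x y)^n\<close> is sorted in a group of class two.\<close>

lemma odd_prime_dvd_sum_lessThan:
  fixes p n :: nat
  assumes "Factorial_Ring.prime p" "odd p" "p dvd n"
  shows "p dvd (\<Sum>i<n. i)"
proof -
  have "2 * (\<Sum>i<n. i) = n * (n - 1)" for n :: nat
    by (induction n) (auto simp: algebra_simps)
  then have "p dvd 2 * (\<Sum>i<n. i)"
    using assms(3) by simp
  then show ?thesis
    using assms(1,2) by (metis prime_dvd_mult_iff primes_dvd_imp_eq two_is_prime_nat even_numeral)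
qed

section \<open>Products of cyclic subgroups\<close>

context group
begin

lemma inv_mult_cancel [simp]:
  assumes "g \<in> carrier G" "x \<in> carrier G"
  shows "inv g \<otimes> (g \<otimes> x) = x" "g \<otimes> (inv g \<otimes> x) = x"
  using assms by (simp_all flip: m_assoc)

lemma conj_hom:
  assumes g: "g \<in> carrier G"
  shows "(\<lambda>x. inv g \<otimes> x \<otimes> g) \<in> hom G G"
proof (rule homI)
  fix x y assume xy: "x \<in> carrier G" "y \<in> carrier G"
  show "inv g \<otimes> (x \<otimes> y) \<otimes> g = (inv g \<otimes> x \<otimes> g) \<otimes> (inv g \<otimes> y \<otimes> g)"
    using g xy by (simp add: m_assoc)
qed (use g in simp)

lemma conj_nat_pow:
  assumes "g \<in> carrier G" "x \<in> carrier G"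
  shows "inv g \<otimes> x [^] (k::nat) \<otimes> g = (inv g \<otimes> x \<otimes> g) [^] k"
proof -
  interpret group_hom G G "\<lambda>x. inv g \<otimes> x \<otimes> g"
    using conj_hom[OF assms(1)] by unfold_locales
  show ?thesis using hom_nat_pow[OF assms(2)] .
qed

lemma generate_singleton_nat_pow:
  "finite (carrier G) \<Longrightarrow> a \<in> carrier G \<Longrightarrow> generate G {a} = range (\<lambda>k::nat. a [^] k)"
  using generate_pow_on_finite_carrier[of a] by blast

lemma generate_singleton_int_pow: "a \<in> carrier G \<Longrightarrow> generate G {a} = range (\<lambda>k::int. a [^] k)"
  by (auto simp: generate_pow)

lemma generate_singleton_subgroup: "a \<in> carrier G \<Longrightarrow> subgroup (generate G {a}) G"
  by (simp add: generate_is_subgroup)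

lemma nat_pow_mem_subgroup: "subgroup H G \<Longrightarrow> x \<in> H \<Longrightarrow> x [^] (k::nat) \<in> H"
  using subgroup_int_pow_closed[of H x "int k"] by (simp add: int_pow_int)

lemma nat_pow_mem_generate: "a \<in> carrier G \<Longrightarrow> a [^] (k::nat) \<in> generate G {a}"
  by (intro nat_pow_mem_subgroup generate_singleton_subgroup generate.incl) auto

text \<open>The factorization of the group as \<langle>a\<rangle>\<langle>b\<rangle>, stated by
  elements so that homomorphisms carry it along. Natural exponents exhaust the cyclic subgroups of a
  finite group.\<close>

definition cyclic_factors :: "'a \<Rightarrow> 'a \<Rightarrow> bool" where
  "cyclic_factors a b \<longleftrightarrow> a \<in> carrier G \<and> b \<in> carrier G \<and>
     (\<forall>g\<in>carrier G. \<exists>(i::nat) (j::nat). g = a [^] i \<otimes> b [^] j)"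

lemma cyclic_factorsE:
  assumes "cyclic_factors a b" "g \<in> carrier G"
  obtains i j :: nat where "g = a [^] i \<otimes> b [^] j"
  using assms unfolding cyclic_factors_def by (elim conjE bspec[elim_format] exE)

text \<open>A metacyclic group described from inside: \<open>n\<close> generates the normal subgroup
  and \<open>y\<close> represents a generator of the quotient. Without cosets, the pair is easily
  lifted from a quotient group.\<close>

definition metacyclic_factors :: "'a \<Rightarrow> 'a \<Rightarrow> bool" where
  "metacyclic_factors n y \<longleftrightarrow> cyclic_factors n y \<and> generate G {n} \<lhd> G"

text \<open>The elements conjugating \<open>n\<close> into \<langle>n\<rangle> are closed under
  products, and in a finite group the inverse of a generator is one of its powers.\<close>

lemma normal_generate_singletonI:
  assumes fin: "finite (carrier G)" and A: "A \<subseteq> carrier G" "generate G A = carrier G"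
    and n: "n \<in> carrier G" and conj: "\<And>a. a \<in> A \<Longrightarrow> inv a \<otimes> n \<otimes> a \<in> generate G {n}"
  shows "generate G {n} \<lhd> G"
proof -
  define S where "S g \<longleftrightarrow> inv g \<otimes> n \<otimes> g \<in> generate G {n}" for g
  have mult: "S (g \<otimes> h)" if gh: "g \<in> carrier G" "h \<in> carrier G" and "S g" "S h" for g h
  proof -
    obtain k :: nat where k: "inv g \<otimes> n \<otimes> g = n [^] k"
      using \<open>S g\<close> unfolding S_def generate_singleton_nat_pow[OF fin n] by (elim rangeE)
    have "inv (g \<otimes> h) \<otimes> n \<otimes> (g \<otimes> h) = inv h \<otimes> (inv g \<otimes> n \<otimes> g) \<otimes> h"
      using gh n by (simp add: inv_mult_group m_assoc)
    also have "\<dots> = (inv h \<otimes> n \<otimes> h) [^] k"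
      unfolding k using gh n by (simp add: conj_nat_pow)
    also have "\<dots> \<in> generate G {n}"
      using \<open>S h\<close> n unfolding S_def by (intro nat_pow_mem_subgroup generate_singleton_subgroup)
    finally show ?thesis unfolding S_def .
  qed
  have pow: "S (g [^] (k::nat))" if "g \<in> carrier G" "S g" for g k
  proof (induction k)
    case 0
    show ?case using n generate.incl[of n "{n}" G] by (simp add: S_def)
  next
    case (Suc k)
    then show ?case using mult that by simp
  qed
  have S: "S g" if "g \<in> carrier G" for g
    using that unfolding A(2)[symmetric]
  proof (induction rule: generate.induct)
    case one
    then show ?case using n generate.incl[of n "{n}" G] by (simp add: S_def)
  next
    case (incl h)
    then show ?case using conj by (simp add: S_def)
  next
    case (inv h)
    then have h: "h \<in> carrier G" "S h"
      using A(1) conj by (auto simp: S_def)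
    obtain k :: nat where "inv h = h [^] k"
      using generate.inv[of h "{h}" G] unfolding generate_singleton_nat_pow[OF fin h(1)] by auto
    then show ?case using pow[OF h] by simp
  next
    case (eng g h)
    then show ?case using mult A(2) by simp
  qed
  show ?thesis
  proof (rule normal_invI)
    show "subgroup (generate G {n}) G" by (rule generate_singleton_subgroup[OF n])
    fix g h assume g: "g \<in> carrier G" and h: "h \<in> generate G {n}"
    obtain k :: nat where k: "h = n [^] k"
      using h unfolding generate_singleton_nat_pow[OF fin n] by (elim rangeE)
    \<comment> \<open>The normality rule conjugates as \<open>g h inv g\<close>, the opposite of
      \<open>S\<close>; hence the inverse of \<open>g\<close>.\<close>
    have "inv (inv g) \<otimes> n \<otimes> inv g \<in> generate G {n}"
      using S[of "inv g"] g by (simp add: S_def)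
    then have "(inv (inv g) \<otimes> n \<otimes> inv g) [^] k \<in> generate G {n}"
      using n by (intro nat_pow_mem_subgroup generate_singleton_subgroup) auto
    then show "g \<otimes> h \<otimes> inv g \<in> generate G {n}"
      using conj_nat_pow[of "inv g" n k] g n k by simp
  qed
qed

lemma generate_cyclic_factors:
  assumes "cyclic_factors a b"
  shows "generate G {a, b} = carrier G"
proof
  have ab: "{a, b} \<subseteq> carrier G"
    using assms by (simp add: cyclic_factors_def)
  then show "generate G {a, b} \<subseteq> carrier G"
    by (rule generate_incl)
  show "carrier G \<subseteq> generate G {a, b}"
  proof
    fix g assume "g \<in> carrier G"
    then obtain i j :: nat where "g = a [^] i \<otimes> b [^] j"
      by (rule cyclic_factorsE[OF assms])
    then show "g \<in> generate G {a, b}"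
      using generate_is_subgroup[OF ab] generate.incl[of a "{a, b}" G] generate.incl[of b "{a, b}" G]
      by (simp add: subgroup.m_closed nat_pow_mem_subgroup)
  qed
qed

lemma inv_nat_pow_ex:
  assumes "finite (carrier G)" "x \<in> carrier G"
  shows "\<exists>k'::nat. inv (x [^] (k::nat)) = x [^] k'"
proof -
  have "inv (x [^] k) \<in> generate G {x}"
    using assms by (intro generate_m_inv_closed nat_pow_mem_generate) auto
  then show ?thesis
    unfolding generate_singleton_nat_pow[OF assms] by auto
qed

lemma ord_prime_power:
  assumes "Factorial_Ring.prime p" "order G = p ^ M" "x \<in> carrier G"
  obtains k where "ord x = p ^ k"
  using assms ord_dvd_group_order divides_primepow_nat by metis

lemma nat_pow_eq_iff_cong:
  "x \<in> carrier G \<Longrightarrow> x [^] (m::nat) = x [^] (n::nat) \<longleftrightarrow> [m = n] (mod ord x)"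
  using int_pow_eq[of x "int m" "int n"]
  by (simp add: int_pow_int cong_sym_eq flip: cong_iff_dvd_diff cong_int_iff)

text \<open>Modulo the central \<langle>z\<rangle>, conjugation by \<open>y\<close> is the
  \<open>q\<close>-th power map on \<langle>n\<rangle>. The exponent of \<open>z\<close> is left
  open, since only that of \<open>n\<close> matters later.\<close>

lemma conj_nat_pow_power:
  assumes y: "y \<in> carrier G" and n: "n \<in> carrier G" and z: "z \<in> carrier G"
    and central: "\<And>g. g \<in> carrier G \<Longrightarrow> z \<otimes> g = g \<otimes> z"
    and conj: "inv y \<otimes> n \<otimes> y = n [^] (q::nat) \<otimes> z [^] (e::nat)"
  shows "\<exists>e'::nat. inv (y [^] k) \<otimes> n \<otimes> y [^] (k::nat) = n [^] (q ^ k) \<otimes> z [^] e'"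
proof (induction k)
  case 0
  show ?case using n z by (intro exI[of _ 0]) simp
next
  case (Suc k)
  then obtain e' :: nat where e': "inv (y [^] k) \<otimes> n \<otimes> y [^] k = n [^] (q ^ k) \<otimes> z [^] e'" ..
  have zpow: "z [^] (i::nat) \<otimes> g = g \<otimes> z [^] i" if "g \<in> carrier G" for g i
    using central[OF that] that z by (metis group_commutes_pow)
  have "inv (y [^] Suc k) \<otimes> n \<otimes> y [^] Suc k = inv y \<otimes> (inv (y [^] k) \<otimes> n \<otimes> y [^] k) \<otimes> y"
    using y n by (simp add: inv_mult_group m_assoc)
  also have "\<dots> = (inv y \<otimes> n [^] (q ^ k) \<otimes> y) \<otimes> z [^] e'"
    unfolding e' using y n z zpow[OF y] by (simp add: m_assoc)
  also have "inv y \<otimes> n [^] (q ^ k) \<otimes> y = n [^] (q ^ Suc k) \<otimes> z [^] (e * q ^ k)"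
    using y n z zpow conj
    by (simp add: conj_nat_pow pow_mult_distrib nat_pow_pow)
  finally show ?case
    using n z by (auto simp: m_assoc nat_pow_mult)
qed

text \<open>Conjugation by \<open>y^(p^M)\<close> is trivial, so
  \<open>n = n^(q^(p^M)) z^e'\<close>. As \<langle>n\<rangle> and \<langle>z\<rangle> meet
  trivially, \<open>q^(p^M)\<close> is 1 modulo \<open>ord n\<close>, hence modulo \<open>p\<close>,
  where it equals \<open>q\<close>. The lemma is applied both with a central \<open>z\<close> of
  order \<open>p\<close> and with \<open>z = \<one>\<close>.\<close>

lemma conj_exponent_cong_1:
  fixes p q :: nat
  assumes p: "Factorial_Ring.prime p" and ord: "order G = p ^ M"
    and y: "y \<in> carrier G" and n: "n \<in> carrier G" "n \<noteq> \<one>" and z: "z \<in> carrier G"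
    and central: "\<And>g. g \<in> carrier G \<Longrightarrow> z \<otimes> g = g \<otimes> z"
    and disj: "generate G {n} \<inter> generate G {z} = {\<one>}"
    and conj: "inv y \<otimes> n \<otimes> y = n [^] q \<otimes> z [^] (e::nat)"
  shows "[q = 1] (mod p)"
proof -
  obtain e' :: nat where e': "inv (y [^] (p ^ M)) \<otimes> n \<otimes> y [^] (p ^ M) = n [^] (q ^ p ^ M) \<otimes> z [^] e'"
    using conj_nat_pow_power[OF y n(1) z central conj] by blast
  have "y [^] (p ^ M) = \<one>"
    using pow_order_eq_1[OF y] ord by simp
  then have eq: "n = n [^] (q ^ p ^ M) \<otimes> z [^] e'"
    using e' n by simp
  then have "inv (n [^] (q ^ p ^ M)) \<otimes> n = z [^] e'"
    using n z by (metis inv_solve_left nat_pow_closed)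
  moreover have "inv (n [^] (q ^ p ^ M)) \<otimes> n \<in> generate G {n}"
    using generate_singleton_subgroup[OF n(1)] nat_pow_mem_generate[OF n(1)]
    by (simp add: generate.incl subgroup.m_closed subgroup.m_inv_closed)
  ultimately have "z [^] e' = \<one>"
    using disj nat_pow_mem_generate[OF z, of e'] by auto
  then have "n [^] (1::nat) = n [^] (q ^ p ^ M)"
    using eq n by simp
  then have "[1 = q ^ p ^ M] (mod ord n)"
    using nat_pow_eq_iff_cong n(1) by blast
  moreover have "p dvd ord n"
  proof -
    obtain k where k: "ord n = p ^ k"
      using ord_prime_power[OF p ord n(1)] .
    with n have "k \<noteq> 0" by (metis ord_eq_1 power_0)
    then show ?thesis using k by simp
  qed
  ultimately have "[1 = q ^ p ^ M] (mod p)"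
    by (rule cong_dvd_mono_modulus)
  then show ?thesis
    using cong_power_prime_power[OF p] by (metis cong_sym cong_trans)
qed

text \<open>\<open>c\<close> is what remains when a \<open>y\<close> passes an \<open>x\<close>.
  Extending \<open>(x y)^i\<close> by one more factor lets an \<open>x\<close> pass
  \<open>y^i\<close>, which contributes \<open>c^i\<close>; being central, these powers collect at
  the end.\<close>

lemma class_two_pow_mult:
  assumes x: "x \<in> carrier G" and y: "y \<in> carrier G" and c: "c \<in> carrier G"
    and central: "\<And>g. g \<in> carrier G \<Longrightarrow> c \<otimes> g = g \<otimes> c"
    and comm: "y \<otimes> x = x \<otimes> y \<otimes> c"
  shows "y [^] (n::nat) \<otimes> x = x \<otimes> y [^] n \<otimes> c [^] n"
    and "y \<otimes> x [^] n = x [^] n \<otimes> y \<otimes> c [^] n"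
    and "(x \<otimes> y) [^] n = x [^] n \<otimes> y [^] n \<otimes> c [^] (\<Sum>i<n. i)"
proof -
  have cpow: "c [^] (i::nat) \<otimes> g = g \<otimes> c [^] i" if "g \<in> carrier G" for g i
    using group_commutes_pow[OF central[OF that] c that] .
  show ypow: "y [^] (n::nat) \<otimes> x = x \<otimes> y [^] n \<otimes> c [^] n" for n
  proof (induction n)
    case (Suc n)
    have "y [^] Suc n \<otimes> x = y [^] n \<otimes> (y \<otimes> x)"
      using x y by (simp add: m_assoc)
    also have "\<dots> = (y [^] n \<otimes> x) \<otimes> y \<otimes> c"
      unfolding comm using x y c by (simp add: m_assoc)
    also have "\<dots> = x \<otimes> y [^] n \<otimes> (c [^] n \<otimes> y) \<otimes> c"
      unfolding Suc using x y c by (simp add: m_assoc)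
    also have "\<dots> = x \<otimes> y [^] Suc n \<otimes> c [^] Suc n"
      unfolding cpow[OF y] using x y c by (simp add: m_assoc)
    finally show ?case .
  qed (use x in simp)
  show "y \<otimes> x [^] n = x [^] n \<otimes> y \<otimes> c [^] n"
  proof (induction n)
    case (Suc n)
    have "y \<otimes> x [^] Suc n = x [^] n \<otimes> y \<otimes> (c [^] n \<otimes> x)"
      using x y c Suc by (simp flip: m_assoc)
    also have "\<dots> = x [^] n \<otimes> (y \<otimes> x) \<otimes> c [^] n"
      unfolding cpow[OF x] using x y c by (simp add: m_assoc)
    also have "\<dots> = x [^] Suc n \<otimes> y \<otimes> (c \<otimes> c [^] n)"
      unfolding comm using x y c by (simp add: m_assoc)
    finally show ?case using c by (simp only: nat_pow_Suc2)
  qed (use y in simp)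
  show "(x \<otimes> y) [^] n = x [^] n \<otimes> y [^] n \<otimes> c [^] (\<Sum>i<n. i)"
  proof (induction n)
    case (Suc n)
    have "(x \<otimes> y) [^] Suc n = x [^] n \<otimes> y [^] n \<otimes> (c [^] (\<Sum>i<n. i) \<otimes> (x \<otimes> y))"
      unfolding nat_pow_Suc Suc using x y c by (simp add: m_assoc)
    also have "\<dots> = x [^] n \<otimes> (y [^] n \<otimes> x) \<otimes> y \<otimes> c [^] (\<Sum>i<n. i)"
      using x y c cpow[of "x \<otimes> y"] by (simp add: m_assoc)
    also have "\<dots> = x [^] n \<otimes> x \<otimes> y [^] n \<otimes> (c [^] n \<otimes> y) \<otimes> c [^] (\<Sum>i<n. i)"
      unfolding ypow using x y c by (simp add: m_assoc)
    also have "\<dots> = x [^] Suc n \<otimes> y [^] Suc n \<otimes> (c [^] n \<otimes> c [^] (\<Sum>i<n. i))"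
      unfolding cpow[OF y] using x y c by (simp add: m_assoc)
    finally show ?case
      using c by (simp add: nat_pow_mult add.commute)
  qed simp
qed

lemma nat_pow_self_comm: "x \<in> carrier G \<Longrightarrow> x \<otimes> x [^] (i::nat) = x [^] i \<otimes> x"
  using nat_pow_Suc2[of x i] by simp

lemma comm_group_cyclic_factors:
  assumes fac: "cyclic_factors a b" and comm: "a \<otimes> b = b \<otimes> a"
  shows "comm_group G"
proof (rule group_comm_groupI)
  have ab: "a \<in> carrier G" "b \<in> carrier G"
    using fac by (auto simp: cyclic_factors_def)
  have ba: "b [^] (i::nat) \<otimes> a [^] (j::nat) = a [^] j \<otimes> b [^] i" for i j
    using ab comm by (metis group_commutes_pow nat_pow_closed)
  have mult: "(a [^] i \<otimes> b [^] j) \<otimes> (a [^] i' \<otimes> b [^] j') = a [^] (i + i') \<otimes> b [^] (j + j')"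
    for i j i' j' :: nat
  proof -
    have "(a [^] i \<otimes> b [^] j) \<otimes> (a [^] i' \<otimes> b [^] j') = a [^] i \<otimes> (b [^] j \<otimes> a [^] i') \<otimes> b [^] j'"
      using ab by (simp add: m_assoc)
    also have "\<dots> = a [^] (i + i') \<otimes> b [^] (j + j')"
      unfolding ba using ab by (simp add: m_assoc flip: nat_pow_mult)
    finally show ?thesis .
  qed
  fix x y assume "x \<in> carrier G" "y \<in> carrier G"
  then obtain i j i' j' :: nat where "x = a [^] i \<otimes> b [^] j" "y = a [^] i' \<otimes> b [^] j'"
    using cyclic_factorsE[OF fac] by metis
  then show "x \<otimes> y = y \<otimes> x"
    by (simp add: mult add.commute)
qed

text \<open>Normality makes \<langle>d\<rangle>\<langle>y\<rangle> a subgroup, so it is everything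
  once it contains \<open>a\<close> and \<open>b\<close>.\<close>

lemma cyclic_factorsI_normal:
  assumes fac: "cyclic_factors a b" and d: "generate G {d} \<lhd> G" "d \<in> carrier G"
    and y: "y \<in> carrier G" and fin: "finite (carrier G)"
    and a: "a \<in> generate G {d} <#> generate G {y}" and b: "b \<in> generate G {d} <#> generate G {y}"
  shows "metacyclic_factors d y"
  unfolding metacyclic_factors_def cyclic_factors_def
proof (intro conjI ballI d y)
  have sub: "subgroup (generate G {d} <#> generate G {y}) G"
    using d y by (intro commut_normal generate_singleton_subgroup mult_norm_subgroup)
  fix g assume "g \<in> carrier G"
  then obtain i j :: nat where "g = a [^] i \<otimes> b [^] j"
    using cyclic_factorsE[OF fac] by blast
  then have "g \<in> generate G {d} <#> generate G {y}"
    using sub a b by (auto intro!: subgroup.m_closed nat_pow_mem_subgroup)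
  then show "\<exists>(i::nat) (j::nat). g = d [^] i \<otimes> y [^] j"
    unfolding set_mult_def generate_singleton_nat_pow[OF fin d(2)] generate_singleton_nat_pow[OF fin y]
    by blast
qed

text \<open>An exponent prime to \<open>p\<close> is invertible modulo the order of
  \<open>x\<close>, a power of \<open>p\<close>; so \<open>x^i\<close> and \<open>x\<close> generate
  the same subgroup.\<close>

lemma pow_not_dvd_pow_eq:
  assumes p: "Factorial_Ring.prime p" and ord: "order G = p ^ M" and x: "x \<in> carrier G"
    and i: "\<not> p dvd i"
  obtains u :: nat where "(x [^] i) [^] u = x"
proof -
  obtain k where k: "ord x = p ^ k"
    using ord_prime_power[OF p ord x] .
  have "coprime i (ord x)"
    using p i k by (metis coprime_commute coprime_power_left_iff prime_imp_coprime)
  then obtain u where "[i * u = 1] (mod ord x)"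
    using cong_solve_coprime_nat by auto
  then have "x [^] (i * u) = x [^] (1::nat)"
    using nat_pow_eq_iff_cong x by blast
  then show thesis
    using that x by (simp add: nat_pow_pow)
qed

text \<open>
  Write \<open>c = a\<^sup>i b\<^sup>j\<close>. Centrality of \<open>c\<close> forces \<open>p\<close> to divide \<open>i\<close> and \<open>j\<close>. For odd \<open>p\<close> the common power of \<open>p\<close>
  can be extracted: \<open>c\<close> is a power of some \<open>d = a\<^sup>m b\<^sup>n\<close> with \<open>m, n\<close> not both divisible by \<open>p\<close>. Then
  \<open>\<langle>d\<rangle>\<close> contains all commutators, hence is normal.
\<close>

lemma metacyclic_factors_class_two:
  assumes p: "Factorial_Ring.prime p" "odd p" and ord: "order G = p ^ M"
    and fac: "cyclic_factors a b" and cG: "c \<in> carrier G"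
    and ba: "b \<otimes> a = a \<otimes> b \<otimes> c"
    and central: "\<And>g. g \<in> carrier G \<Longrightarrow> c \<otimes> g = g \<otimes> c" and cp: "c [^] p = \<one>"
  shows "\<exists>d y. metacyclic_factors d y"
proof (cases "c = \<one>")
  have ab: "a \<in> carrier G" "b \<in> carrier G"
    using fac by (auto simp: cyclic_factors_def)
  have fin: "finite (carrier G)"
    using ord p(1) by (metis order_gt_0_iff_finite prime_gt_0_nat zero_less_power)
  {
    case True
    then have eq: "a \<otimes> b = b \<otimes> a"
      using ab ba by simp
    have "inv b \<otimes> a \<otimes> b = a" "inv a \<otimes> a \<otimes> a = a"
      using ab by (simp_all add: m_assoc eq)
    then have "generate G {a} \<lhd> G"
      using ab generate.incl[of a "{a}" G]
      by (intro normal_generate_singletonI[OF fin _ generate_cyclic_factors[OF fac]]) auto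
    then show ?thesis
      using fac unfolding metacyclic_factors_def by blast
  next
    case False
    obtain i j :: nat where c: "c = a [^] i \<otimes> b [^] j"
      using cyclic_factorsE[OF fac cG] .
    \<comment> \<open>Otherwise \<open>a\<close> is a power of \<open>a^i\<close>. As
      \<open>c = a^i b^j\<close> commutes with \<open>b\<close>, so do \<open>a^i\<close> and
      \<open>a\<close>, and then \<open>c\<close> is trivial. The argument for \<open>j\<close> is
      the mirror image.\<close>
    have pi: "p dvd i"
    proof (rule ccontr)
      assume "\<not> p dvd i"
      then obtain u :: nat where u: "(a [^] i) [^] u = a"
        using pow_not_dvd_pow_eq[OF p(1) ord ab(1)] by blast
      have "a [^] i \<otimes> b \<otimes> b [^] j = c \<otimes> b"
        unfolding c using ab by (simp add: m_assoc nat_pow_self_comm)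
      also have "\<dots> = b \<otimes> a [^] i \<otimes> b [^] j"
        unfolding central[OF ab(2)] unfolding c using ab by (simp add: m_assoc)
      finally have "a [^] i \<otimes> b = b \<otimes> a [^] i"
        using ab by simp
      then have "a \<otimes> b = b \<otimes> a"
        using group_commutes_pow[of "a [^] i" b u] ab u by simp
      then show False
        using ba ab cG False by simp
    qed
    have pj: "p dvd j"
    proof (rule ccontr)
      assume "\<not> p dvd j"
      then obtain u :: nat where u: "(b [^] j) [^] u = b"
        using pow_not_dvd_pow_eq[OF p(1) ord ab(2)] by blast
      have "a [^] i \<otimes> (b [^] j \<otimes> a) = c \<otimes> a"
        unfolding c using ab by (simp add: m_assoc)
      also have "\<dots> = a [^] i \<otimes> (a \<otimes> b [^] j)"
        unfolding central[OF ab(1)] unfolding c using ab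
        by (simp add: nat_pow_self_comm flip: m_assoc)
      finally have "b [^] j \<otimes> a = a \<otimes> b [^] j"
        using ab by simp
      then have "b \<otimes> a = a \<otimes> b"
        using group_commutes_pow[of "b [^] j" a u] ab u by simp
      then show False
        using ba ab cG False by simp
    qed
    have ij: "gcd i j \<noteq> 0"
    proof
      assume "gcd i j = 0"
      then have "i = 0" "j = 0" by simp_all
      then show False using c False by simp
    qed
    \<comment> \<open>\<open>p^k\<close> is the full \<open>p\<close>-part shared by
      \<open>i\<close> and \<open>j\<close>. The part \<open>g\<close> prime to \<open>p\<close>
      stays in \<open>m\<close> and \<open>n\<close>, so that not both are divisible by
      \<open>p\<close>.\<close>
    define k where "k = multiplicity p (gcd i j)"
    obtain g where g: "gcd i j = p ^ k * g" "\<not> p dvd g"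
    proof (rule multiplicity_decompose'[OF ij])
      show "\<not> is_unit p" using p(1) by auto
    qed (use that k_def in blast)
    obtain i' j' where ij': "i = gcd i j * i'" "j = gcd i j * j'" "coprime i' j'"
      using ij gcd_coprime_exists by (metis mult.commute)
    define m where "m = g * i'"
    define n where "n = g * j'"
    have m: "i = m * p ^ k" and n: "j = n * p ^ k"
      using ij' g unfolding m_def n_def by (metis mult.commute mult.left_commute)+
    have mn: "\<not> (p dvd m \<and> p dvd n)"
      using p(1) g(2) ij'(3) unfolding m_def n_def
      by (metis coprime_common_divisor_nat not_prime_1 prime_dvd_mult_iff)
    have "k \<noteq> 0"
      using pi pj g by (metis gcd_greatest mult_1 power_0)
    then have pk: "p dvd p ^ k" by simp
    define d where "d = a [^] m \<otimes> b [^] n"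
    have dG: "d \<in> carrier G"
      unfolding d_def using ab by simp
    have cpow_central: "c [^] (i::nat) \<otimes> g = g \<otimes> c [^] i" if "g \<in> carrier G" for g i
      using group_commutes_pow[OF central[OF that] cG that] .
    have bna: "b [^] n \<otimes> a = a \<otimes> b [^] n \<otimes> c [^] n"
      using class_two_pow_mult(1)[OF ab cG central ba] .
    have bam: "b \<otimes> a [^] m = a [^] m \<otimes> b \<otimes> c [^] m"
      using class_two_pow_mult(2)[OF ab cG central ba] .
    have bnam: "b [^] n \<otimes> a [^] m = a [^] m \<otimes> b [^] n \<otimes> (c [^] n) [^] m"
      using class_two_pow_mult(2)[OF ab(1) _ _ cpow_central bna] ab cG by simp
    \<comment> \<open>Here \<open>d\<close> turns out to be a \<open>p^k\<close>-th root of
      \<open>c\<close>: sorting the power produces \<open>c^(n m)\<close> to a triangular exponent,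
      which \<open>p\<close> divides since \<open>k\<close> is nonzero and \<open>p\<close> is
      odd.\<close>
    have "d [^] (p ^ k) = (a [^] m) [^] (p ^ k) \<otimes> (b [^] n) [^] (p ^ k) \<otimes>
        ((c [^] n) [^] m) [^] (\<Sum>i<p ^ k. i)"
      unfolding d_def
    proof (rule class_two_pow_mult(3)[OF _ _ _ _ bnam])
      show "(c [^] n) [^] m \<otimes> g = g \<otimes> (c [^] n) [^] m" if "g \<in> carrier G" for g
        using cpow_central[OF that, of "n * m"] cG by (simp add: nat_pow_pow)
    qed (use ab cG in simp_all)
    also have "((c [^] n) [^] m) [^] (\<Sum>i<p ^ k. i) = \<one>"
    proof -
      obtain s where "(\<Sum>i<p ^ k. i) = p * s"
        using odd_prime_dvd_sum_lessThan[OF p pk] by (elim dvdE)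
      then have "((c [^] n) [^] m) [^] (\<Sum>i<p ^ k. i) = (c [^] p) [^] (n * m * s)"
        using cG by (simp only: nat_pow_pow) (simp add: ac_simps)
      then show ?thesis using cp by simp
    qed
    finally have dc: "d [^] (p ^ k) = c"
      using ab c m n by (simp add: nat_pow_pow)
    have sub: "subgroup (generate G {d}) G"
      by (rule generate_singleton_subgroup[OF dG])
    have d_in: "d \<in> generate G {d}"
      by (simp add: generate.incl)
    have c_in: "c [^] (i::nat) \<in> generate G {d}" for i
      using nat_pow_mem_generate[OF dG] dc nat_pow_mem_subgroup[OF sub] by metis
    have "d \<otimes> a = a \<otimes> d \<otimes> c [^] n"
    proof -
      have "d \<otimes> a = a [^] m \<otimes> (b [^] n \<otimes> a)"
        unfolding d_def using ab by (simp add: m_assoc)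
      also have "\<dots> = a [^] m \<otimes> a \<otimes> b [^] n \<otimes> c [^] n"
        unfolding bna using ab cG by (simp add: m_assoc)
      also have "a [^] m \<otimes> a = a \<otimes> a [^] m"
        using ab by (simp add: nat_pow_self_comm)
      finally show ?thesis
        unfolding d_def using ab cG by (simp add: m_assoc)
    qed
    then have "inv a \<otimes> d \<otimes> a = d \<otimes> c [^] n"
      using ab cG dG by (simp add: m_assoc)
    then have na: "inv a \<otimes> d \<otimes> a \<in> generate G {d}"
      using subgroup.m_closed[OF sub d_in c_in] by simp
    have "b \<otimes> d = d \<otimes> b \<otimes> c [^] m"
    proof -
      have "b \<otimes> d = (b \<otimes> a [^] m) \<otimes> b [^] n"
        unfolding d_def using ab by (simp add: m_assoc)
      also have "\<dots> = a [^] m \<otimes> b \<otimes> (c [^] m \<otimes> b [^] n)"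
        unfolding bam using ab cG by (simp add: m_assoc)
      also have "\<dots> = a [^] m \<otimes> (b \<otimes> b [^] n) \<otimes> c [^] m"
        using ab cG by (simp add: cpow_central m_assoc)
      also have "b \<otimes> b [^] n = b [^] n \<otimes> b"
        using ab by (simp add: nat_pow_self_comm)
      finally show ?thesis
        unfolding d_def using ab cG by (simp add: m_assoc)
    qed
    then have "d = inv b \<otimes> d \<otimes> b \<otimes> c [^] m"
      using ab cG dG by (metis inv_mult_cancel(1) inv_closed m_assoc m_closed nat_pow_closed)
    then have "inv b \<otimes> d \<otimes> b = d \<otimes> inv (c [^] m)"
      using ab cG dG by (metis inv_solve_right inv_closed m_closed nat_pow_closed)
    then have nb: "inv b \<otimes> d \<otimes> b \<in> generate G {d}"
      using subgroup.m_closed[OF sub d_in subgroup.m_inv_closed[OF sub c_in]] by simp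
    have normal: "generate G {d} \<lhd> G"
      using ab na nb dG by (intro normal_generate_singletonI[OF fin _ generate_cyclic_factors[OF fac]]) auto
    have am: "a [^] m = d \<otimes> inv (b [^] n)" and bn: "b [^] n = inv (a [^] m) \<otimes> d"
      unfolding d_def using ab by (simp_all add: m_assoc)
    have S: "subgroup (generate G {d} <#> generate G {y}) G" if "y \<in> carrier G" for y
      using normal that by (intro mult_norm_subgroup generate_singleton_subgroup)
    have dS: "d \<in> generate G {d} <#> generate G {y}" if "y \<in> carrier G" for y
      using set_mult_def[of G "generate G {d}" "generate G {y}"] d_in generate.one[of G "{y}"] dG by force
    have yS: "y \<in> generate G {d} <#> generate G {y}" if "y \<in> carrier G" for y
      using set_mult_def[of G "generate G {d}" "generate G {y}"] generate.one[of G "{d}"]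
        generate.incl[of y "{y}" G] that by force
    \<comment> \<open>One of \<open>m\<close> and \<open>n\<close> is prime to \<open>p\<close>, so
      the corresponding generator can be recovered from \<open>d\<close> and the other one, which
      therefore generates modulo \<langle>d\<rangle>.\<close>
    show ?thesis
    proof (cases "p dvd m")
      case False
      then obtain u :: nat where u: "(a [^] m) [^] u = a"
        using pow_not_dvd_pow_eq[OF p(1) ord ab(1)] by blast
      have "a [^] m \<in> generate G {d} <#> generate G {b}"
        unfolding am using S[OF ab(2)] dS[OF ab(2)] yS[OF ab(2)]
        by (intro subgroup.m_closed subgroup.m_inv_closed nat_pow_mem_subgroup)
      then have "a \<in> generate G {d} <#> generate G {b}"
        using nat_pow_mem_subgroup[OF S[OF ab(2)]] u by metis
      then show ?thesis
        using cyclic_factorsI_normal[OF fac normal dG ab(2) fin _ yS[OF ab(2)]] by blast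
    next
      case True
      then obtain u :: nat where u: "(b [^] n) [^] u = b"
        using mn pow_not_dvd_pow_eq[OF p(1) ord ab(2)] by blast
      have "b [^] n \<in> generate G {d} <#> generate G {a}"
        unfolding bn using S[OF ab(1)] dS[OF ab(1)] yS[OF ab(1)]
        by (intro subgroup.m_closed subgroup.m_inv_closed nat_pow_mem_subgroup)
      then have "b \<in> generate G {d} <#> generate G {a}"
        using nat_pow_mem_subgroup[OF S[OF ab(1)]] u by metis
      then show ?thesis
        using cyclic_factorsI_normal[OF fac normal dG ab(1) fin yS[OF ab(1)]] by blast
    qed
  }
qed

section \<open>Central elements of finite p-groups\<close>

text \<open>Class equation inside \<open>R\<close>: the classes have \<open>p\<close>-power size,
  the unit forms a class of size 1, and \<open>p\<close> divides the order of \<open>R\<close>, so a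
  second class is a singleton. A power of the central element so found has order
  \<open>p\<close>.\<close>

lemma nontrivial_normal_meets_center:
  assumes p: "Factorial_Ring.prime p" and ord: "order G = p ^ M"
    and R: "R \<lhd> G" and nontriv: "R \<noteq> {\<one>}"
  shows "\<exists>z\<in>R. z \<noteq> \<one> \<and> z [^] p = \<one> \<and> (\<forall>g\<in>carrier G. z \<otimes> g = g \<otimes> z)"
proof -
  interpret R: normal R G by (rule R)
  let ?\<phi> = "\<lambda>g. \<lambda>h\<in>carrier G. g \<otimes> h \<otimes> inv g"
  interpret act: group_action G "carrier G" ?\<phi>
    by (rule action_by_conjugation)
  have fin: "finite (carrier G)"
    using ord p by (metis order_gt_0_iff_finite prime_gt_0_nat zero_less_power)
  have "\<exists>z\<in>R. z \<noteq> \<one> \<and> (\<forall>g\<in>carrier G. z \<otimes> g = g \<otimes> z)"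
  proof (rule ccontr)
    assume no: "\<not> ?thesis"
    \<comment> \<open>The orbit formula sums over the whole carrier; the indicator function of
      \<open>R\<close> restricts it to the classes inside \<open>R\<close>.\<close>
    let ?f = "\<lambda>x. if x \<in> R then 1 else 0 :: nat"
    let ?orbs = "orbits G (carrier G) ?\<phi>"
    have finorbs: "finite ?orbs"
      using fin unfolding orbits_def by (simp add: setcompr_eq_image)
    have one_orb: "orbit G ?\<phi> \<one> = {\<one>}"
      using one_closed by (auto simp: orbit_def intro!: exI[of _ \<one>])
    have "card R = (\<Sum>x\<in>carrier G. ?f x)"
      using sum.inter_restrict[OF fin, of "\<lambda>_. 1::nat" R] R.subset by (simp add: Int_absorb1)
    also have "\<dots> = (\<Sum>orb\<in>?orbs. \<Sum>x\<in>orb. ?f x)"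
      by (rule act.disjoint_sum[OF fin, symmetric])
    also have "\<dots> = (\<Sum>x\<in>{\<one>}. ?f x) + (\<Sum>orb\<in>?orbs - {{\<one>}}. \<Sum>x\<in>orb. ?f x)"
      using finorbs one_orb by (subst sum.remove[of _ "{\<one>}"]) (auto simp: orbits_def)
    finally have "card R = 1 + (\<Sum>orb\<in>?orbs - {{\<one>}}. \<Sum>x\<in>orb. ?f x)"
      by simp
    moreover have "p dvd (\<Sum>x\<in>orb. ?f x)" if orb: "orb \<in> ?orbs - {{\<one>}}" for orb
    proof -
      obtain x where x: "x \<in> carrier G" "orb = orbit G ?\<phi> x"
        using orb by (auto simp: orbits_def)
      show ?thesis
      proof (cases "x \<in> R")
        case True
        have sub: "orb \<subseteq> R"
        proof
          fix y assume "y \<in> orb"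
          then obtain g where "g \<in> carrier G" "y = g \<otimes> x \<otimes> inv g"
            using x by (auto simp: orbit_def)
          then show "y \<in> R"
            using R.inv_op_closed2[OF _ True] by simp
        qed
        have mem: "g \<otimes> x \<otimes> inv g \<in> orb" if "g \<in> carrier G" for g
          unfolding x(2) orbit_def using x(1) that by (intro CollectI exI[of _ g]) simp
        have "card orb dvd p ^ M"
          unfolding x(2) ord[symmetric] act.orbit_stabilizer_theorem[OF x(1), symmetric]
          by (rule dvd_triv_left)
        then obtain k where k: "card orb = p ^ k"
          using p divides_primepow_nat by blast
        have "k \<noteq> 0"
        proof
          assume "k = 0"
          then obtain w where w: "orb = {w}"
            using k by (auto simp: card_1_singleton_iff)
          have "x \<in> orb"
            using mem[OF one_closed] x by simp
          then have "g \<otimes> x \<otimes> inv g = x" if "g \<in> carrier G" for g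
            using mem[OF that] w by simp
          then have "x \<otimes> g = g \<otimes> x" if "g \<in> carrier G" for g
            using that x(1) by (metis inv_solve_right m_closed)
          then have "x = \<one>"
            using no True by blast
          then show False
            using orb x one_orb by simp
        qed
        then have "p dvd card orb"
          using k by simp
        moreover have "(\<Sum>x\<in>orb. ?f x) = card orb"
          using sub by (simp add: subset_iff)
        ultimately show ?thesis by simp
      next
        case False
        have "y \<notin> R" if y: "y \<in> orb" for y
        proof
          assume "y \<in> R"
          obtain g where g: "g \<in> carrier G" "y = g \<otimes> x \<otimes> inv g"
            using y x by (auto simp: orbit_def)
          have "x = inv g \<otimes> y \<otimes> g"
            unfolding g(2) using g(1) x(1) by (simp add: m_assoc)
          then show False
            using R.inv_op_closed1[OF g(1) \<open>y \<in> R\<close>] False by simp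
        qed
        then show ?thesis by simp
      qed
    qed
    ultimately have "p dvd card R - 1"
      using dvd_sum[of "?orbs - {{\<one>}}" p "\<lambda>orb. \<Sum>x\<in>orb. ?f x"] by simp
    moreover have "card R dvd p ^ M"
      using lagrange[OF R.subgroup_axioms] ord by (metis dvd_triv_right)
    then obtain k where k: "card R = p ^ k"
      using p divides_primepow_nat by blast
    moreover have "k \<noteq> 0"
    proof
      assume "k = 0"
      then obtain w where "R = {w}"
        using k by (auto simp: card_1_singleton_iff)
      then show False
        using nontriv R.one_closed by auto
    qed
    ultimately have "p dvd 1"
      using p by (metis dvd_diffD1 dvd_power not_gr_zero one_le_numeral prime_gt_0_nat zero_less_power Suc_leI One_nat_def)
    then show False
      using p by simp
  qed
  then obtain z where z: "z \<in> R" "z \<noteq> \<one>" and central: "\<And>g. g \<in> carrier G \<Longrightarrow> z \<otimes> g = g \<otimes> z"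
    by blast
  have zG: "z \<in> carrier G"
    using z by simp
  obtain k where k: "ord z = p ^ k"
    using ord_prime_power[OF p ord zG] .
  have k0: "k \<noteq> 0"
    using k z(2) zG by (metis ord_eq_1 power_0)
  show ?thesis
  proof (intro bexI[of _ "z [^] (p ^ (k - 1))"] conjI ballI)
    show "z [^] (p ^ (k - 1)) \<in> R"
      using z(1) by (rule nat_pow_mem_subgroup[OF R.subgroup_axioms])
    have "\<not> p ^ k dvd p ^ (k - 1)"
      using k0 p by (meson diff_less nat_dvd_not_less not_gr_zero power_strict_increasing prime_gt_0_nat prime_gt_1_nat zero_less_one zero_less_power)
    then show "z [^] (p ^ (k - 1)) \<noteq> \<one>"
      using k zG by (simp add: pow_eq_id)
    have "p ^ (k - 1) * p = p ^ k"
      using k0 by (simp add: power_eq_if)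
    then show "(z [^] (p ^ (k - 1))) [^] p = \<one>"
      using zG pow_ord_eq_1[OF zG] k by (simp add: nat_pow_pow)
    show "z [^] (p ^ (k - 1)) \<otimes> g = g \<otimes> z [^] (p ^ (k - 1))" if "g \<in> carrier G" for g
      using group_commutes_pow[OF central[OF that] zG that] .
  qed
qed

lemma finite_group_iso_nat:
  assumes "finite (carrier G)"
  obtains K :: "nat monoid" and h where "group K" "h \<in> iso G K"
proof -
  obtain h :: "'a \<Rightarrow> nat" where inj: "inj_on h (carrier G)"
    using finite_imp_inj_to_nat_seg[OF assms] by blast
  define K where "K = \<lparr>carrier = h ` carrier G,
    monoid.mult = \<lambda>i j. h (inv_into (carrier G) h i \<otimes> inv_into (carrier G) h j), one = h \<one>\<rparr>"
  have hom: "h \<in> hom G K"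
    by (rule homI) (auto simp: K_def inj)
  moreover have "K\<lparr>carrier := h ` carrier G, one := h \<one>\<rparr> = K"
    by (simp add: K_def)
  ultimately have "group K"
    using hom_imp_img_group by metis
  moreover have "h \<in> iso G K"
    using hom inj by (simp add: iso_def bij_betw_def K_def)
  ultimately show thesis by (rule that)
qed

section \<open>Huppert's theorem by central quotients\<close>

lemma mem_derived_set_iff:
  "k \<in> derived_set G H \<longleftrightarrow> (\<exists>x\<in>H. \<exists>w\<in>H. k = x \<otimes> w \<otimes> inv x \<otimes> inv w)"
  by simp

text \<open>Generators of the subgroup \<open>(G')^p [G', G]\<close>. If all of them are trivial,
  every commutator is central with trivial \<open>p\<close>-th power, which is the class-two
  situation; otherwise the subgroup supplies the central element for the induction.\<close>

definition higher_commutators :: "nat \<Rightarrow> 'a set" where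
  "higher_commutators p = {h. \<exists>k\<in>derived_set G (carrier G).
     h = k [^] p \<or> (\<exists>w\<in>carrier G. h = k \<otimes> w \<otimes> inv k \<otimes> inv w)}"

lemma finite_if_order_prime_power:
  "Factorial_Ring.prime p \<Longrightarrow> order G = p ^ M \<Longrightarrow> finite (carrier G)"
  by (metis order_gt_0_iff_finite prime_gt_0_nat zero_less_power)

lemma higher_commutators_in_carrier: "higher_commutators p \<subseteq> carrier G"
  by (auto simp: higher_commutators_def)

text \<open>Conjugation is an automorphism and maps commutators to commutators, so the generating
  set itself is invariant.\<close>

lemma normal_generate_higher_commutators: "generate G (higher_commutators p) \<lhd> G"
proof (rule normal_generateI[OF higher_commutators_in_carrier])
  fix h g assume h: "h \<in> higher_commutators p" and g: "g \<in> carrier G"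
  define \<phi> where "\<phi> x = g \<otimes> x \<otimes> inv g" for x
  interpret \<phi>: group_hom G G \<phi>
    using conj_hom[of "inv g"] g unfolding \<phi>_def by unfold_locales simp
  obtain k where k: "k \<in> derived_set G (carrier G)"
    and h': "h = k [^] p \<or> (\<exists>w\<in>carrier G. h = k \<otimes> w \<otimes> inv k \<otimes> inv w)"
    using h unfolding higher_commutators_def by (elim CollectE bexE)
  obtain x w where xw: "x \<in> carrier G" "w \<in> carrier G" "k = x \<otimes> w \<otimes> inv x \<otimes> inv w"
    using k unfolding mem_derived_set_iff by (elim bexE)
  have kG: "k \<in> carrier G"
    using xw by simp
  have "\<phi> k = \<phi> x \<otimes> \<phi> w \<otimes> inv (\<phi> x) \<otimes> inv (\<phi> w)"
    using xw by simp
  then have D: "\<phi> k \<in> derived_set G (carrier G)"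
    unfolding mem_derived_set_iff using xw \<phi>.hom_closed by (intro bexI)
  have "\<phi> h = \<phi> k [^] p \<or> (\<exists>w\<in>carrier G. \<phi> h = \<phi> k \<otimes> w \<otimes> inv (\<phi> k) \<otimes> inv w)"
    using h'
  proof
    assume "\<exists>w\<in>carrier G. h = k \<otimes> w \<otimes> inv k \<otimes> inv w"
    then obtain w where w: "w \<in> carrier G" "h = k \<otimes> w \<otimes> inv k \<otimes> inv w" by (elim bexE)
    then have "\<phi> h = \<phi> k \<otimes> \<phi> w \<otimes> inv (\<phi> k) \<otimes> inv (\<phi> w)"
      using kG by simp
    then show ?thesis
      using \<phi>.hom_closed[OF w(1)] by (intro disjI2 bexI)
  qed (use kG \<phi>.hom_nat_pow in simp)
  then have "\<phi> h \<in> higher_commutators p"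
    unfolding higher_commutators_def using D by (intro CollectI bexI)
  then show "g \<otimes> h \<otimes> inv g \<in> higher_commutators p"
    unfolding \<phi>_def .
qed

text \<open>
  If \<open>z \<notin> \<langle>n\<rangle>\<close> then \<open>\<langle>n\<rangle> \<inter> \<langle>z\<rangle> = 1\<close>, and \<open>\<langle>n\<^sup>p\<rangle>\<langle>z\<rangle>\<close> contains all commutators because \<open>y\<close> acts trivially
  on \<open>\<langle>n\<rangle>/\<langle>n\<^sup>p\<rangle>\<close>. As \<open>z\<close> is central of order \<open>p\<close>, the higher commutators then lie in \<open>\<langle>n\<^sup>p\<rangle>\<close>.
\<close>

lemma central_mem_generate_if_higher_commutator:
  assumes p: "Factorial_Ring.prime p" and ord: "order G = p ^ M"
    and z: "z \<in> carrier G" "z [^] p = \<one>"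
    and central: "\<And>g. g \<in> carrier G \<Longrightarrow> z \<otimes> g = g \<otimes> z"
    and zT: "z \<in> generate G (higher_commutators p)"
    and n: "n \<in> carrier G" and y: "y \<in> carrier G"
    and fac: "\<And>g. g \<in> carrier G \<Longrightarrow> \<exists>(i::nat) (l::nat) (j::nat). g = n [^] i \<otimes> z [^] l \<otimes> y [^] j"
    and conj: "inv y \<otimes> n \<otimes> y = n [^] (q::nat) \<otimes> z [^] (e::nat)"
  shows "z \<in> generate G {n}"
proof (rule ccontr)
  assume notin: "z \<notin> generate G {n}"
  note fin = finite_if_order_prime_power[OF p ord]
  have zpow: "z [^] (l::nat) \<otimes> g = g \<otimes> z [^] l" if "g \<in> carrier G" for g l
    using group_commutes_pow[OF central[OF that] z(1) that] .
  \<comment> \<open>\<open>z\<close> has prime order, so any nontrivial element of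
    \<langle>z\<rangle> generates it and would bring \<open>z\<close> into
    \<langle>n\<rangle>.\<close>
  have disj: "generate G {n} \<inter> generate G {z} = {\<one>}"
  proof -
    have "x = \<one>" if x: "x \<in> generate G {n}" "x \<in> generate G {z}" for x
    proof -
      obtain l :: nat where l: "x = z [^] l"
        using x(2) unfolding generate_singleton_nat_pow[OF fin z(1)] by auto
      have "p dvd l"
      proof (rule ccontr)
        assume "\<not> p dvd l"
        then obtain u :: nat where "(z [^] l) [^] u = z"
          using pow_not_dvd_pow_eq[OF p ord z(1)] by blast
        then show False
          using nat_pow_mem_subgroup[OF generate_singleton_subgroup[OF n] x(1)] l notin by metis
      qed
      then show ?thesis
        using l z by (auto simp flip: nat_pow_pow)
    qed
    then show ?thesis
      using generate.one by blast
  qed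
  \<comment> \<open>As \<open>q\<close> is 1 modulo \<open>p\<close>, conjugation by
    \<open>y\<close> changes \<open>n\<close> only by powers of \<open>n^p\<close> and of
    \<open>z\<close>.\<close>
  obtain f where f: "n [^] q = n \<otimes> (n [^] p) [^] (f::nat)"
  proof (cases "n = \<one>")
    case True
    then show ?thesis using that by simp
  next
    case False
    have "[q = 1] (mod p)"
      by (rule conj_exponent_cong_1[OF p ord y n False z(1) central disj conj])
    then obtain f where "q = 1 + p * f"
      using cong_le_nat[of 1 q p] p
      by (metis add.commute cong_0_1_nat cong_sym le_numeral_extra(4) less_one mult.commute not_le not_prime_1)
    then show ?thesis
      using that[of f] n by (simp add: nat_pow_pow nat_pow_self_comm)
  qed
  define M1 where "M1 = generate G {n [^] p}"
  have gen: "{n, z, y} \<subseteq> carrier G" "generate G {n, z, y} = carrier G"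
  proof -
    show sub: "{n, z, y} \<subseteq> carrier G"
      using n z y by simp
    show "generate G {n, z, y} = carrier G"
    proof
      show "generate G {n, z, y} \<subseteq> carrier G"
        by (rule generate_incl[OF sub])
      show "carrier G \<subseteq> generate G {n, z, y}"
      proof
        fix g assume "g \<in> carrier G"
        then obtain i l j :: nat where "g = n [^] i \<otimes> z [^] l \<otimes> y [^] j"
          using fac by blast
        then show "g \<in> generate G {n, z, y}"
          using generate_is_subgroup[OF sub] generate.incl[of n "{n, z, y}" G]
            generate.incl[of z "{n, z, y}" G] generate.incl[of y "{n, z, y}" G]
          by (simp add: subgroup.m_closed nat_pow_mem_subgroup)
      qed
    qed
  qed
  have npz: "z [^] (e * p) = \<one>" for e
    using z by (metis mult.commute nat_pow_one nat_pow_pow)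
  have M1: "M1 \<lhd> G"
    unfolding M1_def
  proof (rule normal_generate_singletonI[OF fin gen])
    show "inv a \<otimes> n [^] p \<otimes> a \<in> generate G {n [^] p}" if a: "a \<in> {n, z, y}" for a
    proof -
      \<comment> \<open>Taking the \<open>p\<close>-th power removes the central factor
        \<open>z^e\<close>, so \<langle>n^p\<rangle> is normalized by \<open>y\<close> even while
        \<langle>n\<rangle> is known to be so only modulo \<langle>z\<rangle>.\<close>
      have "inv y \<otimes> n [^] p \<otimes> y = (n [^] q \<otimes> z [^] e) [^] p"
        using y n conj by (simp add: conj_nat_pow)
      also have "\<dots> = (n [^] p) [^] q"
        using n z zpow[of "n [^] q" e]
        by (simp add: pow_mult_distrib nat_pow_pow npz mult.commute)
      finally have "inv y \<otimes> n [^] p \<otimes> y \<in> generate G {n [^] p}"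
        using nat_pow_mem_generate[of "n [^] p"] n by simp
      moreover have "inv n \<otimes> n [^] p \<otimes> n = n [^] p" "inv z \<otimes> n [^] p \<otimes> z = n [^] p"
        using n z by (simp_all add: m_assoc flip: nat_pow_self_comm central)
      ultimately show ?thesis
        using a generate.incl[of "n [^] p" "{n [^] p}" G] by auto
    qed
  qed (use n in simp)
  interpret M1: normal M1 G by (rule M1)
  have Z: "generate G {z} \<lhd> G"
    using generate.incl[of z "{z}" G] z central
    by (intro normal_generate_singletonI[OF fin gen]) (auto simp: m_assoc n y)
  define L where "L = M1 <#> generate G {z}"
  have L: "L \<lhd> G"
    unfolding L_def by (rule normal_subgroup_set_mult_closed[OF M1 Z])
  interpret L: normal L G by (rule L)
  have L_iff: "x \<in> L \<longleftrightarrow> (\<exists>m\<in>M1. \<exists>l::nat. x = m \<otimes> z [^] l)" for x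
    unfolding L_def set_mult_def generate_singleton_nat_pow[OF fin z(1)] by auto
  have zL: "z \<in> L"
    using L_iff z M1.one_closed nat_pow_eone by (metis l_one)
  have pfL: "(n [^] p) [^] (f::nat) \<otimes> z [^] (e::nat) \<in> L" for f e
    using L_iff nat_pow_mem_generate[of "n [^] p"] n unfolding M1_def by blast
  interpret Q: group "G Mod L" by (rule L.factorgroup_is_group)
  interpret \<pi>: group_hom G "G Mod L" "\<lambda>g. L #> g"
    using L.r_coset_hom_Mod by unfold_locales
  have one_if: "L #> g = \<one>\<^bsub>G Mod L\<^esub>" if "g \<in> L" for g
    using that coset_join2[OF _ L.subgroup_axioms] by simp
  have "Q.cyclic_factors (L #> n) (L #> y)"
    unfolding Q.cyclic_factors_def
  proof (intro conjI ballI)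
    fix C assume "C \<in> carrier (G Mod L)"
    then obtain g where g: "g \<in> carrier G" "C = L #> g"
      by (auto simp: carrier_FactGroup)
    obtain i l j :: nat where "g = n [^] i \<otimes> z [^] l \<otimes> y [^] j"
      using fac[OF g(1)] by blast
    then have "C = ((L #> n) [^]\<^bsub>G Mod L\<^esub> i \<otimes>\<^bsub>G Mod L\<^esub> (L #> z) [^]\<^bsub>G Mod L\<^esub> l) \<otimes>\<^bsub>G Mod L\<^esub> (L #> y) [^]\<^bsub>G Mod L\<^esub> j"
      using g n z y by (simp only: \<pi>.hom_mult \<pi>.hom_nat_pow m_closed nat_pow_closed)
    then have "C = (L #> n) [^]\<^bsub>G Mod L\<^esub> i \<otimes>\<^bsub>G Mod L\<^esub> (L #> y) [^]\<^bsub>G Mod L\<^esub> j"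
      unfolding one_if[OF zL] using n \<pi>.hom_closed by (simp only: Q.nat_pow_one Q.r_one Q.nat_pow_closed)
    then show "\<exists>(i::nat) (j::nat). C = (L #> n) [^]\<^bsub>G Mod L\<^esub> i \<otimes>\<^bsub>G Mod L\<^esub> (L #> y) [^]\<^bsub>G Mod L\<^esub> j"
      by blast
  qed (use n y \<pi>.hom_closed in blast)+
  moreover have "(L #> n) \<otimes>\<^bsub>G Mod L\<^esub> (L #> y) = (L #> y) \<otimes>\<^bsub>G Mod L\<^esub> (L #> n)"
  proof -
    have "n \<otimes> y = y \<otimes> (inv y \<otimes> n \<otimes> y)"
      using n y by (simp add: m_assoc)
    also have "\<dots> = (y \<otimes> n) \<otimes> ((n [^] p) [^] f \<otimes> z [^] e)"
      unfolding conj f using n y z by (simp add: m_assoc)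
    finally have "L #> (n \<otimes> y) = (L #> (y \<otimes> n)) \<otimes>\<^bsub>G Mod L\<^esub> (L #> ((n [^] p) [^] f \<otimes> z [^] e))"
      using n y z \<pi>.hom_mult[of "y \<otimes> n" "(n [^] p) [^] f \<otimes> z [^] e"] by simp
    also have "\<dots> = L #> (y \<otimes> n)"
      unfolding one_if[OF pfL] using n y \<pi>.hom_closed by (simp only: Q.r_one m_closed)
    finally show ?thesis
      using n y by (simp only: \<pi>.hom_mult)
  qed
  ultimately have "comm_group (G Mod L)"
    by (rule Q.comm_group_cyclic_factors)
  then have derL: "derived G (carrier G) \<subseteq> L"
    by (rule derived_minimal[OF L])
  have "higher_commutators p \<subseteq> M1"
  proof
    fix x assume "x \<in> higher_commutators p"
    then obtain k where k: "k \<in> derived_set G (carrier G)"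
      and x: "x = k [^] p \<or> (\<exists>w\<in>carrier G. x = k \<otimes> w \<otimes> inv k \<otimes> inv w)"
      unfolding higher_commutators_def by (elim CollectE bexE)
    have "k \<in> derived G (carrier G)"
      unfolding derived_def by (rule generate.incl[OF k])
    then have "k \<in> L"
      using derL by (rule subsetD[rotated])
    then obtain m and l :: nat where m: "m \<in> M1" and k_eq: "k = m \<otimes> z [^] l"
      using L_iff by blast
    have mG: "m \<in> carrier G"
      using m by simp
    from x show "x \<in> M1"
    proof
      assume "x = k [^] p"
      also have "\<dots> = m [^] p"
        unfolding k_eq using mG z zpow[OF mG, of l] by (simp add: pow_mult_distrib nat_pow_pow npz)
      finally show ?thesis
        using nat_pow_mem_subgroup[OF M1.subgroup_axioms m] by simp
    next
      assume "\<exists>w\<in>carrier G. x = k \<otimes> w \<otimes> inv k \<otimes> inv w"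
      then obtain w where w: "w \<in> carrier G" "x = k \<otimes> w \<otimes> inv k \<otimes> inv w" by blast
      have "x = m \<otimes> (z [^] l \<otimes> w) \<otimes> inv (z [^] l) \<otimes> inv m \<otimes> inv w"
        unfolding w(2) k_eq using mG z w(1) by (simp add: inv_mult_group m_assoc)
      also have "\<dots> = m \<otimes> (w \<otimes> inv m \<otimes> inv w)"
        unfolding zpow[OF w(1)] using mG z w(1) by (simp add: m_assoc)
      also have "\<dots> \<in> M1"
        using M1.inv_op_closed2[OF w(1) M1.m_inv_closed[OF m]] m by simp
      finally show ?thesis .
    qed
  qed
  then have "generate G (higher_commutators p) \<subseteq> M1"
    by (rule generate_subgroup_incl[OF _ M1.subgroup_axioms])
  also have "M1 \<subseteq> generate G {n}"
    unfolding M1_def using nat_pow_mem_generate[OF n] generate_singleton_subgroup[OF n]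
    by (intro generate_subgroup_incl) auto
  finally show False
    using zT notin by blast
qed

text \<open>
  Passing to a quotient changes the element type, which an induction hypothesis cannot follow; it is
  therefore stated for groups on \<open>nat\<close>, onto which every finite group can be transported.
\<close>

lemma metacyclic_factors_induction_step:
  assumes p: "Factorial_Ring.prime p" "odd p" and ord: "order G = p ^ M"
    and fac: "cyclic_factors a b"
    and IH: "\<And>(K::nat monoid) a b M'. \<lbrakk>M' < M; group K; order K = p ^ M'; group.cyclic_factors K a b\<rbrakk>
      \<Longrightarrow> \<exists>n y. group.metacyclic_factors K n y"
  shows "\<exists>n y. metacyclic_factors n y"
proof (cases "higher_commutators p \<subseteq> {\<one>}")
  case True
  have ab: "a \<in> carrier G" "b \<in> carrier G"
    using fac by (auto simp: cyclic_factors_def)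
  \<comment> \<open>This is \<open>inv b inv a b a\<close>, written with doubled inverses to match
    the form \<open>x w inv x inv w\<close> of \<open>derived_set\<close>.\<close>
  define c where "c = inv b \<otimes> inv a \<otimes> inv (inv b) \<otimes> inv (inv a)"
  have cG: "c \<in> carrier G"
    unfolding c_def using ab by simp
  have cD: "c \<in> derived_set G (carrier G)"
    unfolding mem_derived_set_iff c_def using ab by (intro bexI[of _ "inv b"] bexI[of _ "inv a"]) simp_all
  have ba: "b \<otimes> a = a \<otimes> b \<otimes> c"
    unfolding c_def using ab by (simp add: m_assoc)
  have "c [^] p \<in> higher_commutators p"
    unfolding higher_commutators_def using cD by (intro CollectI bexI[of _ c]) simp_all
  then have cp: "c [^] p = \<one>"
    using True by (auto simp only:)
  have central: "c \<otimes> g = g \<otimes> c" if g: "g \<in> carrier G" for g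
  proof -
    have "c \<otimes> g \<otimes> inv c \<otimes> inv g \<in> higher_commutators p"
      unfolding higher_commutators_def using cD g
      by (intro CollectI bexI[of _ c] disjI2 bexI[of _ g]) simp_all
    then have "c \<otimes> g \<otimes> inv c \<otimes> inv g = \<one>"
      using True by (auto simp only:)
    then have "c \<otimes> g = \<one> \<otimes> g \<otimes> c"
      using cG g by (metis inv_solve_right' inv_closed m_closed one_closed)
    then show ?thesis
      using g by simp
  qed
  show ?thesis
    by (rule metacyclic_factors_class_two[OF p ord fac cG ba central cp])
next
  case False
  note fin = finite_if_order_prime_power[OF p(1) ord]
  have ab: "a \<in> carrier G" "b \<in> carrier G"
    using fac by (auto simp: cyclic_factors_def)
  have nontriv: "generate G (higher_commutators p) \<noteq> {\<one>}"
  proof -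
    obtain h where "h \<in> higher_commutators p" "h \<noteq> \<one>"
      using False by blast
    then show ?thesis
      using generate.incl[of h "higher_commutators p" G] by auto
  qed
  \<comment> \<open>Centrality provides the quotient for the induction; membership in the subgroup
    of higher commutators is what later forces \<open>z\<close> into \<langle>n\<rangle>.\<close>
  obtain z where zT: "z \<in> generate G (higher_commutators p)" and z1: "z \<noteq> \<one>" and zp: "z [^] p = \<one>"
    and central: "\<And>g. g \<in> carrier G \<Longrightarrow> z \<otimes> g = g \<otimes> z"
    using nontrivial_normal_meets_center[OF p(1) ord normal_generate_higher_commutators nontriv]
    by blast
  have zG: "z \<in> carrier G"
    using zT generate_in_carrier[OF higher_commutators_in_carrier] by blast
  have zpow: "z [^] (l::nat) \<otimes> g = g \<otimes> z [^] l" if "g \<in> carrier G" for g l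
    using group_commutes_pow[OF central[OF that] zG that] .
  define N where "N = generate G {z}"
  have N: "N \<lhd> G"
    unfolding N_def using ab generate.incl[of z "{z}" G] zG central
    by (intro normal_generate_singletonI[OF fin _ generate_cyclic_factors[OF fac]]) (auto simp: m_assoc)
  interpret N: normal N G by (rule N)
  interpret Q: group "G Mod N" by (rule N.factorgroup_is_group)
  have ordz: "ord z = p"
  proof -
    have "ord z dvd p" "ord z \<noteq> 1"
      using zp z1 zG pow_eq_id ord_eq_1 by metis+
    then show ?thesis
      using p(1) by (metis prime_nat_iff)
  qed
  have "order (G Mod N) * p = p ^ M"
    using lagrange[OF N.subgroup_axioms] generate_pow_card[OF zG] ordz ord
    by (simp add: order_def FactGroup_def N_def)
  moreover have "M \<noteq> 0"
    using ord_dvd_group_order[OF zG] ordz ord p(1) by (metis not_prime_1 power_0 nat_dvd_1_iff_1)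
  ultimately have ordQ: "order (G Mod N) = p ^ (M - 1)" "M - 1 < M"
    using p(1) by (simp_all add: power_eq_if prime_gt_0_nat)
  have "finite (carrier (G Mod N))"
    by (rule Q.finite_if_order_prime_power[OF p(1) ordQ(1)])
  then obtain K :: "nat monoid" and h where K: "group K" and h: "h \<in> iso (G Mod N) K"
    by (rule Q.finite_group_iso_nat)
  interpret K: group K by (rule K)
  define \<phi> where "\<phi> g = h (N #> g)" for g
  interpret h: group_hom "G Mod N" K h
    using h by unfold_locales (simp add: iso_def)
  interpret \<phi>: group_hom G K \<phi>
    using Group.hom_compose[OF N.r_coset_hom_Mod h.homh] unfolding \<phi>_def comp_def by unfold_locales
  have surj: "\<exists>g\<in>carrier G. x = \<phi> g" if "x \<in> carrier K" for x
    using that h unfolding iso_def bij_betw_def \<phi>_def carrier_FactGroup by auto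
  have ker: "g \<in> N" if g: "g \<in> carrier G" "\<phi> g = \<one>\<^bsub>K\<^esub>" for g
  proof -
    have "h (N #> g) = h \<one>\<^bsub>G Mod N\<^esub>" "N #> g \<in> carrier (G Mod N)"
      using g \<phi>_def h.hom_one by (auto simp: carrier_FactGroup)
    then have "N #> g = N"
      using h Q.one_closed by (auto simp: iso_def bij_betw_def inj_on_def)
    then show ?thesis
      using g(1) N.subgroup_axioms coset_join1 N.subset by blast
  qed
  have eq_mod: "\<exists>l::nat. g = z [^] l \<otimes> g'"
    if g: "g \<in> carrier G" "g' \<in> carrier G" "\<phi> g = \<phi> g'" for g g'
  proof -
    have "\<phi> (g \<otimes> inv g') = \<one>\<^bsub>K\<^esub>"
      using g by simp
    then have "g \<otimes> inv g' \<in> N"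
      using ker g by simp
    then obtain l :: nat where "g \<otimes> inv g' = z [^] l"
      unfolding N_def generate_singleton_nat_pow[OF fin zG] by auto
    then have "g = z [^] l \<otimes> g'"
      using g zG by (metis inv_solve_right nat_pow_closed)
    then show ?thesis ..
  qed
  have "order K = p ^ (M - 1)"
    using iso_same_card[OF is_isoI[OF h]] ordQ(1) by (simp add: order_def)
  moreover have "K.cyclic_factors (\<phi> a) (\<phi> b)"
    unfolding K.cyclic_factors_def
  proof (intro conjI ballI)
    fix x assume "x \<in> carrier K"
    then obtain g where g: "g \<in> carrier G" "x = \<phi> g"
      using surj by blast
    obtain i j :: nat where "g = a [^] i \<otimes> b [^] j"
      using cyclic_factorsE[OF fac g(1)] .
    then have "x = \<phi> a [^]\<^bsub>K\<^esub> i \<otimes>\<^bsub>K\<^esub> \<phi> b [^]\<^bsub>K\<^esub> j"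
      using g ab by (simp add: \<phi>.hom_nat_pow)
    then show "\<exists>(i::nat) (j::nat). x = \<phi> a [^]\<^bsub>K\<^esub> i \<otimes>\<^bsub>K\<^esub> \<phi> b [^]\<^bsub>K\<^esub> j"
      by (intro exI)
  qed (use ab in simp_all)
  ultimately obtain n' y' where meta: "K.metacyclic_factors n' y'"
    using IH[OF ordQ(2) K] by blast
  then have ny'K: "n' \<in> carrier K" "y' \<in> carrier K"
    by (auto simp: K.metacyclic_factors_def K.cyclic_factors_def)
  \<comment> \<open>Lifts of the pair found in the quotient. At this stage they factor the group
    only up to powers of \<open>z\<close>, and \<open>y\<close> normalizes \<langle>n\<rangle> only
    modulo \<langle>z\<rangle>.\<close>
  obtain n where n: "n \<in> carrier G" "n' = \<phi> n" using surj[OF ny'K(1)] by blast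
  obtain y where y: "y \<in> carrier G" "y' = \<phi> y" using surj[OF ny'K(2)] by blast
  note meta = meta[unfolded n(2) y(2)]
  have facK: "K.cyclic_factors (\<phi> n) (\<phi> y)" and normK: "generate K {\<phi> n} \<lhd> K"
    using meta by (simp_all add: K.metacyclic_factors_def)
  have finK: "finite (carrier K)"
    using iso_finite[OF is_isoI[OF h]] \<open>finite (carrier (G Mod N))\<close> by blast
  have nzy: "\<exists>(i::nat) (l::nat) (j::nat). g = n [^] i \<otimes> z [^] l \<otimes> y [^] j" if g: "g \<in> carrier G" for g
  proof -
    obtain i j :: nat where "\<phi> g = \<phi> n [^]\<^bsub>K\<^esub> i \<otimes>\<^bsub>K\<^esub> \<phi> y [^]\<^bsub>K\<^esub> j"
      using K.cyclic_factorsE[OF facK \<phi>.hom_closed[OF g]] .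
    then have "\<phi> g = \<phi> (n [^] i \<otimes> y [^] j)"
      using n y by (simp add: \<phi>.hom_nat_pow)
    then obtain l :: nat where "g = z [^] l \<otimes> (n [^] i \<otimes> y [^] j)"
      using eq_mod[OF g] n y by (metis m_closed nat_pow_closed)
    then have "g = n [^] i \<otimes> z [^] l \<otimes> y [^] j"
      using n y zG zpow[of "n [^] i" l] by (simp flip: m_assoc)
    then show ?thesis by (intro exI)
  qed
  have "\<phi> (inv y \<otimes> n \<otimes> y) \<in> generate K {\<phi> n}"
    using normal.inv_op_closed1[OF normK, of "\<phi> y" "\<phi> n"] n y generate.incl[of "\<phi> n" "{\<phi> n}" K] by simp
  then obtain q :: nat where "\<phi> (inv y \<otimes> n \<otimes> y) = \<phi> (n [^] q)"
    unfolding K.generate_singleton_nat_pow[OF finK \<phi>.hom_closed[OF n(1)]] using n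
    by (auto simp: \<phi>.hom_nat_pow)
  then obtain e :: nat where "inv y \<otimes> n \<otimes> y = z [^] e \<otimes> n [^] q"
    using eq_mod n y by (metis inv_closed m_closed nat_pow_closed)
  then have conj: "inv y \<otimes> n \<otimes> y = n [^] q \<otimes> z [^] e"
    using zpow n by simp
  have "z \<in> generate G {n}"
    by (rule central_mem_generate_if_higher_commutator[OF p(1) ord zG zp central zT n(1) y(1) nzy conj])
  \<comment> \<open>Once \<open>z\<close> is the power \<open>n^w\<close>, both defects of the lift
    are absorbed into exponents of \<open>n\<close>.\<close>
  then obtain w :: nat where w: "z = n [^] w"
    unfolding generate_singleton_nat_pow[OF fin n(1)] by auto
  have "cyclic_factors n y"
    unfolding cyclic_factors_def
  proof (intro conjI ballI n y)
    fix g assume "g \<in> carrier G"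
    then obtain i l j :: nat where "g = n [^] i \<otimes> z [^] l \<otimes> y [^] j"
      using nzy by metis
    then have "g = n [^] (i + w * l) \<otimes> y [^] j"
      using w n by (simp add: nat_pow_pow nat_pow_mult)
    then show "\<exists>(i::nat) (j::nat). g = n [^] i \<otimes> y [^] j"
      by (intro exI)
  qed
  moreover have "generate G {n} \<lhd> G"
  proof (rule normal_generate_singletonI[OF fin _ generate_cyclic_factors[OF \<open>cyclic_factors n y\<close>] n(1)])
    fix x assume "x \<in> {n, y}"
    moreover have "inv y \<otimes> n \<otimes> y = n [^] (q + w * e)"
      unfolding conj w using n by (simp add: nat_pow_pow nat_pow_mult)
    ultimately show "inv x \<otimes> n \<otimes> x \<in> generate G {n}"
      using n generate.incl[of n "{n}" G] nat_pow_mem_generate[OF n(1)] by (auto simp: m_assoc)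
  qed (use n y in simp)
  ultimately show ?thesis
    unfolding metacyclic_factors_def by blast
qed

end

lemma metacyclic_factors_if_cyclic_factors_nat:
  fixes K :: "nat monoid"
  assumes "Factorial_Ring.prime p" "odd p"
  shows "\<lbrakk>group K; order K = p ^ M; group.cyclic_factors K a b\<rbrakk> \<Longrightarrow> \<exists>n y. group.metacyclic_factors K n y"
proof (induction M arbitrary: K a b rule: less_induct)
  case (less M)
  show ?case
    by (rule group.metacyclic_factors_induction_step[OF less.prems(1) assms less.prems(2,3)])
      (rule less.IH)
qed

context group
begin

text \<open>One further application of the induction step, whose hypothesis concerns only groups on
  \<open>nat\<close>, reaches an arbitrary element type.\<close>

theorem metacyclic_factors_if_cyclic_factors:
  assumes "Factorial_Ring.prime p" "odd p" "order G = p ^ M" "cyclic_factors a b"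
  shows "\<exists>n y. metacyclic_factors n y"
  by (rule metacyclic_factors_induction_step[OF assms])
    (rule metacyclic_factors_if_cyclic_factors_nat[OF assms(1,2)])

lemma metacyclic_groupI:
  assumes "metacyclic_factors n y"
  shows "metacyclic_group G"
  unfolding metacyclic_group_def
proof (intro exI conjI)
  have fac: "cyclic_factors n y" and ny: "n \<in> carrier G" "y \<in> carrier G"
    and normal: "generate G {n} \<lhd> G"
    using assms by (auto simp: metacyclic_factors_def cyclic_factors_def)
  let ?N = "generate G {n}"
  show "?N \<lhd> G" by fact
  have sub: "subgroup ?N G" by (rule generate_singleton_subgroup[OF ny(1)])
  interpret N: group "G\<lparr>carrier := ?N\<rparr>" by (rule subgroup_imp_group[OF sub])
  have nN: "n \<in> ?N" by (simp add: generate.incl)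
  show "cyclic_group (G\<lparr>carrier := ?N\<rparr>)"
    unfolding N.cyclic_group
  proof (rule bexI[of _ n])
    show "carrier (G\<lparr>carrier := ?N\<rparr>) = range (\<lambda>k::int. n [^]\<^bsub>G\<lparr>carrier := ?N\<rparr>\<^esub> k)"
    proof -
      have "carrier (G\<lparr>carrier := ?N\<rparr>) = ?N" by simp
      also have "?N = range (\<lambda>k::int. n [^] k)"
        by (rule generate_singleton_int_pow[OF ny(1)])
      finally show ?thesis
        unfolding int_pow_consistent[OF sub nN, symmetric] .
    qed
  qed (use nN in simp)
  interpret normal ?N G by (rule normal)
  interpret Q: group "G Mod ?N" by (rule factorgroup_is_group)
  interpret \<pi>: group_hom G "G Mod ?N" "\<lambda>g. ?N #> g"
    using r_coset_hom_Mod by unfold_locales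
  have "C \<in> range (\<lambda>k::int. (?N #> y) [^]\<^bsub>G Mod ?N\<^esub> k)" if "C \<in> carrier (G Mod ?N)" for C
  proof -
    obtain g where g: "g \<in> carrier G" "C = ?N #> g"
      using \<open>C \<in> carrier (G Mod ?N)\<close> by (auto simp: carrier_FactGroup)
    obtain i j :: nat where ij: "g = n [^] i \<otimes> y [^] j"
      using cyclic_factorsE[OF fac g(1)] .
    have "?N #> (n [^] i) = \<one>\<^bsub>G Mod ?N\<^esub>"
      using coset_join2[OF _ sub] nat_pow_mem_generate[OF ny(1)] ny by simp
    then have "C = (?N #> y) [^]\<^bsub>G Mod ?N\<^esub> j"
      using g(2) ny \<pi>.hom_mult[of "n [^] i" "y [^] j"] \<pi>.hom_nat_pow[OF ny(2), of j]
        Q.l_one[OF \<pi>.hom_closed[of "y [^] j"]]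
      unfolding ij by (simp only: nat_pow_closed)
    then show ?thesis
      by (metis int_pow_int rangeI)
  qed
  then show "cyclic_group (G Mod ?N)"
    unfolding Q.cyclic_group using \<pi>.hom_closed[OF ny(2)] Q.int_pow_closed
    by (intro bexI[of _ "?N #> y"]) blast+
qed

section \<open>Metacyclic p-groups as products of two cyclic subgroups\<close>

lemma cyclic_factors_sym:
  assumes fin: "finite (carrier G)" and "cyclic_factors x y"
  shows "cyclic_factors y x"
  unfolding cyclic_factors_def
proof (intro conjI ballI)
  show xy: "y \<in> carrier G" "x \<in> carrier G"
    using assms by (auto simp: cyclic_factors_def)
  fix g assume g: "g \<in> carrier G"
  obtain i j :: nat where "inv g = x [^] i \<otimes> y [^] j"
    using cyclic_factorsE[OF assms(2) inv_closed[OF g]] .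
  then have "g = inv (y [^] j) \<otimes> inv (x [^] i)"
    using g xy by (metis inv_inv inv_mult_group nat_pow_closed)
  then show "\<exists>(i::nat) (j::nat). g = y [^] i \<otimes> x [^] j"
    using inv_nat_pow_ex[OF fin xy(1), of j] inv_nat_pow_ex[OF fin xy(2), of i] by metis
qed

text \<open>\<open>(n v)^k\<close> is the product of the conjugates of \<open>n\<close> by
  \<open>v^i\<close>, which are \<open>n^(q^i)\<close>, for \<open>i < k\<close>, followed by
  \<open>v^k\<close>.\<close>

lemma left_conj_pow_mult:
  assumes v: "v \<in> carrier G" and n: "n \<in> carrier G"
    and conj: "v \<otimes> n = n [^] (q::nat) \<otimes> v"
  shows "(n \<otimes> v) [^] (k::nat) = n [^] (\<Sum>i<k. q ^ i) \<otimes> v [^] k"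
proof (induction k)
  case (Suc k)
  have vn: "v \<otimes> n [^] (l::nat) = n [^] (q * l) \<otimes> v" for l
  proof (induction l)
    case (Suc l)
    have "v \<otimes> n [^] Suc l = n [^] (q * l) \<otimes> (v \<otimes> n)"
      using Suc v n by (simp flip: m_assoc)
    also have "\<dots> = n [^] (q * Suc l) \<otimes> v"
      unfolding conj using v n by (simp add: nat_pow_mult add.commute flip: m_assoc)
    finally show ?case .
  qed (use v in simp)
  have "(n \<otimes> v) [^] Suc k = (n \<otimes> v) \<otimes> (n \<otimes> v) [^] k"
    using v n by (metis m_closed nat_pow_Suc2)
  also have "\<dots> = n \<otimes> (v \<otimes> n [^] (\<Sum>i<k. q ^ i)) \<otimes> v [^] k"
    unfolding Suc using v n by (simp add: m_assoc)
  also have "\<dots> = (n \<otimes> n [^] (q * (\<Sum>i<k. q ^ i))) \<otimes> (v \<otimes> v [^] k)"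
    unfolding vn using v n by (simp add: m_assoc)
  also have "n \<otimes> n [^] (q * (\<Sum>i<k. q ^ i)) = n [^] (1 + q * (\<Sum>i<k. q ^ i))"
    using n by (simp add: nat_pow_self_comm)
  also have "1 + q * (\<Sum>i<k. q ^ i) = (\<Sum>i<Suc k. q ^ i)"
    by (simp add: sum.lessThan_Suc_shift sum_distrib_left del: sum.lessThan_Suc)
  also have "v \<otimes> v [^] k = v [^] Suc k"
    using v by (simp add: nat_pow_self_comm)
  finally show ?case .
qed simp

text \<open>Write \<open>x = n^i y^j\<close>. If \<open>p\<close> does not divide \<open>i\<close>,
  then \<open>n^i\<close> may replace \<open>n\<close>, and the geometric sums place
  \<langle>n\<rangle> in \<langle>x\<rangle>\<langle>y\<rangle>. If \<open>p\<close> divides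
  \<open>i\<close>, then \<open>x\<close> and \<open>y\<close> lie in
  \<langle>n^p\<rangle>\<langle>y\<rangle>, which is therefore everything; this pushes
  \<open>n\<close> into \<langle>y\<rangle>, so that \<open>y\<close> alone generates.\<close>

lemma cyclic_factors_if_metacyclic_factors:
  assumes p: "Factorial_Ring.prime p" "odd p" and ord: "order G = p ^ M"
    and meta: "metacyclic_factors n y" and x: "x \<in> carrier G" and gen: "generate G {x, y} = carrier G"
  shows "cyclic_factors x y"
proof -
  note fin = finite_if_order_prime_power[OF p(1) ord]
  have fac: "cyclic_factors n y" and ny: "n \<in> carrier G" "y \<in> carrier G"
    and N: "generate G {n} \<lhd> G"
    using meta by (auto simp: metacyclic_factors_def cyclic_factors_def)
  have reduce: ?thesis if ex: "\<And>a::nat. \<exists>(k::nat) (l::nat). n [^] a = x [^] k \<otimes> y [^] l"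
    unfolding cyclic_factors_def
  proof (intro conjI ballI x ny)
    fix g assume "g \<in> carrier G"
    then obtain i j :: nat where g: "g = n [^] i \<otimes> y [^] j"
      using cyclic_factorsE[OF fac] by blast
    obtain k l :: nat where "n [^] i = x [^] k \<otimes> y [^] l"
      using ex by blast
    then have "g = x [^] k \<otimes> y [^] (l + j)"
      unfolding g using x ny by (simp add: m_assoc nat_pow_mult)
    then show "\<exists>(i::nat) (j::nat). g = x [^] i \<otimes> y [^] j"
      by (intro exI)
  qed
  obtain i j :: nat where xij: "x = n [^] i \<otimes> y [^] j"
    using cyclic_factorsE[OF fac x] .
  show ?thesis
  proof (cases "p dvd i")
    case True
    then obtain i' where i': "i = p * i'" ..
    let ?N = "generate G {n [^] p}"
    have npN: "n [^] p \<in> ?N" by (simp add: generate.incl)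
    have "?N \<lhd> G"
    proof (rule normal_generate_singletonI[OF fin _ generate_cyclic_factors[OF fac]])
      fix a assume a: "a \<in> {n, y}"
      then have aG: "a \<in> carrier G" using ny by auto
      have "inv a \<otimes> n \<otimes> a \<in> generate G {n}"
        using normal.inv_op_closed1[OF N aG] generate.incl[of n "{n}" G] by simp
      then obtain q :: nat where "inv a \<otimes> n \<otimes> a = n [^] q"
        unfolding generate_singleton_nat_pow[OF fin ny(1)] by auto
      then have "inv a \<otimes> n [^] p \<otimes> a = (n [^] p) [^] q"
        using aG ny by (simp add: conj_nat_pow nat_pow_pow mult.commute)
      then show "inv a \<otimes> n [^] p \<otimes> a \<in> ?N"
        using nat_pow_mem_generate[of "n [^] p" q] ny by simp
    qed (use ny in simp_all)
    then have sub: "subgroup (?N <#> generate G {y}) G"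
      using ny by (intro mult_norm_subgroup generate_singleton_subgroup)
    have mem: "(n [^] p) [^] (a::nat) \<otimes> y [^] (b::nat) \<in> ?N <#> generate G {y}" for a b
      unfolding set_mult_def using nat_pow_mem_generate ny by blast
    have "x \<in> ?N <#> generate G {y}"
      using mem[of i' j] ny unfolding xij i' by (simp add: nat_pow_pow)
    moreover have "y \<in> ?N <#> generate G {y}"
      using mem[of 0 1] ny by simp
    ultimately have "carrier G \<subseteq> ?N <#> generate G {y}"
      unfolding gen[symmetric] by (intro generate_subgroup_incl[OF _ sub]) simp
    then have "n \<in> ?N <#> generate G {y}"
      using ny by blast
    then obtain a b :: nat where ab: "n = (n [^] p) [^] a \<otimes> y [^] b"
      unfolding set_mult_def generate_singleton_nat_pow[OF fin ny(2)]
        generate_singleton_nat_pow[OF fin nat_pow_closed[OF ny(1)]] by blast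
    \<comment> \<open>From \<open>n = n^(p a) y^b\<close> one wants
      \<open>n^(1 - p a) = y^b\<close>. The exponent \<open>t\<close> is \<open>1 - p a\<close> with
      \<open>-1\<close> replaced by \<open>p^M - 1\<close>, which changes nothing since
      \<open>p^M\<close>-th powers are trivial; it is prime to \<open>p\<close>.\<close>
    define t where "t = p * a * (p ^ M - 1) + 1"
    have "n [^] t = (n [^] (p * a)) [^] (p ^ M - 1) \<otimes> ((n [^] p) [^] a \<otimes> y [^] b)"
      unfolding t_def using ny ab by (simp add: nat_pow_pow)
    also have "\<dots> = (n [^] (p * a)) [^] (p ^ M - 1 + 1) \<otimes> y [^] b"
      using ny by (simp add: nat_pow_pow m_assoc)
    also have "p ^ M - 1 + 1 = order G"
      using ord p(1) by (simp add: prime_gt_0_nat)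
    finally have nt: "n [^] t = y [^] b"
      using ny by (simp add: pow_order_eq_1)
    have "\<not> p dvd t"
      unfolding t_def using prime_gt_1_nat[OF p(1)] dvd_add_right_iff[of p "p * a * (p ^ M - 1)" 1]
      by simp
    then obtain u :: nat where "(n [^] t) [^] u = n"
      using pow_not_dvd_pow_eq[OF p(1) ord ny(1)] by blast
    then have "n [^] a = (y [^] (b * u)) [^] a" for a :: nat
      unfolding nt using ny by (simp add: nat_pow_pow)
    then have "n [^] a = x [^] (0::nat) \<otimes> y [^] (b * u * a)" for a :: nat
      using x ny by (simp add: nat_pow_pow)
    then show ?thesis
      by (intro reduce exI)
  next
    case False
    then obtain u :: nat where u: "(n [^] i) [^] u = n"
      using pow_not_dvd_pow_eq[OF p(1) ord ny(1)] by blast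
    define n' where "n' = n [^] i"
    define v where "v = y [^] j"
    have n'v: "n' \<in> carrier G" "v \<in> carrier G" "x = n' \<otimes> v"
      using ny xij by (simp_all add: n'_def v_def)
    have "v \<otimes> n \<otimes> inv v \<in> generate G {n}"
      using normal.inv_op_closed2[OF N n'v(2)] generate.incl[of n "{n}" G] by simp
    then obtain q :: nat where "v \<otimes> n \<otimes> inv v = n [^] q"
      unfolding generate_singleton_nat_pow[OF fin ny(1)] by auto
    then have conj: "v \<otimes> n' \<otimes> inv v = n' [^] q"
      unfolding n'_def using conj_nat_pow[of "inv v" n i] ny n'v
      by (simp add: nat_pow_pow mult.commute)
    then have vn': "v \<otimes> n' = n' [^] q \<otimes> v"
      using n'v by (metis inv_solve_right' m_closed nat_pow_closed)
    obtain s where s: "ord n' = p ^ s"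
      using ord_prime_power[OF p(1) ord n'v(1)] .
    have "\<exists>k. n [^] a = n' [^] (\<Sum>i<k. q ^ i)" for a :: nat
    proof (cases "n' = \<one>")
      case True
      then have "n = \<one>" using u by (simp flip: n'_def)
      then show ?thesis using True by simp
    next
      case False
      have "[q = 1] (mod p)"
      proof (rule conj_exponent_cong_1[OF p(1) ord])
        \<comment> \<open>The relation at hand conjugates by \<open>v\<close> from the left, so
          \<open>inv v\<close> takes the role of \<open>y\<close>, and the trivial element that of
          \<open>z\<close>.\<close>
        show "inv (inv v) \<otimes> n' \<otimes> inv v = n' [^] q \<otimes> \<one> [^] (0::nat)"
          using conj n'v by simp
        show "generate G {n'} \<inter> generate G {\<one>} = {\<one>}"
          using generate_one generate.one by blast
      qed (use n'v False in simp_all)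
      \<comment> \<open>The exponent \<open>u a\<close> turns \<open>n'\<close> into
        \<open>n^a\<close>, because \<open>n = n'^u\<close>.\<close>
      then obtain k where "[(\<Sum>i<k. q ^ i) = u * a] (mod p ^ s)"
        by (rule geometric_sum_surj[OF p])
      then have "n' [^] (\<Sum>i<k. q ^ i) = n' [^] (u * a)"
        using nat_pow_eq_iff_cong[OF n'v(1)] s by simp
      also have "\<dots> = n [^] a"
        using u n'v(1) by (simp flip: n'_def nat_pow_pow)
      finally show ?thesis by metis
    qed
    moreover have "n' [^] (\<Sum>i<k. q ^ i) = x [^] k \<otimes> inv (v [^] k)" for k
      unfolding n'v(3) left_conj_pow_mult[OF n'v(2,1) vn'] using n'v by (simp add: m_assoc)
    moreover have "\<exists>l::nat. inv (v [^] (k::nat)) = y [^] l" for k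
      unfolding v_def using inv_nat_pow_ex[OF fin ny(2), of "j * k"] ny by (simp add: nat_pow_pow)
    ultimately show ?thesis
      by (intro reduce) metis
  qed
qed

text \<open>A cyclic \<open>p\<close>-group \<langle>W\<rangle> is generated by each
  \<open>W^j\<close> with \<open>j\<close> prime to \<open>p\<close>, so \<open>y\<close> or
  \<open>x\<close> represents a generator of the quotient unless both images lie in
  \<langle>W^p\<rangle>. In that case, as they generate, \<open>W\<close> is a power of
  \<open>W^p\<close> and the quotient is trivial.\<close>

theorem cyclic_factors_if_metacyclic_group:
  assumes p: "Factorial_Ring.prime p" "odd p" and ord: "order G = p ^ M"
    and meta: "metacyclic_group G" and xy: "x \<in> carrier G" "y \<in> carrier G"
    and gen: "generate G {x, y} = carrier G"
  shows "cyclic_factors x y"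
proof -
  note fin = finite_if_order_prime_power[OF p(1) ord]
  obtain N where N: "N \<lhd> G" and cycN: "cyclic_group (G\<lparr>carrier := N\<rparr>)" and cycQ: "cyclic_group (G Mod N)"
    using meta by (auto simp: metacyclic_group_def)
  interpret N: normal N G by (rule N)
  interpret Q: group "G Mod N" by (rule N.factorgroup_is_group)
  interpret NG: group "G\<lparr>carrier := N\<rparr>" by (rule subgroup_imp_group[OF N.subgroup_axioms])
  interpret \<pi>: group_hom G "G Mod N" "\<lambda>g. N #> g"
    using N.r_coset_hom_Mod by unfold_locales
  obtain n where n: "n \<in> N" "N = generate G {n}"
  proof -
    obtain n where "n \<in> carrier (G\<lparr>carrier := N\<rparr>)"
      and N_eq: "carrier (G\<lparr>carrier := N\<rparr>) = range (\<lambda>k::int. n [^]\<^bsub>G\<lparr>carrier := N\<rparr>\<^esub> k)"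
      using cycN unfolding NG.cyclic_group by (elim bexE)
    then have n: "n \<in> N" by simp
    have "carrier (G\<lparr>carrier := N\<rparr>) = range (\<lambda>k::int. n [^] k)"
      using N_eq unfolding int_pow_consistent[OF N.subgroup_axioms n, symmetric] .
    also have "\<dots> = generate G {n}"
      using generate_singleton_int_pow n by simp
    finally show thesis
      using that[OF n] by simp
  qed
  have nG: "n \<in> carrier G" using n by simp
  have ord_dvd: "order (G Mod N) dvd p ^ M"
    using lagrange[OF N.subgroup_axioms] ord by (metis FactGroup_def dvd_triv_left order_def partial_object.simps(1))
  then obtain M' where ordQ: "order (G Mod N) = p ^ M'"
    using p(1) divides_primepow_nat by blast
  have finQ: "finite (carrier (G Mod N))"
    by (rule Q.finite_if_order_prime_power[OF p(1) ordQ])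
  obtain W where W: "W \<in> carrier (G Mod N)" "carrier (G Mod N) = generate (G Mod N) {W}"
    using cycQ Q.generate_singleton_int_pow unfolding Q.cyclic_group by metis
  have powW: "\<exists>k::nat. C = W [^]\<^bsub>G Mod N\<^esub> k" if "C \<in> carrier (G Mod N)" for C
    using that W(2) Q.generate_singleton_nat_pow[OF finQ W(1)] by auto
  have meta_y: "metacyclic_factors n y'" if y': "y' \<in> carrier G"
    and ex: "\<And>C. C \<in> carrier (G Mod N) \<Longrightarrow> \<exists>k::nat. C = (N #> y') [^]\<^bsub>G Mod N\<^esub> k" for y'
    unfolding metacyclic_factors_def cyclic_factors_def
  proof (intro conjI ballI nG y')
    show "generate G {n} \<lhd> G" using N n(2) by simp
    fix g assume g: "g \<in> carrier G"
    obtain k :: nat where "N #> g = (N #> y') [^]\<^bsub>G Mod N\<^esub> k"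
      using ex \<pi>.hom_closed[OF g] by blast
    then have "N #> g = N #> (y' [^] k)"
      using \<pi>.hom_nat_pow[OF y'] by simp
    then have "g \<in> N #> (y' [^] k)"
      using rcos_self[OF g N.subgroup_axioms] by simp
    then obtain h where h: "h \<in> N" "g = h \<otimes> y' [^] k"
      unfolding r_coset_def by blast
    obtain i :: nat where "h = n [^] i"
      using h(1) n(2) generate_singleton_nat_pow[OF fin nG] by auto
    then show "\<exists>(i::nat) (j::nat). g = n [^] i \<otimes> y' [^] j"
      using h(2) by blast
  qed
  have gen_if: "\<And>C. C \<in> carrier (G Mod N) \<Longrightarrow> \<exists>k::nat. C = (N #> y') [^]\<^bsub>G Mod N\<^esub> k"
    if y': "N #> y' = W [^]\<^bsub>G Mod N\<^esub> (j::nat)" "\<not> p dvd j" for y' j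
  proof -
    obtain u :: nat where u: "(W [^]\<^bsub>G Mod N\<^esub> j) [^]\<^bsub>G Mod N\<^esub> u = W"
      using Q.pow_not_dvd_pow_eq[OF p(1) ordQ W(1) y'(2)] .
    fix C assume "C \<in> carrier (G Mod N)"
    then obtain k :: nat where "C = W [^]\<^bsub>G Mod N\<^esub> k"
      using powW by blast
    then have "C = (N #> y') [^]\<^bsub>G Mod N\<^esub> (u * k)"
      unfolding y'(1) using u W(1) Q.nat_pow_pow[OF Q.nat_pow_closed[OF W(1)]] by metis
    then show "\<exists>k::nat. C = (N #> y') [^]\<^bsub>G Mod N\<^esub> k" ..
  qed
  obtain i where i: "N #> x = W [^]\<^bsub>G Mod N\<^esub> (i::nat)"
    using powW[OF \<pi>.hom_closed[OF xy(1)]] by blast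
  obtain j where j: "N #> y = W [^]\<^bsub>G Mod N\<^esub> (j::nat)"
    using powW[OF \<pi>.hom_closed[OF xy(2)]] by blast
  consider "\<not> p dvd j" | "\<not> p dvd i" | "p dvd i" "p dvd j" by blast
  then show ?thesis
  proof cases
    case 1
    show ?thesis
      by (rule cyclic_factors_if_metacyclic_factors[OF p ord meta_y[OF xy(2) gen_if[OF j 1]] xy(1) gen])
  next
    case 2
    have "generate G {y, x} = carrier G"
      using gen by (simp add: insert_commute)
    moreover have "metacyclic_factors n x"
      by (rule meta_y[OF xy(1) gen_if[OF i 2]])
    ultimately have "cyclic_factors y x"
      using cyclic_factors_if_metacyclic_factors[OF p ord _ xy(2)] by blast
    then show ?thesis
      by (rule cyclic_factors_sym[OF fin])
  next
    case 3
    let ?H = "generate (G Mod N) {W [^]\<^bsub>G Mod N\<^esub> p}"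
    have WpQ: "W [^]\<^bsub>G Mod N\<^esub> p \<in> carrier (G Mod N)"
      using W(1) by (rule Q.nat_pow_closed)
    have H: "subgroup ?H (G Mod N)"
      by (rule Q.generate_singleton_subgroup[OF WpQ])
    have dvdH: "W [^]\<^bsub>G Mod N\<^esub> k \<in> ?H" if "p dvd k" for k :: nat
      using that Q.nat_pow_pow[OF W(1)] Q.nat_pow_mem_generate[OF WpQ] by (metis dvdE)
    have "(\<lambda>g. N #> g) ` generate G {x, y} = generate (G Mod N) ((\<lambda>g. N #> g) ` {x, y})"
      using xy by (intro \<pi>.generate_img[symmetric]) simp
    also have "\<dots> \<subseteq> ?H"
      using dvdH[OF 3(1)] dvdH[OF 3(2)] i j by (intro Q.generate_subgroup_incl[OF _ H]) auto
    finally have "W \<in> ?H"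
      using W(1) unfolding gen carrier_FactGroup by (rule subsetD)
    then obtain u :: nat where "W = (W [^]\<^bsub>G Mod N\<^esub> p) [^]\<^bsub>G Mod N\<^esub> u"
      unfolding Q.generate_singleton_nat_pow[OF finQ WpQ] by auto
    then have "W [^]\<^bsub>G Mod N\<^esub> (1::nat) = W [^]\<^bsub>G Mod N\<^esub> (p * u)"
      using W(1) Q.nat_pow_pow Q.nat_pow_eone by metis
    then have cong: "[1 = p * u] (mod Q.ord W)"
      using Q.nat_pow_eq_iff_cong[OF W(1)] by blast
    obtain k where k: "Q.ord W = p ^ k"
      using Q.ord_prime_power[OF p(1) ordQ W(1)] .
    have "k = 0"
    proof (rule ccontr)
      assume "k \<noteq> 0"
      then have "[1 = p * u] (mod p)"
        using cong k by (metis cong_dvd_mono_modulus dvd_power not_gr_zero)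
      then have "p dvd 1"
        by (metis cong_dvd_iff dvd_triv_left)
      then show False using p(1) by simp
    qed
    then have "W = \<one>\<^bsub>G Mod N\<^esub>"
      using k Q.ord_eq_1[OF W(1)] by simp
    then have "C = (N #> y) [^]\<^bsub>G Mod N\<^esub> (0::nat)" if "C \<in> carrier (G Mod N)" for C
      using powW[OF that] Q.nat_pow_one by auto
    then have "metacyclic_factors n y"
      by (intro meta_y[OF xy(2)] exI)
    then show ?thesis
      by (rule cyclic_factors_if_metacyclic_factors[OF p ord _ xy(1) gen])
  qed
qed

end

section \<open>Generation and index two\<close>

context group
begin

text \<open>Meant for a union \<open>B\<close> of two cosets. Finiteness turns an inverse into
  repeated right multiplication by the generator; the claim is proved for all \<open>b\<close> in
  \<open>B\<close> so that it composes along products.\<close>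

lemma generate_subset_if_mult_closed:
  assumes fin: "finite (carrier G)" and A: "A \<subseteq> carrier G" and B: "B \<subseteq> carrier G"
    and closed: "\<And>b a. b \<in> B \<Longrightarrow> a \<in> A \<Longrightarrow> b \<otimes> a \<in> B" and one: "\<one> \<in> B"
  shows "generate G A \<subseteq> B"
proof
  fix g assume "g \<in> generate G A"
  then have "\<forall>b\<in>B. b \<otimes> g \<in> B"
  proof (induction rule: generate.induct)
    case one
    then show ?case using B by auto
  next
    case (incl a)
    then show ?case using closed by blast
  next
    case (inv a)
    then have a: "a \<in> carrier G" using A by blast
    have pow: "b \<otimes> a [^] (k::nat) \<in> B" if "b \<in> B" for b k
    proof (induction k)
      case 0
      show ?case using that B by (simp add: subsetD)
    next
      case (Suc k)
      have "b \<otimes> a [^] Suc k = b \<otimes> a [^] k \<otimes> a"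
        using subsetD[OF B that] a by (simp add: m_assoc)
      then show ?case using closed[OF Suc inv] by simp
    qed
    obtain k :: nat where "inv a = a [^] k"
      using inv_nat_pow_ex[OF fin a, of 1] a by auto
    then show ?case using pow by simp
  next
    case (eng g h)
    have "g \<in> carrier G" "h \<in> carrier G"
      using eng.hyps generate_in_carrier[OF A] by blast+
    then have "b \<otimes> (g \<otimes> h) = b \<otimes> g \<otimes> h" if "b \<in> B" for b
      using subsetD[OF B that] by (simp add: m_assoc)
    then show ?case using eng.IH by simp
  qed
  then have "\<one> \<otimes> g \<in> B"
    using one by blast
  then show "g \<in> B"
    using \<open>g \<in> generate G A\<close> generate_in_carrier[OF A] by simp
qed

text \<open>There are only two cosets, so \<open>x\<close> and \<open>inv y\<close>, both outside
  \<open>P\<close>, lie in the same one.\<close>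

lemma index_two_mult_mem:
  assumes fin: "finite (carrier G)" and P: "subgroup P G" and ord: "order G = 2 * card P"
    and x: "x \<in> carrier G" "x \<notin> P" and y: "y \<in> carrier G" "y \<notin> P"
  shows "x \<otimes> y \<in> P"
proof -
  have "card P > 0"
    using P fin subgroup.finite_imp_card_positive by blast
  then have "card (rcosets P) = 2"
    using lagrange[OF P] ord by simp
  then obtain C D where CD: "rcosets P = {C, D}"
    by (auto simp: card_2_iff)
  have ne: "P #> g \<noteq> P" if "g \<in> carrier G" "g \<notin> P" for g
    using that rcos_self[OF _ P] by blast
  have iy: "inv y \<notin> P"
    using y P by (metis inv_inv subgroup.m_inv_closed)
  have "P \<in> rcosets P"
    by (rule subgroup.subgroup_in_rcosets[OF P is_group])
  moreover have "P #> x \<in> rcosets P" "P #> inv y \<in> rcosets P"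
    using x y P subgroup.subset by (auto intro!: rcosetsI)
  ultimately have "P #> x = P #> inv y"
    using ne[OF x] ne[OF inv_closed[OF y(1)] iy] CD by auto
  then have "x \<in> P #> inv y"
    using rcos_self[OF x(1) P] by simp
  then obtain h where "h \<in> P" "x = h \<otimes> inv y"
    unfolding r_coset_def by blast
  then have "x \<otimes> y = h"
    using y(1) subgroup.mem_carrier[OF P] by (simp add: m_assoc)
  then show ?thesis
    using \<open>h \<in> P\<close> by simp
qed

lemma index_two_normal:
  assumes fin: "finite (carrier G)" and P: "subgroup P G" and ord: "order G = 2 * card P"
  shows "P \<lhd> G"
proof (rule normal_invI[OF P])
  fix x h assume x: "x \<in> carrier G" and h: "h \<in> P"
  then have hG: "h \<in> carrier G"
    using subgroup.mem_carrier[OF P] by blast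
  show "x \<otimes> h \<otimes> inv x \<in> P"
  proof (cases "x \<in> P")
    case True
    then show ?thesis
      using h P by (intro subgroup.m_closed subgroup.m_inv_closed)
  next
    case False
    show ?thesis
    proof (rule ccontr)
      assume "x \<otimes> h \<otimes> inv x \<notin> P"
      then have "(x \<otimes> h \<otimes> inv x) \<otimes> x \<in> P"
        using x hG False by (intro index_two_mult_mem[OF fin P ord]) simp_all
      then have "x \<otimes> h \<in> P"
        using x hG by (simp add: m_assoc)
      then have "x \<otimes> h \<otimes> inv h \<in> P"
        using subgroup.m_closed[OF P _ subgroup.m_inv_closed[OF P h]] by blast
      then show False
        using False x hG by (simp add: m_assoc)
    qed
  qed
qed

lemma conj_iso:
  assumes g: "g \<in> carrier G"
  shows "(\<lambda>x. inv g \<otimes> x \<otimes> g) \<in> iso G G"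
proof (rule isoI[OF conj_hom[OF g]])
  show "bij_betw (\<lambda>x. inv g \<otimes> x \<otimes> g) (carrier G) (carrier G)"
    by (rule bij_betw_byWitness[where f' = "\<lambda>x. g \<otimes> x \<otimes> inv g"]) (use g in \<open>auto simp: m_assoc\<close>)
qed

text \<open>A noncentral \<open>x\<close> gives a strict chain of four subgroups of
  \<open>p\<close>-power order: the trivial one, the center, the centralizer of \<open>x\<close>,
  the whole group. The center is nontrivial, \<open>x\<close> separates it from the centralizer, and
  \<open>w\<close> lies outside the latter.\<close>

lemma order_prime_power_not_comm:
  assumes p: "Factorial_Ring.prime p" and ord: "order G = p ^ m" and ncomm: "\<not> comm_group G"
  shows "m \<ge> 3"
proof -
  note fin = finite_if_order_prime_power[OF p ord]
  obtain x w where xw: "x \<in> carrier G" "w \<in> carrier G" "x \<otimes> w \<noteq> w \<otimes> x"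
    using ncomm group_comm_groupI by blast
  define Z where "Z = {z \<in> carrier G. \<forall>g\<in>carrier G. z \<otimes> g = g \<otimes> z}"
  define C where "C = {g \<in> carrier G. g \<otimes> x = x \<otimes> g}"
  have commI: "inv a \<otimes> g = g \<otimes> inv a" if "a \<otimes> g = g \<otimes> a" "a \<in> carrier G" "g \<in> carrier G" for a g
    using that by (metis inv_solve_left inv_solve_right m_assoc m_closed inv_closed)
  have comm2: "(a \<otimes> b) \<otimes> g = g \<otimes> (a \<otimes> b)"
    if "a \<otimes> g = g \<otimes> a" "b \<otimes> g = g \<otimes> b" "a \<in> carrier G" "b \<in> carrier G" "g \<in> carrier G" for a b g
    using that by (metis m_assoc)
  have subC: "subgroup C G"
    unfolding C_def by (rule subgroupI) (use xw(1) commI comm2 in \<open>auto simp del: m_assoc\<close>)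
  have subZ: "subgroup Z G"
  proof (rule subgroupI)
    show "Z \<subseteq> carrier G" "Z \<noteq> {}"
      unfolding Z_def by (auto intro!: exI[of _ \<one>])
    fix a assume a: "a \<in> Z"
    then show "inv a \<in> Z"
      using commI unfolding Z_def by simp
    fix b assume b: "b \<in> Z"
    show "a \<otimes> b \<in> Z"
      unfolding Z_def
    proof (intro CollectI conjI ballI)
      have ab: "a \<in> carrier G" "b \<in> carrier G"
        using a b unfolding Z_def by blast+
      then show "a \<otimes> b \<in> carrier G"
        by (rule m_closed)
      fix g assume "g \<in> carrier G"
      then show "(a \<otimes> b) \<otimes> g = g \<otimes> (a \<otimes> b)"
        using a b ab unfolding Z_def by (intro comm2) blast+
    qed
  qed
  have finC: "finite C"
    using fin by (simp add: C_def)
  have "Z \<subset> C"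
    using xw by (auto simp: Z_def C_def)
  then have "card Z < card C"
    by (rule psubset_card_mono[OF finC])
  moreover have "w \<notin> C" "C \<subseteq> carrier G"
    using xw(3) by (auto simp: C_def)
  then have "C \<subset> carrier G"
    using xw(2) by blast
  then have "card C < p ^ m"
    using psubset_card_mono[OF fin] ord by (simp add: order_def)
  moreover have "card Z > 1"
  proof -
    have "carrier G \<noteq> {\<one>}"
      using xw by auto
    then obtain z where z: "z \<in> carrier G" "z \<noteq> \<one>" "\<forall>g\<in>carrier G. z \<otimes> g = g \<otimes> z"
      using nontrivial_normal_meets_center[OF p ord normal_self] by blast
    then have "{\<one>, z} \<subseteq> Z"
      by (auto simp: Z_def)
    moreover have "finite Z"
      using fin by (simp add: Z_def)
    ultimately have "card {\<one>, z} \<le> card Z"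
      by (metis card_mono)
    then show ?thesis
      using z(2) by simp
  qed
  moreover obtain i where i: "card Z = p ^ i"
    using lagrange[OF subZ] ord p divides_primepow_nat by (metis dvd_triv_right)
  moreover obtain j where j: "card C = p ^ j"
    using lagrange[OF subC] ord p divides_primepow_nat by (metis dvd_triv_right)
  ultimately have "0 < i" "i < j" "j < m"
    using prime_gt_1_nat[OF p] by (auto simp: power_strict_increasing_iff intro: gr0I)
  then show ?thesis by simp
qed

lemma comm_group_if_cyclic:
  assumes "x \<in> carrier G" "generate G {x} = carrier G"
  shows "comm_group G"
proof -
  have "cyclic_group G"
    unfolding cyclic_group using assms generate_singleton_int_pow by metis
  then show ?thesis
    by (rule cyclic_imp_abelian_group)
qed

lemma min_gen_size_eq_2:
  assumes xy: "x \<in> carrier G" "y \<in> carrier G" and gen: "generate G {x, y} = carrier G"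
    and ncomm: "\<not> comm_group G"
  shows "min_gen_size G = 2"
  unfolding min_gen_size_def
proof (rule Least_equality)
  have "x \<noteq> y"
  proof
    assume "x = y"
    then have "generate G {x} = carrier G"
      using gen by (simp only: insert_absorb2)
    then show False
      using comm_group_if_cyclic[OF xy(1)] ncomm by simp
  qed
  then show "\<exists>S\<subseteq>carrier G. finite S \<and> card S = 2 \<and> generate G S = carrier G"
    using xy gen by (intro exI[of _ "{x, y}"]) simp
next
  fix n assume "\<exists>S\<subseteq>carrier G. finite S \<and> card S = n \<and> generate G S = carrier G"
  then obtain S where S: "S \<subseteq> carrier G" "finite S" "card S = n" "generate G S = carrier G" by blast
  show "2 \<le> n"
  proof (rule ccontr)
    assume "\<not> 2 \<le> n"
    then consider "n = 0" | "n = 1" by linarith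
    then show False
    proof cases
      case 1
      then have "generate G {\<one>} = carrier G"
        using S generate_one generate_empty by simp
      then show False
        using comm_group_if_cyclic ncomm by blast
    next
      case 2
      then obtain a where "S = {a}"
        using S by (auto simp: card_1_singleton_iff)
      then show False
        using comm_group_if_cyclic ncomm S by blast
    qed
  qed
qed

text \<open>Trivial intersection makes multiplication injective on \<langle>a\<rangle> \<times>
  \<langle>b\<rangle>, so the product set has \<open>ord a * ord b\<close> elements.\<close>

lemma cyclic_factors_iff_order:
  assumes fin: "finite (carrier G)" and ab: "a \<in> carrier G" "b \<in> carrier G"
    and disj: "generate G {a} \<inter> generate G {b} = {\<one>}"
  shows "cyclic_factors a b \<longleftrightarrow> ord a * ord b = order G"
proof -
  let ?A = "generate G {a}" and ?B = "generate G {b}"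
  note A = generate_singleton_subgroup[OF ab(1)] and B = generate_singleton_subgroup[OF ab(2)]
  have sub: "?A \<subseteq> carrier G" "?B \<subseteq> carrier G"
    using subgroup.subset[OF A] subgroup.subset[OF B] .
  have inj: "inj_on (\<lambda>(x, y). x \<otimes> y) (?A \<times> ?B)"
  proof (rule inj_onI, clarify)
    fix x y x' y' assume xy: "x \<in> ?A" "y \<in> ?B" "x' \<in> ?A" "y' \<in> ?B" "x \<otimes> y = x' \<otimes> y'"
    then have G: "x \<in> carrier G" "y \<in> carrier G" "x' \<in> carrier G" "y' \<in> carrier G"
      using sub by auto
    have eq: "inv x' \<otimes> x = y' \<otimes> inv y"
      using G xy(5) by (metis inv_closed inv_solve_left inv_solve_right m_assoc m_closed)
    have "inv x' \<otimes> x \<in> ?A"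
      using xy A by (intro subgroup.m_closed subgroup.m_inv_closed)
    moreover have "inv x' \<otimes> x \<in> ?B"
      unfolding eq using xy B by (intro subgroup.m_closed subgroup.m_inv_closed)
    ultimately have one: "inv x' \<otimes> x = \<one>"
      using disj by blast
    then have "x = x'"
      using G by (metis inv_closed inv_equality inv_inv)
    then show "x = x' \<and> y = y'"
      using xy(5) G by simp
  qed
  have img: "(\<lambda>(x, y). x \<otimes> y) ` (?A \<times> ?B) \<subseteq> carrier G"
    using sub by auto
  have card: "card ((\<lambda>(x, y). x \<otimes> y) ` (?A \<times> ?B)) = ord a * ord b"
    using card_image[OF inj] ab by (simp add: generate_pow_card card_cartesian_product)
  have "cyclic_factors a b \<longleftrightarrow> (\<lambda>(x, y). x \<otimes> y) ` (?A \<times> ?B) = carrier G"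
  proof
    assume fac: "cyclic_factors a b"
    have "g \<in> (\<lambda>(x, y). x \<otimes> y) ` (?A \<times> ?B)" if gG: "g \<in> carrier G" for g
    proof -
      obtain i j :: nat where "g = a [^] i \<otimes> b [^] j"
        using cyclic_factorsE[OF fac gG] .
      then show ?thesis
        using nat_pow_mem_generate[OF ab(1), of i] nat_pow_mem_generate[OF ab(2), of j] by auto
    qed
    then show "(\<lambda>(x, y). x \<otimes> y) ` (?A \<times> ?B) = carrier G"
      using img by (intro subset_antisym subsetI[of "carrier G"])
  next
    assume eq: "(\<lambda>(x, y). x \<otimes> y) ` (?A \<times> ?B) = carrier G"
    show "cyclic_factors a b"
      unfolding cyclic_factors_def
    proof (intro conjI ballI ab)
      fix g assume "g \<in> carrier G"
      then obtain x y where xy: "x \<in> ?A" "y \<in> ?B" "g = x \<otimes> y"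
        unfolding eq[symmetric] by auto
      then show "\<exists>(i::nat) (j::nat). g = a [^] i \<otimes> b [^] j"
        unfolding generate_singleton_nat_pow[OF fin ab(1)] generate_singleton_nat_pow[OF fin ab(2)]
        by blast
    qed
  qed
  also have "\<dots> \<longleftrightarrow> ord a * ord b = order G"
    using card_subset_eq[OF fin img] card by (auto simp: order_def)
  finally show ?thesis .
qed

end

section \<open>Groups of order \<open>2p\<^sup>m\<close> with chiral generators\<close>

text \<open>The interface between geometry and group theory: the conditions on the generators
  extracted from a chiral polyhedron, together with \<open>P\<close>. They are symmetric in
  \<open>s\<close> and \<open>t\<close>, so duality becomes an exchange of parameters.\<close>

locale chiral_pair = group G for G (structure) +
  fixes s t :: 'a and p m :: nat and P :: "'a set"
  assumes p: "Factorial_Ring.prime p" "odd p"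
    and ord_G: "order G = 2 * p ^ m"
    and st: "s \<in> carrier G" "t \<in> carrier G"
    and gen: "generate G {s, t} = carrier G"
    and ord_st: "ord (s \<otimes> t) = 2"
    and disj: "generate G {s} \<inter> generate G {t} = {\<one>}"
    and no_inverting: "\<And>\<alpha>. \<alpha> \<in> iso G G \<Longrightarrow> \<not> (\<alpha> s = inv s \<and> \<alpha> t = inv t)"
    and P_sub: "subgroup P G" and card_P: "card P = p ^ m"
begin

lemma fin: "finite (carrier G)"
  using ord_G p(1) order_gt_0_iff_finite by (metis mult_pos_pos prime_gt_0_nat zero_less_numeral zero_less_power)

lemma ord_G_card: "order G = 2 * card P"
  using ord_G card_P by simp

lemma P_carrier: "x \<in> P \<Longrightarrow> x \<in> carrier G"
  using subgroup.mem_carrier[OF P_sub] .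

text \<open>The quotient by \<open>P\<close> has order 2, so membership in \<open>P\<close> behaves
  like a sign.\<close>

lemma mult_mem_iff:
  assumes "x \<in> carrier G" "y \<in> carrier G"
  shows "x \<otimes> y \<in> P \<longleftrightarrow> (x \<in> P \<longleftrightarrow> y \<in> P)"
proof -
  have "inv x \<otimes> (x \<otimes> y) = y" "x \<otimes> y \<otimes> inv y = x"
    using assms by (simp_all add: m_assoc)
  then show ?thesis
    using index_two_mult_mem[OF fin P_sub ord_G_card] assms
      subgroup.m_closed[OF P_sub] subgroup.m_inv_closed[OF P_sub] by metis
qed

lemma P_normal: "P \<lhd> G"
  by (rule index_two_normal[OF fin P_sub ord_G_card])

lemma ord_P:
  assumes "x \<in> P"
  obtains l where "ord x = p ^ l"
proof -
  interpret PG: group "G\<lparr>carrier := P\<rparr>" by (rule subgroup_imp_group[OF P_sub])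
  have "ord x = card (generate G {x})"
    using generate_pow_card P_carrier[OF assms] .
  also have "\<dots> = PG.ord x"
    using PG.generate_pow_card[of x] generate_consistent[OF _ P_sub, of "{x}"] assms by simp
  finally have "ord x dvd p ^ m"
    using PG.ord_dvd_group_order[of x] assms card_P by (simp add: order_def)
  then show thesis
    using that p(1) divides_primepow_nat by blast
qed

lemma odd_ord_P: "x \<in> P \<Longrightarrow> odd (ord x)"
  using ord_P p(2) by (metis even_power)

text \<open>The power \<open>x^k\<close> lies in \<open>P\<close> exactly for even \<open>k\<close>,
  so the order of \<open>x\<close> is even, and \<open>x^2\<close>, lying in \<open>P\<close>, has
  \<open>p\<close>-power order.\<close>

lemma ord_not_P:
  assumes "x \<in> carrier G" "x \<notin> P"
  obtains l where "ord x = 2 * p ^ l" "ord (x [^] (2::nat)) = p ^ l" "x [^] (2::nat) \<in> P"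
proof -
  have pow: "x [^] (k::nat) \<in> P \<longleftrightarrow> even k" for k
    by (induction k) (use assms subgroup.one_closed[OF P_sub] in \<open>auto simp: mult_mem_iff\<close>)
  have "even (ord x)"
    using pow[of "ord x"] assms(1) subgroup.one_closed[OF P_sub] by simp
  then have "ord (x [^] (2::nat)) = ord x div 2"
    using assms(1) by (intro ord_pow) simp_all
  moreover have "x [^] (2::nat) \<in> P"
    using pow by simp
  ultimately show thesis
    using that ord_P \<open>even (ord x)\<close> by (metis dvd_mult_div_cancel)
qed

lemma st_not_P: "s \<otimes> t \<notin> P"
  using odd_ord_P[of "s \<otimes> t"] ord_st by auto

lemma semidirect:
  "P \<inter> generate G {s \<otimes> t} = {\<one>}" "carrier G = P <#> generate G {s \<otimes> t}"
proof -
  let ?u = "s \<otimes> t"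
  have u: "?u \<in> carrier G" using st by simp
  have uu: "?u \<otimes> ?u = \<one>"
    using pow_ord_eq_1[OF u] u ord_st by (simp add: numeral_2_eq_2)
  have one: "\<one> \<in> P"
    by (rule subgroup.one_closed[OF P_sub])
  have "?u [^] (k::nat) \<in> {\<one>, ?u}" for k
    by (induction k) (use u uu in auto)
  then have "generate G {?u} \<subseteq> {\<one>, ?u}"
    unfolding generate_singleton_nat_pow[OF fin u] by (rule image_subsetI)
  then have eq: "generate G {?u} = {\<one>, ?u}"
    using generate.one[of G "{?u}"] generate.incl[of ?u "{?u}" G] by auto
  show "P \<inter> generate G {?u} = {\<one>}"
    unfolding eq using one st_not_P by auto
  show "carrier G = P <#> generate G {?u}"
  proof
    show "P <#> generate G {?u} \<subseteq> carrier G"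
      unfolding eq set_mult_def using P_carrier u by auto
    show "carrier G \<subseteq> P <#> generate G {?u}"
    proof
      fix g assume g: "g \<in> carrier G"
      have "g = g \<otimes> \<one>" "g = (g \<otimes> ?u) \<otimes> ?u"
        using g u uu by (simp_all add: m_assoc del: m_closed)
      moreover have "g \<in> P \<or> g \<otimes> ?u \<in> P"
        using g u st_not_P by (simp add: mult_mem_iff del: m_closed)
      ultimately show "g \<in> P <#> generate G {?u}"
        unfolding eq set_mult_def by blast
    qed
  qed
qed

text \<open>The relation \<open>(s t)^2 = \<one>\<close> solved for \<open>inv s\<close>; in this
  form it lets \<open>t\<close> pass \<open>s\<close>.\<close>

lemma tst: "t \<otimes> s \<otimes> t = inv s"
proof -
  have "(s \<otimes> t) \<otimes> (s \<otimes> t) = \<one>"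
    using pow_ord_eq_1[of "s \<otimes> t"] st ord_st by (simp add: numeral_2_eq_2)
  then have "s \<otimes> (t \<otimes> s \<otimes> t) = \<one>"
    using st by (simp add: m_assoc)
  then show ?thesis
    using st by (metis inv_equality inv_comm m_closed)
qed

lemma s_mem_P_iff: "s \<in> P \<longleftrightarrow> t \<notin> P"
  using st_not_P st by (simp add: mult_mem_iff)

text \<open>Duality on the group side. Only the order of \<open>t s\<close> needs an argument: its
  square is trivial because \<open>t s t = inv s\<close>, and it is trivial only if
  \<open>s t\<close> is.\<close>

lemma chiral_pair_swap: "chiral_pair G t s p m P"
proof (intro chiral_pair.intro chiral_pair_axioms.intro is_group)
  have "ord (t \<otimes> s) = 2"
  proof -
    have "(t \<otimes> s) \<otimes> (t \<otimes> s) = \<one>"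
      using tst st by (metis l_inv m_assoc m_closed)
    then have "ord (t \<otimes> s) dvd 2"
      using st by (simp add: numeral_2_eq_2 flip: pow_eq_id)
    moreover have "t \<otimes> s \<noteq> \<one>"
    proof
      assume "t \<otimes> s = \<one>"
      then have "s \<otimes> t = \<one>"
        using st inv_comm by blast
      then show False using ord_st by simp
    qed
    then have "ord (t \<otimes> s) \<noteq> 1"
      using st ord_eq_1 by blast
    ultimately show ?thesis
      by (metis prime_nat_iff two_is_prime_nat)
  qed
  then show "ord (t \<otimes> s) = 2" .
  show "generate G {t, s} = carrier G" using gen by (simp add: insert_commute)
  show "generate G {t} \<inter> generate G {s} = {\<one>}" using disj by blast
  show "\<not> (\<alpha> t = inv t \<and> \<alpha> s = inv s)" if "\<alpha> \<in> iso G G" for \<alpha>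
    using no_inverting[OF that] by blast
qed (fact p ord_G st P_sub card_P)+

end

section \<open>The case of a first generator of odd order\<close>

locale chiral_pair_odd = chiral_pair +
  assumes s_P: "s \<in> P"
begin

lemma t_not_P: "t \<notin> P"
  using s_mem_P_iff s_P by blast

lemma t2: "t [^] (2::nat) \<in> P" "t [^] (2::nat) = t \<otimes> t"
  using ord_not_P[OF st(2) t_not_P] st by (blast, simp add: numeral_2_eq_2)

text \<open>If \<open>s\<close> is trivial, \<open>t s t = inv s\<close> makes \<open>t\<close> an
  involution or trivial, and the identity inverts both generators. This is what makes
  \<open>l\<^sub>1\<close> positive.\<close>

lemma s_neq_one: "s \<noteq> \<one>"
proof
  assume s: "s = \<one>"
  then have "t \<otimes> t = \<one>"
    using tst st by simp
  then have "t = inv t"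
    using st by (metis inv_equality)
  then show False
    using no_inverting[OF iso_set_refl] s by simp
qed

text \<open>If \<open>t = inv t\<close>, conjugation by \<open>t\<close> inverts \<open>s\<close>
  and fixes \<open>t\<close>, hence inverts both generators. This is what makes
  \<open>l\<^sub>2\<close> positive.\<close>

lemma t2_neq_one: "t [^] (2::nat) \<noteq> \<one>"
proof
  assume "t [^] (2::nat) = \<one>"
  then have t: "t = inv t"
    using st t2(2) by (metis inv_equality)
  have "inv t \<otimes> s \<otimes> t = inv s" "inv t \<otimes> t \<otimes> t = inv t"
    using tst st t by (metis, metis l_inv l_one)
  then show False
    using no_inverting[OF conj_iso[OF st(2)]] by blast
qed

lemma type_orders:
  obtains l\<^sub>1 l\<^sub>2 where "l\<^sub>1 > 0" "l\<^sub>2 > 0" "ord s = p ^ l\<^sub>1" "ord t = 2 * p ^ l\<^sub>2" "ord (t [^] (2::nat)) = p ^ l\<^sub>2"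
proof -
  obtain l\<^sub>1 where l1: "ord s = p ^ l\<^sub>1"
    using ord_P[OF s_P] .
  obtain l\<^sub>2 where l2: "ord t = 2 * p ^ l\<^sub>2" "ord (t [^] (2::nat)) = p ^ l\<^sub>2"
    using ord_not_P[OF st(2) t_not_P] .
  have "l\<^sub>1 \<noteq> 0"
    using l1 s_neq_one st ord_eq_1 by (metis power_0)
  moreover have "l\<^sub>2 \<noteq> 0"
    using l2(2) t2_neq_one st ord_eq_1 by (metis nat_pow_closed power_0)
  ultimately show thesis
    using that l1 l2 by blast
qed

text \<open>For the subgroup \<open>H\<close> on the right, \<open>H \<union> H t\<close> is closed
  under right multiplication by \<open>s\<close> and \<open>t\<close>, hence is all of
  \<open>G\<close>. So \<open>H\<close> has index at most 2, and it is contained in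
  \<open>P\<close>.\<close>

lemma P_eq_generate: "P = generate G {s, t [^] (2::nat)}"
proof -
  let ?H = "generate G {s, t [^] (2::nat)}"
  have sub: "{s, t [^] (2::nat)} \<subseteq> carrier G"
    using st by simp
  have H: "subgroup ?H G"
    by (rule generate_is_subgroup[OF sub])
  have HP: "?H \<subseteq> P"
    using s_P t2 by (intro generate_subgroup_incl[OF _ P_sub]) simp
  have sH: "s \<in> ?H" and tH: "t \<otimes> t \<in> ?H"
    using generate.incl[of s "{s, t [^] (2::nat)}" G] generate.incl[of "t [^] (2::nat)" "{s, t [^] (2::nat)}" G] t2(2)
    by simp_all
  \<comment> \<open>Writing \<open>inv t\<close> as \<open>inv (t t) t\<close> in
    \<open>t s = inv s inv t\<close> exhibits \<open>t s\<close> as an element of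
    \<open>H t\<close>.\<close>
  have ts: "t \<otimes> s = (inv s \<otimes> inv (t \<otimes> t)) \<otimes> t"
  proof -
    have "t \<otimes> s = inv s \<otimes> inv t"
      using tst st by (metis inv_solve_right inv_closed m_closed)
    then show ?thesis
      using st by (simp add: inv_mult_group m_assoc)
  qed
  let ?B = "?H \<union> (\<lambda>h. h \<otimes> t) ` ?H"
  have HG: "h \<in> carrier G" if "h \<in> ?H" for h
    using that subgroup.mem_carrier[OF H] by blast
  have "carrier G \<subseteq> ?B"
    unfolding gen[symmetric]
  proof (rule generate_subset_if_mult_closed[OF fin])
    show "?B \<subseteq> carrier G"
      using HG st by auto
    show "\<one> \<in> ?B"
      using subgroup.one_closed[OF H] by blast
    fix b a assume b: "b \<in> ?B" and a: "a \<in> {s, t}"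
    have "h \<otimes> s \<in> ?H" "h \<otimes> t \<in> (\<lambda>h. h \<otimes> t) ` ?H"
      "h \<otimes> t \<otimes> s \<in> (\<lambda>h. h \<otimes> t) ` ?H" "h \<otimes> t \<otimes> t \<in> ?H" if h: "h \<in> ?H" for h
    proof -
      show "h \<otimes> s \<in> ?H" "h \<otimes> t \<in> (\<lambda>h. h \<otimes> t) ` ?H"
        using subgroup.m_closed[OF H h sH] h by blast+
      have "h \<otimes> t \<otimes> s = h \<otimes> (inv s \<otimes> inv (t \<otimes> t)) \<otimes> t"
        using HG[OF h] st ts by (simp add: m_assoc)
      moreover have "h \<otimes> (inv s \<otimes> inv (t \<otimes> t)) \<in> ?H"
        by (intro subgroup.m_closed[OF H h] subgroup.m_closed[OF H subgroup.m_inv_closed[OF H sH] subgroup.m_inv_closed[OF H tH]])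
      ultimately show "h \<otimes> t \<otimes> s \<in> (\<lambda>h. h \<otimes> t) ` ?H"
        by blast
      show "h \<otimes> t \<otimes> t \<in> ?H"
        using subgroup.m_closed[OF H h tH] HG[OF h] st by (simp add: m_assoc)
    qed
    then show "b \<otimes> a \<in> ?B"
      using a b by blast
  qed (use st in simp)
  moreover have finH: "finite ?H"
    using fin HG by (meson finite_subset subsetI)
  ultimately have "order G \<le> card ?B"
    unfolding order_def by (intro card_mono) simp_all
  also have "\<dots> \<le> card ?H + card ?H"
    using card_Un_le[of ?H "(\<lambda>h. h \<otimes> t) ` ?H"] card_image_le[OF finH, of "\<lambda>h. h \<otimes> t"] by linarith
  finally have "card P \<le> card ?H"
    using ord_G_card by simp
  then show ?thesis
    using HP card_seteq[of P ?H] fin subgroup.subset[OF P_sub] by (metis finite_subset)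
qed

text \<open>
  If \<open>P\<close> were abelian, then inversion on \<open>P\<close> would extend to an automorphism inverting both generators.
\<close>

lemma P_not_comm: "\<exists>x\<in>P. \<exists>y\<in>P. x \<otimes> y \<noteq> y \<otimes> x"
proof (rule ccontr)
  assume "\<not> ?thesis"
  then have comm: "x \<otimes> y = y \<otimes> x" if "x \<in> P" "y \<in> P" for x y
    using that by blast
  \<comment> \<open>For \<open>g'\<close> in \<open>P\<close> the second branch sends
    \<open>g' t\<close> to \<open>inv g' inv t\<close>, the value forced by inverting
    \<open>t\<close>; the formula needs no choice of \<open>g'\<close>.\<close>
  define \<alpha> where "\<alpha> g = (if g \<in> P then inv g else t \<otimes> inv g \<otimes> inv t)" for g
  have split: "\<exists>g'\<in>P. g = g' \<otimes> t" if "g \<in> carrier G" "g \<notin> P" for g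
  proof (rule bexI[of _ "g \<otimes> inv t"])
    have "inv t \<notin> P"
      using t_not_P st by (metis inv_inv subgroup.m_inv_closed[OF P_sub])
    then show "g \<otimes> inv t \<in> P"
      using that st by (simp add: mult_mem_iff)
  qed (use that st in \<open>simp add: m_assoc\<close>)
  have P_inv: "inv h \<in> P" if "h \<in> P" for h
    using that by (rule subgroup.m_inv_closed[OF P_sub])
  have conjP: "x \<otimes> h \<otimes> inv x \<in> P" "inv x \<otimes> h \<otimes> x \<in> P" if "h \<in> P" "x \<in> carrier G" for h x
    using normal.inv_op_closed2[OF P_normal that(2,1)] normal.inv_op_closed1[OF P_normal that(2,1)] .
  have \<alpha>P: "\<alpha> g = inv g" if "g \<in> P" for g
    using that by (simp add: \<alpha>_def)
  have \<alpha>t: "\<alpha> (g \<otimes> t) = inv g \<otimes> inv t" if "g \<in> P" for g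
  proof -
    have "g \<otimes> t \<notin> P"
      using that t_not_P st P_carrier by (simp add: mult_mem_iff)
    then show ?thesis
      using that st P_carrier by (simp add: \<alpha>_def inv_mult_group m_assoc)
  qed
  have "\<alpha> \<in> hom G G"
  proof (rule homI)
    show "\<alpha> g \<in> carrier G" if "g \<in> carrier G" for g
      using that st by (simp add: \<alpha>_def)
    fix g h assume gh: "g \<in> carrier G" "h \<in> carrier G"
    show "\<alpha> (g \<otimes> h) = \<alpha> g \<otimes> \<alpha> h"
    proof (cases "g \<in> P")
      case g: True
      show ?thesis
      proof (cases "h \<in> P")
        case True
        then show ?thesis
          using g gh \<alpha>P comm[OF P_inv P_inv] subgroup.m_closed[OF P_sub] by (simp add: inv_mult_group)
      next
        case False
        then obtain h' where h': "h' \<in> P" "h = h' \<otimes> t"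
          using split gh by blast
        have "\<alpha> (g \<otimes> h) = \<alpha> ((g \<otimes> h') \<otimes> t)"
          using h' gh st P_carrier by (simp add: m_assoc)
        also have "\<dots> = inv g \<otimes> inv h' \<otimes> inv t"
          using \<alpha>t[OF subgroup.m_closed[OF P_sub g h'(1)]] comm[OF P_inv P_inv, of g h'] g h' gh P_carrier
          by (simp add: inv_mult_group)
        finally show ?thesis
          using \<alpha>P[OF g] \<alpha>t[OF h'(1)] h' gh st P_carrier by (simp add: m_assoc)
      qed
    next
      case False
      then obtain g' where g': "g' \<in> P" "g = g' \<otimes> t"
        using split gh by blast
      have g'G: "g' \<in> carrier G" using g' P_carrier by blast
      show ?thesis
      proof (cases "h \<in> P")
        case h: True
        let ?k = "t \<otimes> h \<otimes> inv t"
        have kP: "?k \<in> P"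
          by (rule conjP(1)[OF h st(2)])
        have "\<alpha> (g \<otimes> h) = \<alpha> ((g' \<otimes> ?k) \<otimes> t)"
          using g' g'G gh st by (simp add: m_assoc)
        also have "\<dots> = inv (g' \<otimes> ?k) \<otimes> inv t"
          by (rule \<alpha>t[OF subgroup.m_closed[OF P_sub g'(1) kP]])
        also have "inv (g' \<otimes> ?k) = inv g' \<otimes> inv ?k"
          using comm[OF P_inv P_inv, of g' ?k] g' g'G kP P_carrier by (simp only: inv_mult_group)
        also have "inv g' \<otimes> inv ?k \<otimes> inv t = inv g' \<otimes> (inv ?k \<otimes> inv t)"
          using g'G gh st by (simp add: m_assoc)
        \<comment> \<open>Here \<open>t^2 \<in> P\<close> enters: it commutes with \<open>h\<close>,
          so conjugation by \<open>t\<close> and by \<open>inv t\<close> agree on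
          \<open>P\<close>.\<close>
        also have "inv ?k \<otimes> inv t = inv t \<otimes> inv h"
        proof -
          have "inv (t \<otimes> t) \<otimes> inv h = inv h \<otimes> inv (t \<otimes> t)"
            using comm[OF P_inv P_inv, of "t \<otimes> t" h] t2 h by simp
          then have "t \<otimes> (inv (t \<otimes> t) \<otimes> inv h) = t \<otimes> (inv h \<otimes> inv (t \<otimes> t))"
            by simp
          then show ?thesis
            using gh st by (simp add: inv_mult_group m_assoc)
        qed
        finally show ?thesis
          using \<alpha>P[OF h] \<alpha>t[OF g'(1)] g' g'G gh st kP P_carrier by (simp add: m_assoc)
      next
        case False
        then obtain h' where h': "h' \<in> P" "h = h' \<otimes> t"
          using split gh by blast
        have h'G: "h' \<in> carrier G" using h' P_carrier by blast
        let ?k = "t \<otimes> h' \<otimes> t"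
        have kP: "?k \<in> P"
          using h' h'G st t_not_P by (simp add: mult_mem_iff)
        have "g \<otimes> h = g' \<otimes> ?k"
          using g' h' g'G h'G st by (simp add: m_assoc)
        then have "\<alpha> (g \<otimes> h) = inv g' \<otimes> inv ?k"
          using \<alpha>P[OF subgroup.m_closed[OF P_sub g'(1) kP]] comm[OF P_inv P_inv, of g' ?k] g' g'G kP P_carrier
          by (simp only: inv_mult_group)
        then show ?thesis
          using \<alpha>t[OF g'(1)] \<alpha>t[OF h'(1)] g' h' g'G h'G st by (simp add: inv_mult_group m_assoc)
      qed
    qed
  qed
  moreover have "inj_on \<alpha> (carrier G)"
  proof -
    interpret \<alpha>: group_hom G G \<alpha>
      using calculation by unfold_locales
    show ?thesis
      unfolding \<alpha>.inj_on_one_iff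
    proof (intro allI impI)
      fix g assume g: "g \<in> carrier G" "\<alpha> g = \<one>"
      show "g = \<one>"
      proof (cases "g \<in> P")
        case True
        then show ?thesis using g by (simp add: \<alpha>_def)
      next
        case False
        then have "t \<otimes> inv g \<otimes> inv t = \<one>"
          using g by (simp add: \<alpha>_def)
        then have "t \<otimes> inv g = \<one> \<otimes> t"
          using g st by (metis inv_closed inv_solve_right' m_closed one_closed)
        then show ?thesis
          using g st by simp
      qed
    qed
  qed
  moreover have "\<alpha> ` carrier G \<subseteq> carrier G"
    using calculation(1) by (auto simp: hom_def)
  ultimately have "\<alpha> \<in> iso G G"
    using endo_inj_surj[OF fin] by (auto simp: iso_def bij_betw_def)
  moreover have "\<alpha> s = inv s"
    by (rule \<alpha>P[OF s_P])
  moreover have "\<alpha> t = inv t"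
    using t_not_P st by (simp add: \<alpha>_def m_assoc)
  ultimately show False
    using no_inverting by blast
qed

theorem structure_of_P:
  shows "min_gen_size (G\<lparr>carrier := P\<rparr>) = 2" and "\<not> comm_group (G\<lparr>carrier := P\<rparr>)" and "m \<ge> 3"
    and "ord s * ord t = order G \<longleftrightarrow> metacyclic_group (G\<lparr>carrier := P\<rparr>)"
proof -
  let ?P = "G\<lparr>carrier := P\<rparr>" and ?b = "t [^] (2::nat)"
  interpret PG: group ?P by (rule subgroup_imp_group[OF P_sub])
  show ncomm: "\<not> comm_group ?P"
  proof
    assume "comm_group ?P"
    then interpret C: comm_group ?P .
    show False
      using P_not_comm C.m_comm by auto
  qed
  have sb: "s \<in> carrier ?P" "?b \<in> carrier ?P"
    using s_P t2 by simp_all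
  have generate_eq: "generate ?P A = generate G A" if "A \<subseteq> P" for A
    by (rule generate_consistent[OF that P_sub])
  have genP: "generate ?P {s, ?b} = carrier ?P"
    using generate_eq[of "{s, ?b}"] s_P t2 P_eq_generate by simp
  show "min_gen_size ?P = 2"
    by (rule PG.min_gen_size_eq_2[OF sb genP ncomm])
  have ordP: "order ?P = p ^ m"
    using card_P by (simp add: order_def)
  show "m \<ge> 3"
    by (rule PG.order_prime_power_not_comm[OF p(1) ordP ncomm])
  have ord_eq: "PG.ord x = ord x" if "x \<in> P" for x
    using PG.generate_pow_card[of x] generate_pow_card[of x] generate_eq[of "{x}"] that P_carrier by simp
  have "generate G {?b} \<subseteq> generate G {t}"
    using nat_pow_mem_generate[OF st(2)] by (intro generate_subgroup_incl generate_singleton_subgroup st) simp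
  then have "generate G {s} \<inter> generate G {?b} = {\<one>}"
    using disj generate.one by blast
  then have disjP: "generate ?P {s} \<inter> generate ?P {?b} = {\<one>\<^bsub>?P\<^esub>}"
    using generate_eq s_P t2 by simp
  have finP: "finite (carrier ?P)"
    using PG.finite_if_order_prime_power[OF p(1) ordP] .
  obtain l\<^sub>2 where l2: "ord t = 2 * p ^ l\<^sub>2" "ord ?b = p ^ l\<^sub>2"
    using type_orders .
  \<comment> \<open>The factor 2 in the order of \<open>t\<close> cancels against the index of
    \<open>P\<close>.\<close>
  have "ord s * ord t = order G \<longleftrightarrow> PG.ord s * PG.ord ?b = order ?P"
    using l2 ord_G ordP ord_eq s_P t2 by simp
  also have "\<dots> \<longleftrightarrow> PG.cyclic_factors s ?b"
    using PG.cyclic_factors_iff_order[OF finP sb disjP] by simp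
  also have "\<dots> \<longleftrightarrow> metacyclic_group ?P"
    using PG.metacyclic_factors_if_cyclic_factors[OF p ordP] PG.metacyclic_groupI
      PG.cyclic_factors_if_metacyclic_group[OF p ordP _ sb genP] by blast
  finally show "ord s * ord t = order G \<longleftrightarrow> metacyclic_group ?P" .
qed

end

context chiral_pair
begin

text \<open>Parity of the order decides which generator lies in \<open>P\<close>, so the given
  orders admit only one of the two patterns, and the clause for the other one is vacuous.\<close>

theorem chiral_pair_structure:
  fixes k\<^sub>1 k\<^sub>2 :: nat
  assumes k: "ord s = k\<^sub>1" "ord t = k\<^sub>2"
  shows
    "(P \<lhd> G \<and> P \<inter> generate G {s \<otimes> t} = {\<one>} \<and> carrier G = P <#> generate G {s \<otimes> t}) \<and>
     (\<exists>l\<^sub>1 l\<^sub>2. l\<^sub>1 > 0 \<and> l\<^sub>2 > 0 \<and>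
        ((k\<^sub>1, k\<^sub>2) = (p ^ l\<^sub>1, 2 * p ^ l\<^sub>2) \<or> (k\<^sub>1, k\<^sub>2) = (2 * p ^ l\<^sub>2, p ^ l\<^sub>1))) \<and>
     (\<forall>l\<^sub>1 l\<^sub>2. l\<^sub>1 > 0 \<and> l\<^sub>2 > 0 \<longrightarrow>
        ((k\<^sub>1, k\<^sub>2) = (p ^ l\<^sub>1, 2 * p ^ l\<^sub>2) \<longrightarrow> P = generate G {s, t [^] (2::nat)}) \<and>
        ((k\<^sub>1, k\<^sub>2) = (2 * p ^ l\<^sub>2, p ^ l\<^sub>1) \<longrightarrow> P = generate G {t, s [^] (2::nat)})) \<and>
     (min_gen_size (G\<lparr>carrier := P\<rparr>) = 2 \<and> \<not> comm_group (G\<lparr>carrier := P\<rparr>) \<and> m \<ge> 3) \<and>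
     (k\<^sub>1 * k\<^sub>2 = order G \<longleftrightarrow> metacyclic_group (G\<lparr>carrier := P\<rparr>))"
proof -
  have mem: "x \<in> P \<longleftrightarrow> odd (ord x)" if "x \<in> carrier G" for x
    using odd_ord_P ord_not_P[OF that] by (metis dvd_triv_left)
  have case_s: "s \<in> P" if "k\<^sub>1 = p ^ l" for l
    using mem[OF st(1)] k(1) that p(2) by simp
  have case_t: "t \<in> P" if "k\<^sub>2 = p ^ l" for l
    using mem[OF st(2)] k(2) that p(2) by simp
  show ?thesis
  proof (cases "s \<in> P")
    case True
    interpret A: chiral_pair_odd G s t p m P by unfold_locales (rule True)
    have "t \<notin> P" using True s_mem_P_iff by blast
    obtain l\<^sub>1 l\<^sub>2 where l: "l\<^sub>1 > 0" "l\<^sub>2 > 0" "ord s = p ^ l\<^sub>1" "ord t = 2 * p ^ l\<^sub>2"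
      using A.type_orders .
    have "\<exists>l\<^sub>1 l\<^sub>2. l\<^sub>1 > 0 \<and> l\<^sub>2 > 0 \<and>
        ((k\<^sub>1, k\<^sub>2) = (p ^ l\<^sub>1, 2 * p ^ l\<^sub>2) \<or> (k\<^sub>1, k\<^sub>2) = (2 * p ^ l\<^sub>2, p ^ l\<^sub>1))"
      using l k by (intro exI[of _ l\<^sub>1] exI[of _ l\<^sub>2]) simp
    moreover have "k\<^sub>2 \<noteq> p ^ l" for l
      using case_t \<open>t \<notin> P\<close> by blast
    ultimately show ?thesis
      using P_normal semidirect A.structure_of_P A.P_eq_generate unfolding k by blast
  next
    case False
    interpret S: chiral_pair G t s p m P by (rule chiral_pair_swap)
    have tP: "t \<in> P" using False s_mem_P_iff by blast
    interpret A: chiral_pair_odd G t s p m P by unfold_locales (rule tP)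
    obtain l\<^sub>1 l\<^sub>2 where l: "l\<^sub>1 > 0" "l\<^sub>2 > 0" "ord t = p ^ l\<^sub>1" "ord s = 2 * p ^ l\<^sub>2"
      using A.type_orders .
    have "\<exists>l\<^sub>1 l\<^sub>2. l\<^sub>1 > 0 \<and> l\<^sub>2 > 0 \<and>
        ((k\<^sub>1, k\<^sub>2) = (p ^ l\<^sub>1, 2 * p ^ l\<^sub>2) \<or> (k\<^sub>1, k\<^sub>2) = (2 * p ^ l\<^sub>2, p ^ l\<^sub>1))"
      using l k by (intro exI[of _ l\<^sub>1] exI[of _ l\<^sub>2]) simp
    moreover have "k\<^sub>1 \<noteq> p ^ l" for l
      using case_s False by blast
    ultimately show ?thesis
      using P_normal semidirect A.structure_of_P A.P_eq_generate unfolding k mult.commute[of k\<^sub>2] by blast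
  qed
qed

end

section \<open>Flags of abstract polyhedra\<close>

context abstract_polyhedron
begin

lemma refl_r: "x \<in> Field r \<Longrightarrow> (x, x) \<in> r"
  using poset by (auto simp: partial_order_on_def preorder_on_def refl_on_def)

lemma trans_r: "(x, y) \<in> r \<Longrightarrow> (y, z) \<in> r \<Longrightarrow> (x, z) \<in> r"
  using poset by (auto simp: partial_order_on_def preorder_on_def dest: transD)

lemma rk_le: "(x, y) \<in> r \<Longrightarrow> rk x \<le> rk y"
  using rank_strict_mono[of x y] by (cases "x = y") auto

lemma rk_eq_imp_eq: "(x, y) \<in> r \<or> (y, x) \<in> r \<Longrightarrow> rk x = rk y \<Longrightarrow> x = y"
  using rank_strict_mono[of x y] rank_strict_mono[of y x] by auto

lemma rk_mem: "x \<in> Field r \<Longrightarrow> rk x \<in> {-1, 0, 1, 2, 3}"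
  using rank_range by blast

definition is_chain :: "'a set \<Rightarrow> bool" where
  "is_chain C \<longleftrightarrow> C \<subseteq> Field r \<and> (\<forall>x\<in>C. \<forall>y\<in>C. (x, y) \<in> r \<or> (y, x) \<in> r)"

lemma pred_on_chain_iff: "pred_on.chain (Field r) (\<lambda>x y. (x, y) \<in> r) C \<longleftrightarrow> is_chain C"
  unfolding pred_on.chain_def is_chain_def using refl_r by blast

lemma chain_inj_rk: "is_chain C \<Longrightarrow> inj_on rk C"
  unfolding is_chain_def by (intro inj_onI) (meson rk_eq_imp_eq)

lemma chain_rk_image: "is_chain C \<Longrightarrow> rk ` C \<subseteq> {-1, 0, 1, 2, 3}"
  unfolding is_chain_def using rank_range by blast

lemma finite_chain: "is_chain C \<Longrightarrow> finite C"
  using chain_inj_rk chain_rk_image by (meson finite.emptyI finite.insertI inj_on_finite)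

lemma card_chain: "is_chain C \<Longrightarrow> card C \<le> 5"
  using card_inj_on_le[of rk C "{-1, 0, 1, 2, 3}"] chain_inj_rk chain_rk_image by simp

lemma flag_iff_maximal_chain:
  "flag r C \<longleftrightarrow> is_chain C \<and> (\<nexists>D. is_chain D \<and> C \<subset> D)"
  unfolding flag_def pred_on.maxchain_def pred_on_chain_iff ..

text \<open>The rank is injective on chains and takes five values, so chains have at most five
  elements and those with five are maximal; P2 is the converse.\<close>

lemma flag_iff: "flag r C \<longleftrightarrow> is_chain C \<and> card C = 5"
proof
  assume "flag r C"
  then show "is_chain C \<and> card C = 5"
    using P2 flag_iff_maximal_chain by blast
next
  assume C: "is_chain C \<and> card C = 5"
  have False if "is_chain D" "C \<subset> D" for D
    using psubset_card_mono[OF finite_chain[OF that(1)] that(2)] card_chain[OF that(1)] C by simp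
  then show "flag r C"
    unfolding flag_iff_maximal_chain using C by blast
qed

lemma chain_extend:
  assumes "is_chain C"
  obtains \<Psi> where "flag r \<Psi>" "C \<subseteq> \<Psi>"
proof -
  \<comment> \<open>A chain of greatest cardinality exists since cardinalities are at most 5; the
    bound 6 appears because the rule asks for a strict one.\<close>
  have "\<exists>\<Psi>. (is_chain \<Psi> \<and> C \<subseteq> \<Psi>) \<and> (\<forall>D. is_chain D \<and> C \<subseteq> D \<longrightarrow> card D \<le> card \<Psi>)"
    by (rule ex_has_greatest_nat[of _ C _ 6]) (use assms in \<open>auto intro: le_less_trans[OF card_chain]\<close>)
  then obtain \<Psi> where \<Psi>: "is_chain \<Psi>" "C \<subseteq> \<Psi>"
    and max: "\<And>D. is_chain D \<Longrightarrow> C \<subseteq> D \<Longrightarrow> card D \<le> card \<Psi>" by blast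
  have False if "is_chain D" "\<Psi> \<subset> D" for D
    using psubset_card_mono[OF finite_chain[OF that(1)] that(2)] max[OF that(1)] \<Psi>(2) that(2) by auto
  then show thesis
    using that \<Psi> unfolding flag_iff_maximal_chain by blast
qed

lemma flag_chain: "flag r \<Psi> \<Longrightarrow> is_chain \<Psi>"
  by (simp add: flag_iff)

lemma flag_Field: "flag r \<Psi> \<Longrightarrow> x \<in> \<Psi> \<Longrightarrow> x \<in> Field r"
  by (auto simp: flag_iff is_chain_def)

lemma flag_inj: "flag r \<Psi> \<Longrightarrow> x \<in> \<Psi> \<Longrightarrow> y \<in> \<Psi> \<Longrightarrow> rk x = rk y \<Longrightarrow> x = y"
  using chain_inj_rk[OF flag_chain] by (meson inj_onD)

lemma flag_rk_image: "flag r \<Psi> \<Longrightarrow> rk ` \<Psi> = {-1, 0, 1, 2, 3}"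
  using card_subset_eq[OF _ chain_rk_image] card_image[OF chain_inj_rk] by (simp add: flag_iff)

lemma flag_le_iff: "flag r \<Psi> \<Longrightarrow> x \<in> \<Psi> \<Longrightarrow> y \<in> \<Psi> \<Longrightarrow> (x, y) \<in> r \<longleftrightarrow> rk x \<le> rk y"
  using rk_le[of x y] rk_le[of y x] rk_eq_imp_eq[of x y] refl_r[OF flag_Field] unfolding flag_iff is_chain_def
  by (metis order_antisym)

lemma flag_containing:
  assumes "x \<in> Field r"
  obtains \<Psi> where "flag r \<Psi>" "x \<in> \<Psi>"
proof -
  have "is_chain {x}"
    using assms refl_r by (simp add: is_chain_def)
  then show thesis
    by (rule chain_extend) (use that in blast)
qed

lemma flag_containing_pair:
  assumes "(x, y) \<in> r"
  obtains \<Psi> where "flag r \<Psi>" "x \<in> \<Psi>" "y \<in> \<Psi>"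
proof -
  have "x \<in> Field r" "y \<in> Field r"
    using assms by (auto simp: Field_def)
  then have "is_chain {x, y}"
    using assms refl_r by (simp add: is_chain_def)
  then show thesis
    by (rule chain_extend) (use that in blast)
qed

definition face :: "'a set \<Rightarrow> int \<Rightarrow> 'a" where
  "face \<Psi> i = (THE x. x \<in> \<Psi> \<and> rk x = i)"

lemma face:
  assumes "flag r \<Psi>" "i \<in> {-1, 0, 1, 2, 3}"
  shows "face \<Psi> i \<in> \<Psi>" "rk (face \<Psi> i) = i"
proof -
  have "\<exists>!x. x \<in> \<Psi> \<and> rk x = i"
  proof (rule ex_ex1I)
    show "\<exists>x. x \<in> \<Psi> \<and> rk x = i"
      using assms(2) unfolding flag_rk_image[OF assms(1), symmetric] by blast
  qed (use flag_inj[OF assms(1)] in metis)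
  from theI'[OF this] show "face \<Psi> i \<in> \<Psi>" "rk (face \<Psi> i) = i"
    unfolding face_def by blast+
qed

lemma face_eqI: "flag r \<Psi> \<Longrightarrow> x \<in> \<Psi> \<Longrightarrow> face \<Psi> (rk x) = x"
  using face flag_inj rk_mem flag_Field by metis

lemma flag_subset_imp_eq:
  assumes "flag r \<Psi>" "flag r \<Theta>" "\<Psi> \<subseteq> \<Theta>"
  shows "\<Psi> = \<Theta>"
  using assms card_subset_eq[OF finite_chain] by (simp add: flag_iff)

lemma flag_eqI:
  assumes "flag r \<Psi>" "flag r \<Theta>" "\<And>i. i \<in> {-1, 0, 1, 2, 3} \<Longrightarrow> face \<Psi> i = face \<Theta> i"
  shows "\<Psi> = \<Theta>"
proof (rule flag_subset_imp_eq[OF assms(1,2)])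
  show "\<Psi> \<subseteq> \<Theta>"
    using assms face face_eqI flag_Field rk_mem by (metis subsetI)
qed

lemma face_extreme:
  assumes "flag r \<Psi>" "flag r \<Theta>"
  shows "face \<Psi> (-1) = face \<Theta> (-1)" "face \<Psi> 3 = face \<Theta> 3"
proof -
  obtain b where b: "b \<in> Field r" "\<And>y. y \<in> Field r \<Longrightarrow> (b, y) \<in> r"
    using P1_least by blast
  obtain t where t: "t \<in> Field r" "\<And>y. y \<in> Field r \<Longrightarrow> (y, t) \<in> r"
    using P1_greatest by blast
  have "face \<Psi> (-1) = b \<and> face \<Psi> 3 = t" if "flag r \<Psi>" for \<Psi>
  proof
    have f: "face \<Psi> (-1) \<in> Field r" "rk (face \<Psi> (-1)) = -1" "face \<Psi> 3 \<in> Field r" "rk (face \<Psi> 3) = 3"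
      using face[OF that] flag_Field[OF that] by simp_all
    have "rk b = -1"
      using rk_le[OF b(2)[OF f(1)]] f(2) rk_mem[OF b(1)] by auto
    then show "face \<Psi> (-1) = b"
      using rk_eq_imp_eq b(2)[OF f(1)] f(2) by metis
    have "rk t = 3"
      using rk_le[OF t(2)[OF f(3)]] f(4) rk_mem[OF t(1)] by auto
    then show "face \<Psi> 3 = t"
      using rk_eq_imp_eq t(2)[OF f(3)] f(4) by metis
  qed
  then show "face \<Psi> (-1) = face \<Theta> (-1)" "face \<Psi> 3 = face \<Theta> 3"
    using assms by simp_all
qed

section \<open>The diamond condition and adjacent flags\<close>

text \<open>P4 leaves only two faces of rank \<open>i\<close> between the common neighbours, so two
  flags that both avoid one of them share the other.\<close>

lemma diamond:
  assumes i: "i \<in> {0, 1, 2}" and \<Psi>: "flag r \<Psi>\<^sub>1" "flag r \<Psi>\<^sub>2" "flag r \<Psi>\<^sub>3"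
    and lo: "face \<Psi>\<^sub>2 (i - 1) = face \<Psi>\<^sub>1 (i - 1)" "face \<Psi>\<^sub>3 (i - 1) = face \<Psi>\<^sub>1 (i - 1)"
    and hi: "face \<Psi>\<^sub>2 (i + 1) = face \<Psi>\<^sub>1 (i + 1)" "face \<Psi>\<^sub>3 (i + 1) = face \<Psi>\<^sub>1 (i + 1)"
    and ne: "face \<Psi>\<^sub>2 i \<noteq> face \<Psi>\<^sub>1 i" "face \<Psi>\<^sub>3 i \<noteq> face \<Psi>\<^sub>1 i"
  shows "face \<Psi>\<^sub>2 i = face \<Psi>\<^sub>3 i"
proof -
  let ?F = "face \<Psi>\<^sub>1 (i - 1)" and ?G = "face \<Psi>\<^sub>1 (i + 1)"
  let ?S = "{H \<in> Field r. rk H = i \<and> (?F, H) \<in> r - Id \<and> (H, ?G) \<in> r - Id}"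
  have ranks: "i \<in> {-1, 0, 1, 2, 3}" "i - 1 \<in> {-1, 0, 1, 2, 3}" "i + 1 \<in> {-1, 0, 1, 2, 3}"
    using i by auto
  have between: "(face \<Psi> (i - 1), face \<Psi> i) \<in> r - Id \<and> (face \<Psi> i, face \<Psi> (i + 1)) \<in> r - Id \<and>
      (face \<Psi> (i - 1), face \<Psi> (i + 1)) \<in> r - Id \<and> face \<Psi> i \<in> Field r \<and> rk (face \<Psi> i) = i"
    if "flag r \<Psi>" for \<Psi>
  proof -
    note f = face[OF that ranks(1)] face[OF that ranks(2)] face[OF that ranks(3)]
    have "face \<Psi> (i - 1) \<noteq> face \<Psi> i" "face \<Psi> i \<noteq> face \<Psi> (i + 1)" "face \<Psi> (i - 1) \<noteq> face \<Psi> (i + 1)"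
      using f by fastforce+
    then show ?thesis
      using f flag_le_iff[OF that] flag_Field[OF that] by simp
  qed
  have "card ?S = 2"
    using between[OF \<Psi>(1)] face(2)[OF \<Psi>(1) ranks(2)] face(2)[OF \<Psi>(1) ranks(3)]
    by (intro P4[OF i]) simp_all
  then obtain x y where S: "?S = {x, y}"
    unfolding card_2_iff by blast
  have "face \<Psi>\<^sub>1 i \<in> {x, y}" "face \<Psi>\<^sub>2 i \<in> {x, y}" "face \<Psi>\<^sub>3 i \<in> {x, y}"
    unfolding S[symmetric] using between[OF \<Psi>(1)] between[OF \<Psi>(2)] between[OF \<Psi>(3)] lo hi by simp_all
  then show ?thesis
    using ne by (metis insertE singletonD)
qed

abbreviation adj :: "int \<Rightarrow> 'a set \<Rightarrow> 'a set" where
  "adj \<equiv> adj_flag r rk"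

text \<open>The face of rank \<open>i\<close> is exchanged for the second one supplied by P4, which
  is comparable with the rest of the flag through the neighbours in ranks \<open>i - 1\<close> and
  \<open>i + 1\<close>.\<close>

lemma adj_ex:
  assumes i: "i \<in> {0, 1, 2}" and \<Psi>: "flag r \<Psi>"
  shows "\<exists>\<Theta>. flag r \<Theta> \<and> \<Theta> \<noteq> \<Psi> \<and> {x \<in> \<Theta>. rk x \<noteq> i} = {x \<in> \<Psi>. rk x \<noteq> i}"
proof -
  let ?F = "face \<Psi> (i - 1)" and ?G = "face \<Psi> (i + 1)" and ?x = "face \<Psi> i"
  let ?S = "{H \<in> Field r. rk H = i \<and> (?F, H) \<in> r - Id \<and> (H, ?G) \<in> r - Id}"
  have ranks: "i \<in> {-1, 0, 1, 2, 3}" "i - 1 \<in> {-1, 0, 1, 2, 3}" "i + 1 \<in> {-1, 0, 1, 2, 3}"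
    using i by auto
  note F = face[OF \<Psi> ranks(2)] and G = face[OF \<Psi> ranks(3)] and x = face[OF \<Psi> ranks(1)]
  have "?F \<noteq> ?G"
    using F G by fastforce
  then have "(?F, ?G) \<in> r - Id"
    using F G flag_le_iff[OF \<Psi>] by simp
  then have "card ?S = 2"
    using F G by (intro P4[OF i]) simp_all
  then obtain y where y: "y \<in> ?S" "y \<noteq> ?x"
    by (auto simp: card_2_iff)
  let ?\<Theta> = "insert y (\<Psi> - {?x})"
  have y_notin: "y \<notin> \<Psi>"
    using y face_eqI[OF \<Psi>, of y] by auto
  have comp: "(w, y) \<in> r \<or> (y, w) \<in> r" if w: "w \<in> \<Psi>" "w \<noteq> ?x" for w
  proof -
    have "rk w \<noteq> i"
      using w face_eqI[OF \<Psi>, of w] by auto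
    then consider "rk w \<le> i - 1" | "i + 1 \<le> rk w" by linarith
    then show ?thesis
    proof cases
      case 1
      then have "(w, ?F) \<in> r"
        using flag_le_iff[OF \<Psi>] w F by simp
      then show ?thesis
        using y trans_r by blast
    next
      case 2
      then have "(?G, w) \<in> r"
        using flag_le_iff[OF \<Psi>] w G by simp
      then show ?thesis
        using y trans_r by blast
    qed
  qed
  have "is_chain ?\<Theta>"
    using flag_chain[OF \<Psi>] y(1) comp refl_r unfolding is_chain_def by blast
  moreover have "card ?\<Theta> = 5"
    using \<Psi> y_notin x finite_chain[OF flag_chain[OF \<Psi>]] by (simp add: flag_iff card_Diff_singleton)
  ultimately have "flag r ?\<Theta>"
    by (simp add: flag_iff)
  moreover have "?\<Theta> \<noteq> \<Psi>"
    using y_notin by blast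
  moreover have "{w \<in> ?\<Theta>. rk w \<noteq> i} = {w \<in> \<Psi>. rk w \<noteq> i}"
    using x y(1) by auto
  ultimately show ?thesis by blast
qed

lemma same_faces:
  assumes "flag r \<Psi>" "flag r \<Theta>" "{x \<in> \<Theta>. rk x \<noteq> i} = {x \<in> \<Psi>. rk x \<noteq> i}"
    and "j \<in> {-1, 0, 1, 2, 3}" "j \<noteq> i"
  shows "face \<Theta> j = face \<Psi> j"
proof -
  have "face \<Theta> j \<in> {x \<in> \<Theta>. rk x \<noteq> i}"
    using face[OF assms(2,4)] assms(5) by simp
  then have "face \<Theta> j \<in> \<Psi>"
    unfolding assms(3) by simp
  then show ?thesis
    using face_eqI[OF assms(1)] face(2)[OF assms(2,4)] by metis
qed

lemma adj_unique:
  assumes i: "i \<in> {0, 1, 2}" and \<Psi>: "flag r \<Psi>"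
    and \<Theta>: "flag r \<Theta>" "\<Theta> \<noteq> \<Psi>" "{x \<in> \<Theta>. rk x \<noteq> i} = {x \<in> \<Psi>. rk x \<noteq> i}"
  shows "adj i \<Psi> = \<Theta>"
  unfolding adj_flag_def
proof (rule the_equality)
  fix \<Xi> assume \<Xi>: "flag r \<Xi> \<and> \<Xi> \<noteq> \<Psi> \<and> {x \<in> \<Xi>. rk x \<noteq> i} = {x \<in> \<Psi>. rk x \<noteq> i}"
  have ne: "face \<Delta> i \<noteq> face \<Psi> i"
    if "flag r \<Delta>" "\<Delta> \<noteq> \<Psi>" "{x \<in> \<Delta>. rk x \<noteq> i} = {x \<in> \<Psi>. rk x \<noteq> i}" for \<Delta>
  proof
    assume "face \<Delta> i = face \<Psi> i"
    then have "face \<Delta> j = face \<Psi> j" if "j \<in> {-1, 0, 1, 2, 3}" for j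
      using same_faces[OF \<Psi> \<open>flag r \<Delta>\<close> \<open>{x \<in> \<Delta>. rk x \<noteq> i} = {x \<in> \<Psi>. rk x \<noteq> i}\<close> that]
      by (cases "j = i") simp_all
    then show False
      using flag_eqI[OF that(1) \<Psi>] that(2) by blast
  qed
  have \<Xi>': "flag r \<Xi>" "\<Xi> \<noteq> \<Psi>" "{x \<in> \<Xi>. rk x \<noteq> i} = {x \<in> \<Psi>. rk x \<noteq> i}"
    using \<Xi> by simp_all
  note \<Xi>_face = same_faces[OF \<Psi> \<Xi>'(1,3)] and \<Theta>_face = same_faces[OF \<Psi> \<Theta>(1,3)]
  have "i - 1 \<in> {-1, 0, 1, 2, 3}" "i + 1 \<in> {-1, 0, 1, 2, 3}" "i - 1 \<noteq> i" "i + 1 \<noteq> i"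
    using i by auto
  then have "face \<Xi> i = face \<Theta> i"
    by (intro diamond[OF i \<Psi> \<Xi>'(1) \<Theta>(1)] \<Xi>_face \<Theta>_face ne[OF \<Xi>'] ne[OF \<Theta>])
  then have "face \<Xi> j = face \<Theta> j" if "j \<in> {-1, 0, 1, 2, 3}" for j
    using \<Xi>_face[OF that] \<Theta>_face[OF that] by (cases "j = i") simp_all
  then show "\<Xi> = \<Theta>"
    by (rule flag_eqI[OF \<Xi>'(1) \<Theta>(1)])
qed (use \<Theta> in blast)

lemma adj:
  assumes "i \<in> {0, 1, 2}" "flag r \<Psi>"
  shows flag_adj: "flag r (adj i \<Psi>)" and adj_neq: "adj i \<Psi> \<noteq> \<Psi>"
    and adj_same: "{x \<in> adj i \<Psi>. rk x \<noteq> i} = {x \<in> \<Psi>. rk x \<noteq> i}"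
  using adj_ex[OF assms] adj_unique[OF assms] by blast+

lemma adj_adj: "i \<in> {0, 1, 2} \<Longrightarrow> flag r \<Psi> \<Longrightarrow> adj i (adj i \<Psi>) = \<Psi>"
  using adj[of i \<Psi>] by (intro adj_unique) auto

lemma adj_mem_iff: "i \<in> {0, 1, 2} \<Longrightarrow> flag r \<Psi> \<Longrightarrow> rk x \<noteq> i \<Longrightarrow> x \<in> adj i \<Psi> \<longleftrightarrow> x \<in> \<Psi>"
  using adj_same by blast

lemma face_adj: "i \<in> {0, 1, 2} \<Longrightarrow> flag r \<Psi> \<Longrightarrow> j \<in> {-1, 0, 1, 2, 3} \<Longrightarrow> j \<noteq> i \<Longrightarrow> face (adj i \<Psi>) j = face \<Psi> j"
  by (rule same_faces[OF _ flag_adj adj_same])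

lemma face_adj_neq: "i \<in> {0, 1, 2} \<Longrightarrow> flag r \<Psi> \<Longrightarrow> face (adj i \<Psi>) i \<noteq> face \<Psi> i"
  using flag_eqI[OF flag_adj] face_adj adj_neq by metis

lemma mem_adj_rk_neq:
  assumes "i \<in> {0, 1, 2}" "flag r \<Psi>" "x \<in> \<Psi>" "x \<in> adj i \<Psi>"
  shows "rk x \<noteq> i"
  using face_adj_neq[OF assms(1,2)] face_eqI[OF assms(2,3)] face_eqI[OF flag_adj[OF assms(1,2)] assms(4)] by metis

text \<open>All flags share their faces of ranks -1 and 3, so only two proper ranks remain to be
  compared. This converts statements about fixed faces into statements about flags.\<close>

lemma eq_or_adj:
  assumes i: "i \<in> {0, 1, 2}" and flags: "flag r \<Psi>" "flag r \<Theta>"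
    and same: "\<And>j. j \<in> {0, 1, 2} \<Longrightarrow> j \<noteq> i \<Longrightarrow> face \<Theta> j = face \<Psi> j"
  shows "\<Theta> = \<Psi> \<or> \<Theta> = adj i \<Psi>"
proof (rule disjCI)
  assume ne: "\<Theta> \<noteq> adj i \<Psi>"
  have all: "face \<Theta> j = face \<Psi> j" if "j \<in> {-1, 0, 1, 2, 3}" "j \<noteq> i" for j
    using that same[of j] face_extreme[OF flags(2,1)] by auto
  have sub: "{x \<in> \<Delta>. rk x \<noteq> i} \<subseteq> {x \<in> \<Delta>'. rk x \<noteq> i}"
    if d: "flag r \<Delta>" "flag r \<Delta>'" "\<And>j. j \<in> {-1, 0, 1, 2, 3} \<Longrightarrow> j \<noteq> i \<Longrightarrow> face \<Delta> j = face \<Delta>' j" for \<Delta> \<Delta>'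
  proof
    fix x assume x: "x \<in> {x \<in> \<Delta>. rk x \<noteq> i}"
    then have "rk x \<in> {-1, 0, 1, 2, 3}"
      using rk_mem flag_Field[OF d(1)] by blast
    then have "x = face \<Delta>' (rk x)" "face \<Delta>' (rk x) \<in> \<Delta>'"
      using d(3)[of "rk x"] face_eqI[OF d(1)] face(1)[OF d(2)] x by auto
    then show "x \<in> {x \<in> \<Delta>'. rk x \<noteq> i}"
      using x by simp
  qed
  have "{x \<in> \<Theta>. rk x \<noteq> i} \<subseteq> {x \<in> \<Psi>. rk x \<noteq> i}"
    by (rule sub[OF flags(2,1)]) (rule all)
  moreover have "{x \<in> \<Psi>. rk x \<noteq> i} \<subseteq> {x \<in> \<Theta>. rk x \<noteq> i}"
    by (rule sub[OF flags]) (rule all[symmetric])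
  ultimately have "{x \<in> \<Theta>. rk x \<noteq> i} = {x \<in> \<Psi>. rk x \<noteq> i}"
    by (rule subset_antisym)
  then show "\<Theta> = \<Psi>"
    using adj_unique[OF i flags] ne by metis
qed

text \<open>The exchange in rank 0 depends only on the faces of ranks -1, 0 and 1, which the
  exchange in rank 2 leaves alone, and symmetrically. This is why \<open>s t\<close> is an
  involution.\<close>

lemma adj_0_2_commute:
  assumes \<Psi>: "flag r \<Psi>"
  shows "adj 0 (adj 2 \<Psi>) = adj 2 (adj 0 \<Psi>)"
proof -
  have flags: "flag r (adj 0 \<Psi>)" "flag r (adj 2 \<Psi>)" "flag r (adj 0 (adj 2 \<Psi>))" "flag r (adj 2 (adj 0 \<Psi>))"
    using \<Psi> by (simp_all add: flag_adj)
  have f0: "face (adj 0 (adj 2 \<Psi>)) 0 = face (adj 0 \<Psi>) 0"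
    by (rule diamond[OF _ \<Psi>])
      (use face_adj_neq[of 0 "adj 2 \<Psi>"] face_adj_neq[of 0 \<Psi>] \<Psi> flags in \<open>simp_all add: face_adj\<close>)
  have f2: "face (adj 2 (adj 0 \<Psi>)) 2 = face (adj 2 \<Psi>) 2"
    by (rule diamond[OF _ \<Psi>])
      (use face_adj_neq[of 2 "adj 0 \<Psi>"] face_adj_neq[of 2 \<Psi>] \<Psi> flags in \<open>simp_all add: face_adj\<close>)
  show ?thesis
    by (rule flag_eqI) (use \<Psi> flags f0 f2 in \<open>auto simp: face_adj\<close>)
qed

lemma adjacent_adj:
  assumes "i \<in> {0, 1, 2}" "flag r \<Psi>"
  shows "adjacent \<Psi> (adj i \<Psi>)"
proof -
  have diff: "\<Delta> - adj i \<Delta> = {face \<Delta> i}" if \<Delta>: "flag r \<Delta>" for \<Delta>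
  proof
    have i: "i \<in> {-1, 0, 1, 2, 3}" using assms(1) by auto
    show "{face \<Delta> i} \<subseteq> \<Delta> - adj i \<Delta>"
      using face[OF \<Delta> i] mem_adj_rk_neq[OF assms(1) \<Delta>] by auto
    show "\<Delta> - adj i \<Delta> \<subseteq> {face \<Delta> i}"
    proof
      fix x assume x: "x \<in> \<Delta> - adj i \<Delta>"
      then have "rk x = i"
        using adj_mem_iff[OF assms(1) \<Delta>] by auto
      then show "x \<in> {face \<Delta> i}"
        using face_eqI[OF \<Delta>, of x] x by auto
    qed
  qed
  show ?thesis
    using diff[OF assms(2)] diff[OF flag_adj[OF assms]] adj_adj[OF assms] by (simp add: adjacent_def)
qed

lemma adjacent_imp_adj:
  assumes flags: "flag r \<Psi>" "flag r \<Theta>" and adjacent: "adjacent \<Psi> \<Theta>"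
  obtains i where "i \<in> {0, 1, 2}" "\<Theta> = adj i \<Psi>"
proof -
  obtain x y where xy: "\<Psi> - \<Theta> = {x}" "\<Theta> - \<Psi> = {y}"
    using adjacent by (auto simp: adjacent_def card_1_singleton_iff)
  have x: "x \<in> \<Psi>" "x \<notin> \<Theta>" using xy by auto
  have rk_x: "rk x \<in> {-1, 0, 1, 2, 3}"
    using rk_mem flag_Field[OF flags(1) x(1)] .
  have same: "face \<Theta> j = face \<Psi> j" if j: "j \<in> {-1, 0, 1, 2, 3}" "j \<noteq> rk x" for j
  proof -
    have "face \<Psi> j \<noteq> x"
      using face(2)[OF flags(1) j(1)] j(2) by auto
    then have "face \<Psi> j \<in> \<Theta>"
      using face(1)[OF flags(1) j(1)] xy(1) by blast
    then show ?thesis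
      using face_eqI[OF flags(2)] face(2)[OF flags(1) j(1)] by metis
  qed
  \<comment> \<open>The least and greatest faces belong to every flag, so the exchanged face has a
    proper rank.\<close>
  have "rk x \<noteq> -1" "rk x \<noteq> 3"
    using face_extreme[OF flags] face(1)[OF flags(2) rk_x] face_eqI[OF flags(1) x(1)] x(2) by metis+
  then have "rk x \<in> {0, 1, 2}" using rk_x by auto
  moreover have "\<Theta> = adj (rk x) \<Psi>"
    using eq_or_adj[OF calculation flags] same x by auto
  ultimately show thesis by (rule that)
qed

text \<open>P3 as an induction rule. Keeping the common faces \<open>C\<close> along the path gives
  connectivity among the flags through a given face, not only among all flags.\<close>

lemma flag_induct:
  assumes flags: "flag r \<Phi>" "flag r \<Psi>" and C: "C \<subseteq> \<Phi>" "C \<subseteq> \<Psi>" and base: "Q \<Phi>"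
    and step: "\<And>\<Theta> i. flag r \<Theta> \<Longrightarrow> C \<subseteq> \<Theta> \<Longrightarrow> i \<in> {0, 1, 2} \<Longrightarrow> C \<subseteq> adj i \<Theta> \<Longrightarrow> Q \<Theta> \<Longrightarrow> Q (adj i \<Theta>)"
  shows "Q \<Psi>"
proof -
  obtain k :: nat and \<Theta> where \<Theta>: "\<Theta> 0 = \<Phi>" "\<Theta> k = \<Psi>"
    and fl: "\<And>j. j \<le> k \<Longrightarrow> flag r (\<Theta> j) \<and> \<Phi> \<inter> \<Psi> \<subseteq> \<Theta> j"
    and adj: "\<And>j. j < k \<Longrightarrow> adjacent (\<Theta> j) (\<Theta> (Suc j))"
    using P3[OF flags] by blast
  have "Q (\<Theta> j)" if "j \<le> k" for j
    using that
  proof (induction j)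
    case 0
    then show ?case using \<Theta>(1) base by simp
  next
    case (Suc j)
    have "flag r (\<Theta> j)" "flag r (\<Theta> (Suc j))" "C \<subseteq> \<Theta> j" "C \<subseteq> \<Theta> (Suc j)"
      using fl[of j] fl[of "Suc j"] Suc.prems C by auto
    moreover obtain i where "i \<in> {0, 1, 2}" "\<Theta> (Suc j) = adj i (\<Theta> j)"
      using adjacent_imp_adj[OF calculation(1,2)] adj[of j] Suc.prems by auto
    ultimately show ?case
      using step[of "\<Theta> j" i] Suc by simp
  qed
  then show ?thesis
    using \<Theta>(2) by blast
qed

section \<open>Automorphisms and their action on flags\<close>

lemma Aut_simps:
  "f \<otimes>\<^bsub>Aut r\<^esub> g = compose (Field r) g f" "\<one>\<^bsub>Aut r\<^esub> = (\<lambda>x\<in>Field r. x)"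
  by (simp_all add: Aut_def)

lemma AutD:
  assumes "f \<in> carrier (Aut r)"
  shows "f \<in> extensional (Field r)" "bij_betw f (Field r) (Field r)"
    "\<And>x y. x \<in> Field r \<Longrightarrow> y \<in> Field r \<Longrightarrow> (f x, f y) \<in> r \<longleftrightarrow> (x, y) \<in> r"
    "\<And>x. x \<in> Field r \<Longrightarrow> f x \<in> Field r" "inj_on f (Field r)"
  using assms by (auto simp: Aut_def Bij_def bij_betw_def)

lemma image_mult:
  assumes "C \<subseteq> Field r"
  shows "(f \<otimes>\<^bsub>Aut r\<^esub> g) ` C = g ` (f ` C)"
  unfolding Aut_simps image_image using assms by (intro image_cong) (auto simp: compose_eq)

lemma image_one: "C \<subseteq> Field r \<Longrightarrow> \<one>\<^bsub>Aut r\<^esub> ` C = C"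
  unfolding Aut_simps by (auto simp: subset_iff)

lemma flag_subset: "flag r \<Psi> \<Longrightarrow> \<Psi> \<subseteq> Field r"
  using flag_Field by blast

lemma flag_image:
  assumes f: "f \<in> carrier (Aut r)" and \<Psi>: "flag r \<Psi>"
  shows "flag r (f ` \<Psi>)"
proof -
  have "is_chain (f ` \<Psi>)"
    using flag_chain[OF \<Psi>] AutD(3,4)[OF f] unfolding is_chain_def by (auto simp: subset_iff)
  moreover have "card (f ` \<Psi>) = 5"
    using \<Psi> card_image[OF inj_on_subset[OF AutD(5)[OF f] flag_subset[OF \<Psi>]]] by (simp add: flag_iff)
  ultimately show ?thesis
    by (simp add: flag_iff)
qed

text \<open>An order-theoretic description of the rank within a flag: the ranks from -1 to
  \<open>rk x\<close> occur below \<open>x\<close>, itself included. It yields that automorphisms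
  preserve the rank, which \<open>Aut\<close> does not mention.\<close>

lemma card_below:
  assumes \<Psi>: "flag r \<Psi>" and x: "x \<in> \<Psi>"
  shows "int (card {y \<in> \<Psi>. (y, x) \<in> r}) = rk x + 2"
proof -
  have "rk ` {y \<in> \<Psi>. (y, x) \<in> r} = {-1..rk x}"
  proof
    show "rk ` {y \<in> \<Psi>. (y, x) \<in> r} \<subseteq> {-1..rk x}"
    proof
      fix i assume "i \<in> rk ` {y \<in> \<Psi>. (y, x) \<in> r}"
      then obtain y where "y \<in> \<Psi>" "(y, x) \<in> r" "i = rk y" by blast
      then show "i \<in> {-1..rk x}"
        using rk_le[of y x] rk_mem[OF flag_Field[OF \<Psi>, of y]] by auto
    qed
    show "{-1..rk x} \<subseteq> rk ` {y \<in> \<Psi>. (y, x) \<in> r}"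
    proof
      fix i assume i: "i \<in> {-1..rk x}"
      then have "i \<in> {-1, 0, 1, 2, 3}"
        using rk_mem[OF flag_Field[OF \<Psi> x]] by auto
      note f = face[OF \<Psi> this]
      have "(face \<Psi> i, x) \<in> r"
        using flag_le_iff[OF \<Psi> f(1) x] f(2) i by simp
      then show "i \<in> rk ` {y \<in> \<Psi>. (y, x) \<in> r}"
        using f by (intro image_eqI[of _ _ "face \<Psi> i"]) simp_all
    qed
  qed
  moreover have "inj_on rk {y \<in> \<Psi>. (y, x) \<in> r}"
    by (rule inj_on_subset[OF chain_inj_rk[OF flag_chain[OF \<Psi>]]]) blast
  ultimately have "card {y \<in> \<Psi>. (y, x) \<in> r} = card {-1..rk x}"
    using card_image[of rk "{y \<in> \<Psi>. (y, x) \<in> r}"] by simp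
  then show ?thesis
    using rk_mem[OF flag_Field[OF \<Psi> x]] by auto
qed

lemma rk_image:
  assumes f: "f \<in> carrier (Aut r)" and x: "x \<in> Field r"
  shows "rk (f x) = rk x"
proof -
  obtain \<Psi> where \<Psi>: "flag r \<Psi>" "x \<in> \<Psi>"
    by (rule flag_containing[OF x])
  have "{y \<in> f ` \<Psi>. (y, f x) \<in> r} = f ` {y \<in> \<Psi>. (y, x) \<in> r}"
    using AutD(3)[OF f _ x] flag_Field[OF \<Psi>(1)] by auto
  moreover have "inj_on f {y \<in> \<Psi>. (y, x) \<in> r}"
    using flag_Field[OF \<Psi>(1)] by (intro inj_on_subset[OF AutD(5)[OF f]]) blast
  ultimately have "card {y \<in> f ` \<Psi>. (y, f x) \<in> r} = card {y \<in> \<Psi>. (y, x) \<in> r}"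
    by (simp add: card_image)
  then show ?thesis
    using card_below[OF \<Psi>] card_below[OF flag_image[OF f \<Psi>(1)], of "f x"] \<Psi>(2) by simp
qed

lemma face_image:
  assumes f: "f \<in> carrier (Aut r)" and \<Psi>: "flag r \<Psi>" and i: "i \<in> {-1, 0, 1, 2, 3}"
  shows "face (f ` \<Psi>) i = f (face \<Psi> i)"
  using face[OF \<Psi> i] face_eqI[OF flag_image[OF f \<Psi>], of "f (face \<Psi> i)"] rk_image[OF f flag_Field[OF \<Psi>]] by simp

lemma adj_image:
  assumes f: "f \<in> carrier (Aut r)" and \<Psi>: "flag r \<Psi>" and i: "i \<in> {0, 1, 2}"
  shows "adj i (f ` \<Psi>) = f ` adj i \<Psi>"
proof (rule adj_unique[OF i flag_image[OF f \<Psi>] flag_image[OF f flag_adj[OF i \<Psi>]]])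
  show "f ` adj i \<Psi> \<noteq> f ` \<Psi>"
    using inj_on_image_eq_iff[OF AutD(5)[OF f]] flag_subset[OF \<Psi>] flag_subset[OF flag_adj[OF i \<Psi>]]
      adj_neq[OF i \<Psi>] by blast
  have "{x \<in> f ` \<Delta>. rk x \<noteq> i} = f ` {x \<in> \<Delta>. rk x \<noteq> i}" if "flag r \<Delta>" for \<Delta>
    using rk_image[OF f] flag_Field[OF that] by auto
  then show "{x \<in> f ` adj i \<Psi>. rk x \<noteq> i} = {x \<in> f ` \<Psi>. rk x \<noteq> i}"
    using \<Psi> flag_adj[OF i \<Psi>] adj_same[OF i \<Psi>] by simp
qed

text \<open>Automorphisms commute with adjacency, so by connectivity fixing one flag means fixing
  all flags and hence all faces. The action on flags is therefore free.\<close>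

lemma Aut_eq_one_if_fixes_flag:
  assumes f: "f \<in> carrier (Aut r)" and \<Phi>: "flag r \<Phi>" and fixed: "f ` \<Phi> = \<Phi>"
  shows "f = \<one>\<^bsub>Aut r\<^esub>"
proof -
  have all: "f ` \<Psi> = \<Psi>" if "flag r \<Psi>" for \<Psi>
    by (rule flag_induct[OF \<Phi> that, of "{}"]) (use fixed in \<open>simp_all flip: adj_image[OF f]\<close>)
  have "f x = x" if x: "x \<in> Field r" for x
  proof -
    obtain \<Psi> where "flag r \<Psi>" "x \<in> \<Psi>"
      by (rule flag_containing[OF x])
    then show ?thesis
      using all[of \<Psi>] flag_inj[of \<Psi> "f x" x] rk_image[OF f x] by blast
  qed
  then show ?thesis
    using AutD(1)[OF f] unfolding Aut_simps by (auto simp: extensional_def fun_eq_iff)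
qed

text \<open>
  A face of rank \<open>i\<close> amounts to a class of flags connected by \<open>j\<close>-adjacencies with \<open>j \<noteq> i\<close>, so a map
  on flags commuting with all adjacencies acts on faces.
\<close>

lemma automorphism_of_flag_map:
  assumes \<Phi>: "flag r \<Phi>" and F: "\<And>\<Psi>. flag r \<Psi> \<Longrightarrow> flag r (F \<Psi>)"
    and comm: "\<And>\<Psi> i. flag r \<Psi> \<Longrightarrow> i \<in> {0, 1, 2} \<Longrightarrow> F (adj i \<Psi>) = adj i (F \<Psi>)"
    and inv: "F (F \<Phi>) = \<Phi>"
  obtains \<rho> where "\<rho> \<in> carrier (Aut r)" "\<rho> ` \<Phi> = F \<Phi>"
proof -
  \<comment> \<open>The involution property is assumed at the base flag only; commutation with
    adjacency carries it to all flags, and it makes the induced map on faces its own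
    inverse.\<close>
  have FF: "F (F \<Psi>) = \<Psi>" if "flag r \<Psi>" for \<Psi>
    by (rule flag_induct[OF \<Phi> that, of "{}"]) (use inv comm F in simp_all)
  define \<rho> where "\<rho> = (\<lambda>x\<in>Field r. face (F (SOME \<Psi>. flag r \<Psi> \<and> x \<in> \<Psi>)) (rk x))"
  have \<rho>: "\<rho> x = face (F \<Psi>) (rk x)" if \<Psi>: "flag r \<Psi>" "x \<in> \<Psi>" for \<Psi> x
  proof -
    have x: "x \<in> Field r"
      by (rule flag_Field[OF \<Psi>])
    define \<Theta> where "\<Theta> = (SOME \<Psi>. flag r \<Psi> \<and> x \<in> \<Psi>)"
    have \<Theta>: "flag r \<Theta> \<and> x \<in> \<Theta>"
      unfolding \<Theta>_def by (rule someI[of _ \<Psi>]) (use \<Psi> in blast)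
    have "face (F \<Theta>) (rk x) = face (F \<Psi>) (rk x)"
    proof (rule flag_induct[where C = "{x}" and \<Phi> = \<Psi> and \<Psi> = \<Theta>])
      fix \<Delta> i assume \<Delta>: "flag r \<Delta>" "{x} \<subseteq> \<Delta>" "i \<in> {0, 1, 2}" "{x} \<subseteq> adj i \<Delta>"
        and IH: "face (F \<Delta>) (rk x) = face (F \<Psi>) (rk x)"
      have "rk x \<noteq> i"
        using mem_adj_rk_neq[OF \<Delta>(3,1)] \<Delta>(2,4) by blast
      then show "face (F (adj i \<Delta>)) (rk x) = face (F \<Psi>) (rk x)"
        using comm[OF \<Delta>(1,3)] face_adj[OF \<Delta>(3) F[OF \<Delta>(1)] rk_mem[OF x]] IH by simp
    qed (use \<Psi> \<Theta> in simp_all)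
    then show ?thesis
      using x by (simp add: \<rho>_def \<Theta>_def)
  qed
  have mem: "\<rho> x \<in> F \<Psi>" and rk: "rk (\<rho> x) = rk x" if \<Psi>: "flag r \<Psi>" "x \<in> \<Psi>" for \<Psi> x
    using face[OF F[OF \<Psi>(1)] rk_mem[OF flag_Field[OF \<Psi>]]] \<rho>[OF \<Psi>] by simp_all
  have closed: "\<rho> x \<in> Field r" if "x \<in> Field r" for x
  proof -
    obtain \<Psi> where "flag r \<Psi>" "x \<in> \<Psi>"
      by (rule flag_containing[OF \<open>x \<in> Field r\<close>])
    then show ?thesis
      using mem F flag_Field by blast
  qed
  have invol: "\<rho> (\<rho> x) = x" if "x \<in> Field r" for x
  proof -
    obtain \<Psi> where \<Psi>: "flag r \<Psi>" "x \<in> \<Psi>"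
      by (rule flag_containing[OF \<open>x \<in> Field r\<close>])
    show ?thesis
      using mem[OF F[OF \<Psi>(1)] mem[OF \<Psi>]] rk[OF F[OF \<Psi>(1)] mem[OF \<Psi>]] rk[OF \<Psi>] FF[OF \<Psi>(1)]
        flag_inj[OF \<Psi>(1) _ \<Psi>(2)] by simp
  qed
  have mono: "(\<rho> x, \<rho> y) \<in> r" if "(x, y) \<in> r" for x y
  proof -
    obtain \<Psi> where \<Psi>: "flag r \<Psi>" "x \<in> \<Psi>" "y \<in> \<Psi>"
      by (rule flag_containing_pair[OF \<open>(x, y) \<in> r\<close>])
    show ?thesis
      using flag_le_iff[OF F[OF \<Psi>(1)] mem[OF \<Psi>(1,2)] mem[OF \<Psi>(1,3)]] rk[OF \<Psi>(1,2)] rk[OF \<Psi>(1,3)]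
        rk_le[OF that] by simp
  qed
  have "\<rho> \<in> carrier (Aut r)"
  proof -
    have "bij_betw \<rho> (Field r) (Field r)"
      by (rule bij_betw_byWitness[of _ \<rho>]) (use invol closed in auto)
    moreover have "\<rho> \<in> extensional (Field r)"
      by (simp add: \<rho>_def)
    moreover have "(x, y) \<in> r \<longleftrightarrow> (\<rho> x, \<rho> y) \<in> r" if "x \<in> Field r" "y \<in> Field r" for x y
      using mono[of x y] mono[of "\<rho> x" "\<rho> y"] invol that by auto
    ultimately show ?thesis
      by (simp add: Aut_def Bij_def)
  qed
  moreover have "\<rho> ` \<Phi> = F \<Phi>"
    by (rule flag_subset_imp_eq[OF flag_image[OF calculation \<Phi>] F[OF \<Phi>]]) (use mem[OF \<Phi>] in blast)
  ultimately show thesis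
    by (rule that)
qed

end

section \<open>Flag orbits and generators of a chiral polyhedron\<close>

locale chiral_polyhedron_generators = chiral_polyhedron r rk for r :: "'a rel" and rk +
  fixes \<Phi> :: "'a set" and s t :: "'a \<Rightarrow> 'a"
  assumes \<Phi>: "flag r \<Phi>" and generators: "distinguished_generators r rk \<Phi> s t"
begin

abbreviation G :: "('a \<Rightarrow> 'a) monoid" where "G \<equiv> Aut r"

sublocale G: group "Aut r" by (rule group_Aut)

lemma s_in: "s \<in> carrier G" and t_in: "t \<in> carrier G"
  and s_\<Phi>: "s ` \<Phi> = adj 0 (adj 1 \<Phi>)" and t_\<Phi>: "t ` \<Phi> = adj 1 (adj 2 \<Phi>)"
  using generators by (simp_all add: distinguished_generators_def)

definition \<Phi>\<^sub>1 :: "'a set" where "\<Phi>\<^sub>1 = adj 1 \<Phi>"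

lemma \<Phi>\<^sub>1: "flag r \<Phi>\<^sub>1"
  unfolding \<Phi>\<^sub>1_def by (rule flag_adj[OF _ \<Phi>]) simp

lemma image_mult_flag: "flag r \<Psi> \<Longrightarrow> (f \<otimes>\<^bsub>G\<^esub> g) ` \<Psi> = g ` (f ` \<Psi>)"
  by (rule image_mult[OF flag_subset])

lemma flag_image_\<Phi>: "g \<in> carrier G \<Longrightarrow> flag r (g ` \<Phi>)" "g \<in> carrier G \<Longrightarrow> flag r (g ` \<Phi>\<^sub>1)"
  using flag_image \<Phi> \<Phi>\<^sub>1 by blast+

lemma orbit_image:
  assumes g: "g \<in> carrier G" and \<Psi>: "flag r \<Psi>"
  shows "orbit G (\<lambda>f \<Phi>. f ` \<Phi>) (g ` \<Psi>) = orbit G (\<lambda>f \<Phi>. f ` \<Phi>) \<Psi>"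
proof -
  have "h ` (g ` \<Psi>) \<in> orbit G (\<lambda>f \<Phi>. f ` \<Phi>) \<Psi>" if "h \<in> carrier G" for h
    using image_mult_flag[OF \<Psi>, of g h] g that G.m_closed unfolding orbit_def by blast
  moreover have "h ` \<Psi> \<in> orbit G (\<lambda>f \<Phi>. f ` \<Phi>) (g ` \<Psi>)" if h: "h \<in> carrier G" for h
  proof -
    have "g \<otimes>\<^bsub>G\<^esub> (inv\<^bsub>G\<^esub> g \<otimes>\<^bsub>G\<^esub> h) = h"
      using g h by (simp flip: G.m_assoc)
    then have "h ` \<Psi> = (inv\<^bsub>G\<^esub> g \<otimes>\<^bsub>G\<^esub> h) ` (g ` \<Psi>)"
      using image_mult_flag[OF \<Psi>, of g "inv\<^bsub>G\<^esub> g \<otimes>\<^bsub>G\<^esub> h"] by simp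
    moreover have "inv\<^bsub>G\<^esub> g \<otimes>\<^bsub>G\<^esub> h \<in> carrier G"
      using g h by simp
    ultimately show ?thesis
      unfolding orbit_def by blast
  qed
  ultimately show ?thesis
    by (auto simp: orbit_def)
qed

lemma image_neq_adj:
  assumes "g \<in> carrier G" "flag r \<Psi>" "i \<in> {0, 1, 2}"
  shows "g ` \<Psi> \<noteq> adj i \<Psi>"
  using orbit_image[OF assms(1,2)] adjacent_orbits_differ[OF assms(2) flag_adj[OF assms(3,2)] adjacent_adj[OF assms(3,2)]]
  by metis

lemma image_eq_iff:
  assumes g: "g \<in> carrier G" and h: "h \<in> carrier G" and \<Psi>: "flag r \<Psi>"
  shows "g ` \<Psi> = h ` \<Psi> \<longleftrightarrow> g = h"
proof
  assume eq: "g ` \<Psi> = h ` \<Psi>"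
  have "(g \<otimes>\<^bsub>G\<^esub> inv\<^bsub>G\<^esub> h) ` \<Psi> = (h \<otimes>\<^bsub>G\<^esub> inv\<^bsub>G\<^esub> h) ` \<Psi>"
    using eq by (simp only: image_mult_flag[OF \<Psi>])
  also have "\<dots> = \<Psi>"
    using h image_one[OF flag_subset[OF \<Psi>]] by simp
  finally have "g \<otimes>\<^bsub>G\<^esub> inv\<^bsub>G\<^esub> h = \<one>\<^bsub>G\<^esub>"
    using g h by (intro Aut_eq_one_if_fixes_flag[OF _ \<Psi>]) simp_all
  then show "g = h"
    using g h by (metis G.inv_equality G.inv_closed G.inv_inv)
qed simp

lemma image_\<Phi>_neq:
  assumes g: "g \<in> carrier G" and h: "h \<in> carrier G"
  shows "g ` \<Phi> \<noteq> h ` \<Phi>\<^sub>1"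
proof
  assume eq: "g ` \<Phi> = h ` \<Phi>\<^sub>1"
  have "(g \<otimes>\<^bsub>G\<^esub> inv\<^bsub>G\<^esub> h) ` \<Phi> = (h \<otimes>\<^bsub>G\<^esub> inv\<^bsub>G\<^esub> h) ` \<Phi>\<^sub>1"
    using eq by (simp only: image_mult_flag[OF \<Phi>] image_mult_flag[OF \<Phi>\<^sub>1])
  also have "\<dots> = adj 1 \<Phi>"
    using h image_one[OF flag_subset[OF \<Phi>\<^sub>1]] by (simp add: \<Phi>\<^sub>1_def)
  finally show False
    using image_neq_adj[OF _ \<Phi>, of "g \<otimes>\<^bsub>G\<^esub> inv\<^bsub>G\<^esub> h" 1] g h by simp
qed

text \<open>Automorphisms act on the right and commute with adjacency, so the relation at the base
  flag is transported by \<open>g\<close> and the new factor stands on its left. The rules with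
  inverses come from applying the same adjacency twice.\<close>

lemma adj_rules:
  assumes g: "g \<in> carrier G"
  shows "adj 0 (g ` \<Phi>\<^sub>1) = (s \<otimes>\<^bsub>G\<^esub> g) ` \<Phi>" "adj 0 (g ` \<Phi>) = (inv\<^bsub>G\<^esub> s \<otimes>\<^bsub>G\<^esub> g) ` \<Phi>\<^sub>1"
    "adj 1 (g ` \<Phi>\<^sub>1) = g ` \<Phi>" "adj 1 (g ` \<Phi>) = g ` \<Phi>\<^sub>1"
    "adj 2 (g ` \<Phi>\<^sub>1) = (inv\<^bsub>G\<^esub> t \<otimes>\<^bsub>G\<^esub> g) ` \<Phi>" "adj 2 (g ` \<Phi>) = (t \<otimes>\<^bsub>G\<^esub> g) ` \<Phi>\<^sub>1"
proof -
  have zero: "adj 0 (g ` \<Phi>\<^sub>1) = (s \<otimes>\<^bsub>G\<^esub> g) ` \<Phi>" if "g \<in> carrier G" for g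
    using adj_image[OF that \<Phi>\<^sub>1, of 0] image_mult_flag[OF \<Phi>] s_\<Phi> by (simp add: \<Phi>\<^sub>1_def)
  show "adj 0 (g ` \<Phi>\<^sub>1) = (s \<otimes>\<^bsub>G\<^esub> g) ` \<Phi>"
    by (rule zero[OF g])
  have "adj 0 ((inv\<^bsub>G\<^esub> s \<otimes>\<^bsub>G\<^esub> g) ` \<Phi>\<^sub>1) = g ` \<Phi>"
    using zero[of "inv\<^bsub>G\<^esub> s \<otimes>\<^bsub>G\<^esub> g"] g s_in by (simp flip: G.m_assoc)
  then show "adj 0 (g ` \<Phi>) = (inv\<^bsub>G\<^esub> s \<otimes>\<^bsub>G\<^esub> g) ` \<Phi>\<^sub>1"
    using adj_adj[of 0 "(inv\<^bsub>G\<^esub> s \<otimes>\<^bsub>G\<^esub> g) ` \<Phi>\<^sub>1"] flag_image_\<Phi> g s_in by simp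
  show "adj 1 (g ` \<Phi>) = g ` \<Phi>\<^sub>1"
    using adj_image[OF g \<Phi>, of 1] by (simp add: \<Phi>\<^sub>1_def)
  then show "adj 1 (g ` \<Phi>\<^sub>1) = g ` \<Phi>"
    using adj_adj[of 1 "g ` \<Phi>"] flag_image_\<Phi>[OF g] by simp
  have "t ` \<Phi>\<^sub>1 = adj 2 \<Phi>"
    using adj_image[OF t_in \<Phi>, of 1] t_\<Phi> adj_adj[of 1 "adj 2 \<Phi>"] flag_adj[OF _ \<Phi>, of 2] by (simp add: \<Phi>\<^sub>1_def)
  then have two: "adj 2 (g ` \<Phi>) = (t \<otimes>\<^bsub>G\<^esub> g) ` \<Phi>\<^sub>1" if "g \<in> carrier G" for g
    using adj_image[OF that \<Phi>, of 2] image_mult_flag[OF \<Phi>\<^sub>1] by simp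
  show "adj 2 (g ` \<Phi>) = (t \<otimes>\<^bsub>G\<^esub> g) ` \<Phi>\<^sub>1"
    by (rule two[OF g])
  have "adj 2 ((inv\<^bsub>G\<^esub> t \<otimes>\<^bsub>G\<^esub> g) ` \<Phi>) = g ` \<Phi>\<^sub>1"
    using two[of "inv\<^bsub>G\<^esub> t \<otimes>\<^bsub>G\<^esub> g"] g t_in by (simp flip: G.m_assoc)
  then show "adj 2 (g ` \<Phi>\<^sub>1) = (inv\<^bsub>G\<^esub> t \<otimes>\<^bsub>G\<^esub> g) ` \<Phi>"
    using adj_adj[of 2 "(inv\<^bsub>G\<^esub> t \<otimes>\<^bsub>G\<^esub> g) ` \<Phi>"] flag_image_\<Phi> g t_in by simp
qed

text \<open>Along flags containing \<open>C\<close> no step changes the rank of a face in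
  \<open>C\<close>. A step of rank 0 multiplies by \<open>s\<close> or its inverse, one of rank 2 by
  \<open>t\<close> or its inverse, one of rank 1 by nothing. An empty \<open>C\<close> yields
  generation; the base 2-face alone allows \<langle>s\<rangle> for \<open>H\<close>, the base vertex
  alone \<langle>t\<rangle>.\<close>

lemma flag_cover:
  assumes H: "subgroup H G" and C: "C \<subseteq> \<Phi>" "C \<subseteq> \<Psi>" and \<Psi>: "flag r \<Psi>"
    and step: "(\<exists>x\<in>C. rk x = 0) \<or> s \<in> H" "(\<exists>x\<in>C. rk x = 2) \<or> t \<in> H" "\<forall>x\<in>C. rk x \<noteq> 1"
  shows "\<exists>h\<in>H. \<Psi> = h ` \<Phi> \<or> \<Psi> = h ` \<Phi>\<^sub>1"
proof (rule flag_induct[OF \<Phi> \<Psi> C])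
  show "\<exists>h\<in>H. \<Phi> = h ` \<Phi> \<or> \<Phi> = h ` \<Phi>\<^sub>1"
    using subgroup.one_closed[OF H] image_one[OF flag_subset[OF \<Phi>]] by metis
  fix \<Theta> i assume \<Theta>: "flag r \<Theta>" "C \<subseteq> \<Theta>" "i \<in> {0, 1, 2}" "C \<subseteq> adj i \<Theta>"
    and IH: "\<exists>h\<in>H. \<Theta> = h ` \<Phi> \<or> \<Theta> = h ` \<Phi>\<^sub>1"
  then obtain h where h: "h \<in> H" "\<Theta> = h ` \<Phi> \<or> \<Theta> = h ` \<Phi>\<^sub>1" by blast
  have hG: "h \<in> carrier G"
    using subgroup.mem_carrier[OF H h(1)] .
  have mult: "k \<otimes>\<^bsub>G\<^esub> h \<in> H" "inv\<^bsub>G\<^esub> k \<otimes>\<^bsub>G\<^esub> h \<in> H" if "k \<in> H" for k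
    using that h(1) subgroup.m_closed[OF H] subgroup.m_inv_closed[OF H] by blast+
  have "i = 0 \<Longrightarrow> s \<in> H" "i = 2 \<Longrightarrow> t \<in> H"
    using mem_adj_rk_neq[OF \<Theta>(3,1)] \<Theta>(2,4) step by blast+
  then have "\<exists>k\<in>H. adj i (h ` \<Phi>) = k ` \<Phi>\<^sub>1" "\<exists>k\<in>H. adj i (h ` \<Phi>\<^sub>1) = k ` \<Phi>"
    using \<Theta>(3) adj_rules[OF hG] mult h(1) by (metis insertE singletonD)+
  then show "\<exists>h\<in>H. adj i \<Theta> = h ` \<Phi> \<or> adj i \<Theta> = h ` \<Phi>\<^sub>1"
    using h(2) by blast
qed

lemma generate_eq_carrier: "generate G {s, t} = carrier G"
proof
  have sub: "{s, t} \<subseteq> carrier G"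
    using s_in t_in by simp
  show "generate G {s, t} \<subseteq> carrier G"
    by (rule G.generate_incl[OF sub])
  show "carrier G \<subseteq> generate G {s, t}"
  proof
    fix g assume g: "g \<in> carrier G"
    obtain h where h: "h \<in> generate G {s, t}" "g ` \<Phi> = h ` \<Phi> \<or> g ` \<Phi> = h ` \<Phi>\<^sub>1"
      using flag_cover[OF G.generate_is_subgroup[OF sub], of "{}" "g ` \<Phi>"] flag_image_\<Phi>(1)[OF g]
        generate.incl[of s "{s, t}" G] generate.incl[of t "{s, t}" G] by auto
    then show "g \<in> generate G {s, t}"
      using image_\<Phi>_neq[OF g] image_eq_iff[OF g _ \<Phi>] G.generate_in_carrier[OF sub] by metis
  qed
qed

lemma face_fixed:
  assumes "k \<in> carrier G" "i \<in> {-1, 0, 1, 2, 3}" "face (k ` \<Phi>) i = face \<Phi> i" "h \<in> generate G {k}"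
  shows "h (face \<Phi> i) = face \<Phi> i"
proof -
  let ?x = "face \<Phi> i"
  let ?S = "{h \<in> carrier G. h ?x = ?x}"
  have x: "?x \<in> Field r"
    using face(1)[OF \<Phi> assms(2)] flag_Field[OF \<Phi>] by blast
  have mult: "(f \<otimes>\<^bsub>G\<^esub> g) ?x = g (f ?x)" for f g
    using x by (simp add: Aut_simps compose_eq)
  have "subgroup ?S G"
  proof (rule G.subgroupI)
    have one: "\<one>\<^bsub>G\<^esub> ?x = ?x"
      using x by (simp add: Aut_simps)
    then have "\<one>\<^bsub>G\<^esub> \<in> ?S"
      by simp
    then show "?S \<noteq> {}" by blast
    fix a assume a: "a \<in> ?S"
    have "(a \<otimes>\<^bsub>G\<^esub> inv\<^bsub>G\<^esub> a) ?x = ?x"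
      using a one by simp
    then show "inv\<^bsub>G\<^esub> a \<in> ?S"
      unfolding mult using a by simp
    fix b assume "b \<in> ?S"
    then show "a \<otimes>\<^bsub>G\<^esub> b \<in> ?S"
      using a mult by simp
  qed blast
  moreover have "k \<in> ?S"
    using assms face_image[OF assms(1) \<Phi> assms(2)] by simp
  ultimately have "generate G {k} \<subseteq> ?S"
    by (intro G.generate_subgroup_incl) simp_all
  then show ?thesis
    using assms(4) by blast
qed

lemma face_s: "face (s ` \<Phi>) 2 = face \<Phi> 2" and face_t: "face (t ` \<Phi>) 0 = face \<Phi> 0"
  unfolding s_\<Phi> t_\<Phi> using \<Phi> by (simp_all add: face_adj flag_adj)

text \<open>Both entries of the type at once: \<open>i\<close> is the rank left free, so
  \<open>i = 0\<close> treats the base 2-face with \<open>s\<close>, and \<open>i = 2\<close> the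
  base vertex with \<open>t\<close>. The group \<langle>k\<rangle> acts simply transitively on the
  incident edges; the disjunction covers both directions of incidence.\<close>

lemma card_edges:
  assumes i: "i \<in> {0, 2}" and k: "k = (if i = 0 then s else t)"
  shows "card {E \<in> Field r. rk E = 1 \<and> ((E, face \<Phi> (2 - i)) \<in> r \<or> (face \<Phi> (2 - i), E) \<in> r)} = G.ord k"
proof -
  let ?x = "face \<Phi> (2 - i)" and ?e = "face \<Phi> 1" and ?K = "generate G {k}"
  let ?E = "{E \<in> Field r. rk E = 1 \<and> ((E, ?x) \<in> r \<or> (?x, E) \<in> r)}"
  have ranks: "2 - i \<in> {-1, 0, 1, 2, 3}" "(1::int) \<in> {-1, 0, 1, 2, 3}" "i \<in> {0, 1, 2}"
    using i by auto
  have kG: "k \<in> carrier G"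
    using k s_in t_in by simp
  have K: "subgroup ?K G"
    by (rule G.generate_singleton_subgroup[OF kG])
  have KG: "h \<in> carrier G" if "h \<in> ?K" for h
    using subgroup.mem_carrier[OF K that] .
  have x: "?x \<in> \<Phi>" "rk ?x = 2 - i" and e: "?e \<in> \<Phi>" "rk ?e = 1"
    using face[OF \<Phi> ranks(1)] face[OF \<Phi> ranks(2)] by simp_all
  have fixed: "h ?x = ?x" if "h \<in> ?K" for h
    using i k face_s face_t by (intro face_fixed[OF kG ranks(1) _ that]) auto
  have "inj_on (\<lambda>h. h ?e) ?K"
  proof (rule inj_onI)
    fix g h assume gh: "g \<in> ?K" "h \<in> ?K" "g ?e = h ?e"
    note ghG = KG[OF gh(1)] KG[OF gh(2)]
    have "face (g ` \<Phi>) j = face (h ` \<Phi>) j" if "j \<in> {0, 1, 2}" "j \<noteq> i" for j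
    proof -
      have "j = 1 \<or> j = 2 - i" using that i by auto
      then show ?thesis
      proof
        assume "j = 1"
        then show ?thesis
          using face_image[OF ghG(1) \<Phi> ranks(2)] face_image[OF ghG(2) \<Phi> ranks(2)] gh(3) by simp
      next
        assume "j = 2 - i"
        then show ?thesis
          using face_image[OF ghG(1) \<Phi> ranks(1)] face_image[OF ghG(2) \<Phi> ranks(1)]
            fixed[OF gh(1)] fixed[OF gh(2)] by simp
      qed
    qed
    \<comment> \<open>Flags agreeing outside rank \<open>i\<close> are equal or adjacent, and
      adjacent flags lie in different orbits.\<close>
    then have "g ` \<Phi> = h ` \<Phi> \<or> g ` \<Phi> = adj i (h ` \<Phi>)"
      using ghG flag_image_\<Phi> by (intro eq_or_adj ranks) simp_all
    moreover have "\<exists>k\<in>carrier G. adj i (h ` \<Phi>) = k ` \<Phi>\<^sub>1"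
      using i adj_rules(2,6)[OF ghG(2)] ghG(2) s_in t_in by (metis G.inv_closed G.m_closed insertE singletonD)
    then have "g ` \<Phi> \<noteq> adj i (h ` \<Phi>)"
      using image_\<Phi>_neq[OF ghG(1)] by metis
    ultimately show "g = h"
      using image_eq_iff[OF ghG \<Phi>] by simp
  qed
  moreover have "(\<lambda>h. h ?e) ` ?K = ?E"
  proof
    show "(\<lambda>h. h ?e) ` ?K \<subseteq> ?E"
    proof
      fix E assume "E \<in> (\<lambda>h. h ?e) ` ?K"
      then obtain h where h: "h \<in> ?K" "E = h ?e" by blast
      have "?e \<in> Field r" "?x \<in> Field r" "(?e, ?x) \<in> r \<or> (?x, ?e) \<in> r"
        using flag_Field[OF \<Phi>] x e flag_le_iff[OF \<Phi> x(1) e(1)] flag_le_iff[OF \<Phi> e(1) x(1)] by auto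
      then show "E \<in> ?E"
        using h AutD(3,4)[OF KG[OF h(1)]] fixed[OF h(1)] rk_image[OF KG[OF h(1)]] e(2) by auto metis+
    qed
    show "?E \<subseteq> (\<lambda>h. h ?e) ` ?K"
    proof
      fix E assume E: "E \<in> ?E"
      then obtain \<Psi> where \<Psi>: "flag r \<Psi>" "E \<in> \<Psi>" "?x \<in> \<Psi>"
        using flag_containing_pair by blast
      have "s \<in> ?K \<or> i = 2" "t \<in> ?K \<or> i = 0"
        using i k generate.incl[of k "{k}" G] by auto
      then obtain h where h: "h \<in> ?K" "\<Psi> = h ` \<Phi> \<or> \<Psi> = h ` \<Phi>\<^sub>1"
        using flag_cover[OF K, of "{?x}" \<Psi>] x \<Psi> i by auto
      have "\<exists>h\<in>?K. E \<in> h ` \<Phi>"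
        using h(2)
      proof
        assume \<Psi>_eq: "\<Psi> = h ` \<Phi>\<^sub>1"
        \<comment> \<open>A flag in the orbit of \<open>\<Phi>\<^sub>1\<close> is replaced by its
          \<open>i\<close>-adjacent flag, which lies in the orbit of \<open>\<Phi>\<close> and still
          contains the edge, as \<open>i\<close> is not 1.\<close>
        have "E \<in> adj i \<Psi>"
          using adj_mem_iff[OF ranks(3) \<Psi>(1), of E] \<Psi>(2) E i by auto
        moreover have "\<exists>h'\<in>?K. adj i \<Psi> = h' ` \<Phi>"
        proof -
          have "k \<otimes>\<^bsub>G\<^esub> h \<in> ?K" "inv\<^bsub>G\<^esub> k \<otimes>\<^bsub>G\<^esub> h \<in> ?K"
            using subgroup.m_closed[OF K _ h(1)] subgroup.m_inv_closed[OF K] generate.incl[of k "{k}" G] by simp_all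
          moreover have "adj i \<Psi> = (k \<otimes>\<^bsub>G\<^esub> h) ` \<Phi> \<or> adj i \<Psi> = (inv\<^bsub>G\<^esub> k \<otimes>\<^bsub>G\<^esub> h) ` \<Phi>"
            unfolding \<Psi>_eq using i k adj_rules(1,5)[OF KG[OF h(1)]] by auto
          ultimately show ?thesis by blast
        qed
        ultimately show ?thesis by auto
      qed (use h(1) \<Psi>(2) in blast)
      then obtain h' where h': "h' \<in> ?K" "E \<in> h' ` \<Phi>" by blast
      have "E = h' ?e"
        using face_eqI[OF flag_image_\<Phi>(1)[OF KG[OF h'(1)]] h'(2)] face_image[OF KG[OF h'(1)] \<Phi> ranks(2)] E by simp
      then show "E \<in> (\<lambda>h. h ?e) ` ?K"
        using h'(1) by blast
    qed
  qed
  ultimately have "card ?E = card ?K"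
    using card_image[of "\<lambda>h. h ?e" ?K] by simp
  then show ?thesis
    using G.generate_pow_card[OF kG] by simp
qed

text \<open>The orders of the generators determine the type, with 0 standing for infinity on both
  sides. This uniqueness makes the existential quantifier in \<open>tight\<close> refer to the given
  type.\<close>

lemma has_type_unique:
  assumes "has_type r rk k\<^sub>1 k\<^sub>2"
  shows "k\<^sub>1 = G.ord s" "k\<^sub>2 = G.ord t"
proof -
  let ?F = "face \<Phi> 2" and ?v = "face \<Phi> 0"
  have F: "?F \<in> Field r" "rk ?F = 2" and v: "?v \<in> Field r" "rk ?v = 0"
    using face[OF \<Phi>, of 2] face[OF \<Phi>, of 0] flag_Field[OF \<Phi>] by simp_all
  have "{E \<in> Field r. rk E = 1 \<and> ((E, ?F) \<in> r \<or> (?F, E) \<in> r)} = {E \<in> Field r. rk E = 1 \<and> (E, ?F) \<in> r}"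
    using rk_le F(2) by fastforce
  then show "k\<^sub>1 = G.ord s"
    using card_edges[of 0 s] assms F by (simp add: has_type_def)
  have "{E \<in> Field r. rk E = 1 \<and> ((E, ?v) \<in> r \<or> (?v, E) \<in> r)} = {E \<in> Field r. rk E = 1 \<and> (?v, E) \<in> r}"
    using rk_le v(2) by fastforce
  then show "k\<^sub>2 = G.ord t"
    using card_edges[of 2 t] assms v by (simp add: has_type_def)
qed

text \<open>A common element fixes the base 2-face and the base vertex, so it maps the base flag to
  itself or to its 1-adjacent flag; chirality excludes the latter.\<close>

lemma generate_disjoint: "generate G {s} \<inter> generate G {t} = {\<one>\<^bsub>G\<^esub>}"
proof -
  have "g = \<one>\<^bsub>G\<^esub>" if g: "g \<in> generate G {s}" "g \<in> generate G {t}" for g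
  proof -
    have gG: "g \<in> carrier G"
      using g(1) G.generate_in_carrier[of "{s}"] s_in by simp
    have "face (g ` \<Phi>) j = face \<Phi> j" if "j \<in> {0, 1, 2}" "j \<noteq> 1" for j
    proof -
      have "j = 0 \<or> j = 2" using that by auto
      then show ?thesis
        using face_fixed[OF s_in _ face_s g(1)] face_fixed[OF t_in _ face_t g(2)]
          face_image[OF gG \<Phi>, of j] by (elim disjE) simp_all
    qed
    then have "g ` \<Phi> = \<Phi> \<or> g ` \<Phi> = adj 1 \<Phi>"
      using gG \<Phi> flag_image_\<Phi> by (intro eq_or_adj) simp_all
    then show ?thesis
      using image_neq_adj[OF gG \<Phi>, of 1] Aut_eq_one_if_fixes_flag[OF gG \<Phi>] by simp
  qed
  then show ?thesis
    using generate.one by blast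
qed

text \<open>\<open>s t\<close> maps the base flag to the one obtained by exchanging its faces of
  ranks 0 and 2. These exchanges commute, so doing it twice restores the flag.\<close>

lemma ord_s_t: "G.ord (s \<otimes>\<^bsub>G\<^esub> t) = 2"
proof -
  let ?u = "s \<otimes>\<^bsub>G\<^esub> t"
  have uG: "?u \<in> carrier G"
    using s_in t_in by simp
  have flags: "flag r (adj 1 \<Phi>)" "flag r (adj 2 \<Phi>)" "flag r (adj 0 \<Phi>)" "flag r (adj 0 (adj 2 \<Phi>))"
    using \<Phi> by (simp_all add: flag_adj)
  have "?u ` \<Phi> = adj 0 (adj 1 (t ` \<Phi>))"
    using image_mult_flag[OF \<Phi>] s_\<Phi> adj_image[OF t_in] \<Phi> flags by simp
  then have u: "?u ` \<Phi> = adj 0 (adj 2 \<Phi>)"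
    unfolding t_\<Phi> using adj_adj flags by simp
  have "(?u \<otimes>\<^bsub>G\<^esub> ?u) ` \<Phi> = adj 0 (adj 2 (?u ` \<Phi>))"
    unfolding image_mult_flag[OF \<Phi>, of ?u] unfolding u
    using adj_image[OF uG flags(2), of 0] adj_image[OF uG \<Phi>, of 2] u by simp
  also have "\<dots> = \<Phi>"
    unfolding u adj_0_2_commute[OF \<Phi>] using adj_adj \<Phi> flags by simp
  finally have "?u \<otimes>\<^bsub>G\<^esub> ?u = \<one>\<^bsub>G\<^esub>"
    using uG by (intro Aut_eq_one_if_fixes_flag[OF _ \<Phi>]) simp_all
  then have "G.ord ?u dvd 2"
    using uG by (simp add: numeral_2_eq_2 flip: G.pow_eq_id)
  moreover have "?u \<noteq> \<one>\<^bsub>G\<^esub>"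
  proof
    assume "?u = \<one>\<^bsub>G\<^esub>"
    then have "adj 0 (adj 2 \<Phi>) = \<Phi>"
      using u image_one[OF flag_subset[OF \<Phi>]] by simp
    then have "face (adj 0 (adj 2 \<Phi>)) 2 = face \<Phi> 2" by simp
    then show False
      using face_adj_neq[of 2 \<Phi>] face_adj[of 0 "adj 2 \<Phi>" 2] \<Phi> flags by simp
  qed
  then have "G.ord ?u \<noteq> 1"
    using uG G.ord_eq_1 by blast
  ultimately show ?thesis
    by (metis prime_nat_iff two_is_prime_nat)
qed

text \<open>An inverting automorphism would make the two orbits interchangeable: sending
  \<open>g\<close> applied to \<open>\<Phi>\<close> to \<open>\<alpha> g\<close> applied to
  \<open>\<Phi>\<^sub>1\<close>, and conversely, respects adjacencies, because inverting
  \<open>s\<close> and \<open>t\<close> swaps the adjacency rules of the two orbits. The induced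
  automorphism moves the base flag to an adjacent one, against chirality.\<close>

lemma no_inverting_automorphism:
  assumes \<alpha>: "\<alpha> \<in> iso G G"
  shows "\<not> (\<alpha> s = inv\<^bsub>G\<^esub> s \<and> \<alpha> t = inv\<^bsub>G\<^esub> t)"
proof
  assume inv: "\<alpha> s = inv\<^bsub>G\<^esub> s \<and> \<alpha> t = inv\<^bsub>G\<^esub> t"
  interpret \<alpha>: group_hom G G \<alpha>
    using \<alpha> by unfold_locales (simp add: iso_def)
  \<comment> \<open>Freeness makes the described \<open>g\<close> unique, and disjointness of the
    orbits makes the case distinction unambiguous.\<close>
  define F where "F \<Psi> = (if \<exists>g\<in>carrier G. \<Psi> = g ` \<Phi>
    then \<alpha> (THE g. g \<in> carrier G \<and> \<Psi> = g ` \<Phi>) ` \<Phi>\<^sub>1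
    else \<alpha> (THE g. g \<in> carrier G \<and> \<Psi> = g ` \<Phi>\<^sub>1) ` \<Phi>)" for \<Psi>
  have F: "F (g ` \<Phi>) = \<alpha> g ` \<Phi>\<^sub>1" "F (g ` \<Phi>\<^sub>1) = \<alpha> g ` \<Phi>" if g: "g \<in> carrier G" for g
  proof -
    have the: "(THE h. h \<in> carrier G \<and> g ` \<Psi> = h ` \<Psi>) = g" if "flag r \<Psi>" for \<Psi>
      by (rule the_equality) (use g image_eq_iff[OF g _ that] in auto)
    have "\<exists>h\<in>carrier G. g ` \<Phi> = h ` \<Phi>"
      using g by blast
    then show "F (g ` \<Phi>) = \<alpha> g ` \<Phi>\<^sub>1"
      unfolding F_def using the[OF \<Phi>] by simp
    have "\<not> (\<exists>h\<in>carrier G. g ` \<Phi>\<^sub>1 = h ` \<Phi>)"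
      using image_\<Phi>_neq[OF _ g] by metis
    then show "F (g ` \<Phi>\<^sub>1) = \<alpha> g ` \<Phi>"
      unfolding F_def using the[OF \<Phi>\<^sub>1] by simp
  qed
  have cover: "\<exists>g\<in>carrier G. \<Psi> = g ` \<Phi> \<or> \<Psi> = g ` \<Phi>\<^sub>1" if "flag r \<Psi>" for \<Psi>
    using flag_cover[OF G.subgroup_self, of "{}" \<Psi>] that s_in t_in by simp
  have \<Phi>_eq: "\<Phi> = \<one>\<^bsub>G\<^esub> ` \<Phi>" "\<Phi>\<^sub>1 = \<one>\<^bsub>G\<^esub> ` \<Phi>\<^sub>1"
    using image_one flag_subset \<Phi> \<Phi>\<^sub>1 by simp_all
  have F_\<Phi>: "F \<Phi> = \<Phi>\<^sub>1" "F \<Phi>\<^sub>1 = \<Phi>"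
    using F[OF G.one_closed] \<Phi>_eq by simp_all
  obtain \<rho> where "\<rho> \<in> carrier G" "\<rho> ` \<Phi> = F \<Phi>"
  proof (rule automorphism_of_flag_map[OF \<Phi>, of F])
    show "flag r (F \<Psi>)" if "flag r \<Psi>" for \<Psi>
      using cover[OF that] F flag_image_\<Phi> by auto
    show "F (F \<Phi>) = \<Phi>"
      using F_\<Phi> by simp
    show "F (adj i \<Psi>) = adj i (F \<Psi>)" if \<Psi>: "flag r \<Psi>" and i: "i \<in> {0, 1, 2}" for \<Psi> i
    proof -
      obtain g where g: "g \<in> carrier G" and \<Psi>_eq: "\<Psi> = g ` \<Phi> \<or> \<Psi> = g ` \<Phi>\<^sub>1"
        using cover[OF \<Psi>] by blast
      have \<alpha>g: "\<alpha> g \<in> carrier G"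
        using g by simp
      from \<Psi>_eq show ?thesis
      proof
        assume "\<Psi> = g ` \<Phi>"
        then show ?thesis
          using i g \<alpha>g s_in t_in inv by (auto simp: adj_rules F)
      next
        assume "\<Psi> = g ` \<Phi>\<^sub>1"
        then show ?thesis
          using i g \<alpha>g s_in t_in inv by (auto simp: adj_rules F)
      qed
    qed
  qed
  then show False
    using F_\<Phi> image_neq_adj[OF _ \<Phi>, of \<rho> 1] by (simp add: \<Phi>\<^sub>1_def)
qed

end

theorem theorem1p1:
  fixes p m k\<^sub>1 k\<^sub>2 :: nat
    and r :: "'a rel" and rk :: "'a \<Rightarrow> int" and \<Phi> :: "'a set"
    and G :: "('a \<Rightarrow> 'a) monoid" and \<sigma>\<^sub>1 \<sigma>\<^sub>2 :: "'a \<Rightarrow> 'a" and P :: "('a \<Rightarrow> 'a) set"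
  assumes "Factorial_Ring.prime p" and "odd p" and "m > 0"
    and "chiral_polyhedron r rk" and "has_type r rk k\<^sub>1 k\<^sub>2"
    and "G = Aut r" and "order G = 2 * p ^ m"
    and "flag r \<Phi>" and "distinguished_generators r rk \<Phi> \<sigma>\<^sub>1 \<sigma>\<^sub>2"
    and "sylow_subgroup p P G"
  shows
    "(P \<lhd> G \<and>
      P \<inter> generate G {\<sigma>\<^sub>1 \<otimes>\<^bsub>G\<^esub> \<sigma>\<^sub>2} = {\<one>\<^bsub>G\<^esub>} \<and>
      carrier G = P <#>\<^bsub>G\<^esub> generate G {\<sigma>\<^sub>1 \<otimes>\<^bsub>G\<^esub> \<sigma>\<^sub>2}) \<and>
     (\<exists>l\<^sub>1 l\<^sub>2. l\<^sub>1 > 0 \<and> l\<^sub>2 > 0 \<and>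
        ((k\<^sub>1, k\<^sub>2) = (p ^ l\<^sub>1, 2 * p ^ l\<^sub>2) \<or> (k\<^sub>1, k\<^sub>2) = (2 * p ^ l\<^sub>2, p ^ l\<^sub>1))) \<and>
     (\<forall>l\<^sub>1 l\<^sub>2. l\<^sub>1 > 0 \<and> l\<^sub>2 > 0 \<longrightarrow>
        ((k\<^sub>1, k\<^sub>2) = (p ^ l\<^sub>1, 2 * p ^ l\<^sub>2) \<longrightarrow> P = generate G {\<sigma>\<^sub>1, \<sigma>\<^sub>2 [^]\<^bsub>G\<^esub> (2::nat)}) \<and>
        ((k\<^sub>1, k\<^sub>2) = (2 * p ^ l\<^sub>2, p ^ l\<^sub>1) \<longrightarrow> P = generate G {\<sigma>\<^sub>2, \<sigma>\<^sub>1 [^]\<^bsub>G\<^esub> (2::nat)})) \<and>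
     (min_gen_size (G\<lparr>carrier := P\<rparr>) = 2 \<and> \<not> comm_group (G\<lparr>carrier := P\<rparr>) \<and> m \<ge> 3) \<and>
     (tight r rk \<longleftrightarrow> k\<^sub>1 * k\<^sub>2 = 2 * p ^ m) \<and>
     (tight r rk \<longleftrightarrow> metacyclic_group (G\<lparr>carrier := P\<rparr>))"
proof -
  interpret chiral_polyhedron r rk by fact
  interpret C: chiral_polyhedron_generators r rk \<Phi> \<sigma>\<^sub>1 \<sigma>\<^sub>2
    by unfold_locales fact+
  have ord: "order (Aut r) = 2 * p ^ m"
    using assms(6,7) by simp
  \<comment> \<open>As \<open>p\<close> is odd, the factor 2 adds nothing to the multiplicity, so
    the Sylow subgroup has order \<open>p^m\<close> and index 2.\<close>
  have "\<not> p dvd 2"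
    using assms(1,2) primes_dvd_imp_eq[OF assms(1) two_is_prime_nat] by auto
  then have "multiplicity p (2 * p ^ m) = m"
    using assms(1) by (simp add: prime_elem_multiplicity_mult_distrib not_dvd_imp_multiplicity_0)
  then have P: "subgroup P (Aut r)" "card P = p ^ m"
    using assms(10) ord unfolding assms(6) sylow_subgroup_def by simp_all
  interpret S: chiral_pair "Aut r" \<sigma>\<^sub>1 \<sigma>\<^sub>2 p m P
    by (intro chiral_pair.intro chiral_pair_axioms.intro group_Aut assms ord C.s_in C.t_in
        C.generate_eq_carrier C.ord_s_t C.generate_disjoint C.no_inverting_automorphism P)
  have k: "C.G.ord \<sigma>\<^sub>1 = k\<^sub>1" "C.G.ord \<sigma>\<^sub>2 = k\<^sub>2"
    using C.has_type_unique[OF assms(5)] by simp_all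
  have "tight r rk \<longleftrightarrow> k\<^sub>1 * k\<^sub>2 = order (Aut r)"
  proof
    assume "tight r rk"
    then obtain k\<^sub>1' k\<^sub>2' where "has_type r rk k\<^sub>1' k\<^sub>2'" "order (Aut r) = k\<^sub>1' * k\<^sub>2'"
      unfolding tight_def by blast
    then show "k\<^sub>1 * k\<^sub>2 = order (Aut r)"
      using C.has_type_unique k by simp
  next
    assume "k\<^sub>1 * k\<^sub>2 = order (Aut r)"
    then show "tight r rk"
      unfolding tight_def using S.fin assms(5) by metis
  qed
  then show ?thesis
    using S.chiral_pair_structure[OF k] unfolding assms(6) ord by blast
qed

end
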